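(* Let $p\in[0,1)\cap\mathbb Q$ and let $M,M'$ be closed $\mathsf{pPCF}$ terms of type $\sigma$. Then $$d^{p}_{\mathrm{obs}}(M,M')\le\frac{p}{1-p}\,d_{\llbracket\sigma\rrbracket}(\llbracket M\rrbracket,\llbracket M'\rrbracket).$$
   Context: **pPCF.** Types $\sigma::=\mathsf{nat}\mid\sigma\Rightarrow\tau$; terms $\underline n$, $\mathsf{succ}(M)$, $\mathsf{pred}(M)$, $x$, $\mathsf{coin}(r)$ ($r\in[0,1]\cap\mathbb Q$), $\mathsf{let}\,x=M\,\mathsf{in}\,N$ ($M:\mathsf{nat}$, $x:\mathsf{nat}$), $\mathsf{if}(M,N,P)$ ($M:\mathsf{nat}$, $N,P:\sigma$), $(M)N$, $\lambda x^\sigma M$, $\mathsf{fix}(M)$ ($M:\sigma\Rightarrow\sigma$), simply typed. $\Omega_\sigma=\mathsf{fix}(\lambda x^\sigma x)$. **Operational semantics.** Stacks $\pi::=\varepsilon\mid\mathsf{arg}(M)\cdot\pi\mid\mathsf{succ}\cdot\pi\mid\mathsf{pred}\cdot\pi\mid\mathsf{if}(N,P)\cdot\pi\mid\mathsf{let}(x,N)\cdot\pi$; states $\langle M,\pi\rangle$ (closed, well-typed, ending in $\mathsf{nat}$). $\mathrm{Eval}(s,\alpha)\in[0,1]$, $\alpha\in\{0,1\}^{<\omega}$, is the least partial function with: let/application/if/fix/succ/pred push onto the stack ($\langle\mathsf{let}\,x=M\,\mathsf{in}\,N,\pi\rangle\to\langle M,\mathsf{let}(x,N)\cdot\pi\rangle$,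 $\langle(M)N,\pi\rangle\to\langle M,\mathsf{arg}(N)\cdot\pi\rangle$, $\langle\mathsf{if}(M,N,P),\pi\rangle\to\langle M,\mathsf{if}(N,P)\cdot\pi\rangle$, $\langle\mathsf{fix}(M),\pi\rangle\to\langle M,\mathsf{arg}(\mathsf{fix}(M))\cdot\pi\rangle$, $\langle\mathsf{succ}(M),\pi\rangle\to\langle M,\mathsf{succ}\cdot\pi\rangle$, same for pred), each meaning $\mathrm{Eval}(\text{lhs},\alpha)=\mathrm{Eval}(\text{rhs},\alpha)$; $\langle\underline n,\mathsf{let}(x,N)\cdot\pi\rangle\to\langle N[\underline n/x],\pi\rangle$; $\langle\lambda x^\sigma M,\mathsf{arg}(N)\cdot\pi\rangle\to\langle M[N/x],\pi\rangle$; $\langle\underline0,\mathsf{if}(N,P)\cdot\pi\rangle\to\langle N,\pi\rangle$; $\langle\underline{n+1},\mathsf{if}(N,P)\cdot\pi\rangle\to\langle P,\pi\rangle$; $\langle\underline n,\mathsf{succ}\cdot\pi\rangle\to\langle\underline{n+1},\pi\rangle$; $\langle\underline0,\mathsf{pred}\cdot\pi\rangle\to\langle\underline0,\pi\rangle$; $\langle\underline{n+1},\mathsf{pred}\cdot\pi\rangle\to\langle\underline n,\pi\rangle$; $\mathrm{Eval}(\langle\mathsf{coin}(r),\pi\rangle,i\alpha)=\mathrm{Eval}(\langle\underline i,\pi\rangle,\alpha)\cdot\rho_i(r)$ with $\rho_0(r)=r$, $\rho_1(r)=1-r$; $\mathrm{Eval}(\langle\underline0,\varepsilon\rangle,\langle\rangle)=1$.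 For closed $M:\mathsf{nat}$, $\mathbb P(M\to\underline0)=\sum\{\mathrm{Eval}(\langle M,\varepsilon\rangle,\alpha)\mid\alpha\text{ where defined}\}$. **Tamed distance.** For closed $C:\sigma\Rightarrow\mathsf{nat}$, $C_p=\lambda z^\sigma(C)\,\mathsf{if}(\mathsf{coin}(p),z,\Omega_\sigma)$, and $d^p_{\mathrm{obs}}(M,M')=\sup_C|\mathbb P((C_p)M\to\underline0)-\mathbb P((C_p)M'\to\underline0)|$ over closed $C:\sigma\Rightarrow\mathsf{nat}$. **PCS semantics.** A PCS $X$: countable $|X|$, $P(X)\subseteq\mathbb R_{\ge0}^{|X|}$ with $P(X)^{\perp\perp}=P(X)$ ($Q^\perp=\{u'\mid\forall u\in Q\ \sum_au_au'_a\le1\}$), $0<\sup_{x\in P(X)}x_a<\infty$. $\mathbf N$: web $\mathbb N$, sub-probability distributions, $e_n$ Dirac. $X\multimap Y$: matrices mapping $P(X)$ into $P(Y)$. $!X$: web finite multisets, $P(!X)=\{x^!\}^{\perp\perp}$, $x^!_\mu=\prod_ax_a^{\mu(a)}$; $t\in P(!X\multimap Y)$ identified with $x\mapsto(\sum_\mu t_{\mu,b}x^\mu)_b$. $\llbracket\mathsf{nat}\rrbracket=\mathbf N$, $\llbracket\sigma\Rightarrow\tau\rrbracket=!\llbracket\sigma\rrbracket\multimap\llbracket\tau\rrbracket$; terms in context $(x_i:\sigma_i)$ denote such functions $\prod_iP(\llbracket\sigma_i\rrbracket)\to P(\llbracket\sigma\rrbracket)$: $\underline n\mapsto e_n$; $x_i\mapsto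 u_i$; $\mathsf{coin}(r)\mapsto re_0+(1-r)e_1$; succ/pred shift the distribution (pred sends $0$ to $0$); $\mathsf{let}\,x=M\,\mathsf{in}\,N\mapsto\sum_n\llbracket M\rrbracket_n\llbracket N[\underline n/x]\rrbracket$; $\mathsf{if}(M,N,P)\mapsto\llbracket M\rrbracket_0\llbracket N\rrbracket+(\sum_n\llbracket M\rrbracket_{n+1})\llbracket P\rrbracket$; application = function application; abstraction = currying; $\mathsf{fix}(M)\mapsto\sup_n\llbracket M\rrbracket^n(0)$. Norm $\|x\|_X=\inf\{r>0\mid x\in rP(X)\}$; distance $d_X(x,y)=\|x-(x\wedge y)\|_X+\|y-(x\wedge y)\|_X$ with $(x\wedge y)_a=\min(x_a,y_a)$. *)

theory Defs
  imports "HOL-Analysis.Analysis" "HOL-Library.Multiset"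
begin

section \<open>Syntax and typing of pPCF\<close>

datatype ty = TNat | TFun ty ty  (infixr "\<rightarrow>" 65)

type_synonym vname = nat

datatype tm =
    Num nat
  | Succ tm
  | Pred tm
  | Var vname
  | Coin rat
  | Let vname tm tm      \<comment> \<open>\<open>Let x M N\<close> is \<open>let x = M in N\<close>\<close>
  | If tm tm tm
  | App tm tm
  | Lam vname ty tm
  | Fix tm

type_synonym ctx = "vname \<rightharpoonup> ty"

inductive typing :: "ctx \<Rightarrow> tm \<Rightarrow> ty \<Rightarrow> bool"  ("_ \<turnstile> _ : _" [50, 50, 50] 50)
where
  T_Num:  "\<Gamma> \<turnstile> Num n : TNat"
| T_Succ: "\<Gamma> \<turnstile> M : TNat \<Longrightarrow> \<Gamma> \<turnstile> Succ M : TNat"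
| T_Pred: "\<Gamma> \<turnstile> M : TNat \<Longrightarrow> \<Gamma> \<turnstile> Pred M : TNat"
| T_Var:  "\<Gamma> x = Some \<sigma> \<Longrightarrow> \<Gamma> \<turnstile> Var x : \<sigma>"
| T_Coin: "0 \<le> r \<Longrightarrow> r \<le> 1 \<Longrightarrow> \<Gamma> \<turnstile> Coin r : TNat"
| T_Let:  "\<Gamma> \<turnstile> M : TNat \<Longrightarrow> \<Gamma>(x \<mapsto> TNat) \<turnstile> N : \<sigma> \<Longrightarrow> \<Gamma> \<turnstile> Let x M N : \<sigma>"
| T_If:   "\<Gamma> \<turnstile> M : TNat \<Longrightarrow> \<Gamma> \<turnstile> N : \<sigma> \<Longrightarrow> \<Gamma> \<turnstile> P : \<sigma> \<Longrightarrow> \<Gamma> \<turnstile> If M N P : \<sigma>"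
| T_App:  "\<Gamma> \<turnstile> M : \<sigma> \<rightarrow> \<tau> \<Longrightarrow> \<Gamma> \<turnstile> N : \<sigma> \<Longrightarrow> \<Gamma> \<turnstile> App M N : \<tau>"
| T_Lam:  "\<Gamma>(x \<mapsto> \<sigma>) \<turnstile> M : \<tau> \<Longrightarrow> \<Gamma> \<turnstile> Lam x \<sigma> M : \<sigma> \<rightarrow> \<tau>"
| T_Fix:  "\<Gamma> \<turnstile> M : \<sigma> \<rightarrow> \<sigma> \<Longrightarrow> \<Gamma> \<turnstile> Fix M : \<sigma>"

definition closed_terms :: "ty \<Rightarrow> tm set" where
  "closed_terms \<sigma> = {M. Map.empty \<turnstile> M : \<sigma>}"

text \<open>\<open>subst x N M\<close> is \<open>M[N/x]\<close>. It does not rename bound variables and is capture-avoiding only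
  for closed \<open>N\<close>; the reduction of closed states and the semantics never substitute anything else.\<close>

primrec subst :: "vname \<Rightarrow> tm \<Rightarrow> tm \<Rightarrow> tm" where
  "subst x N (Num n) = Num n"
| "subst x N (Succ M) = Succ (subst x N M)"
| "subst x N (Pred M) = Pred (subst x N M)"
| "subst x N (Var y) = (if x = y then N else Var y)"
| "subst x N (Coin r) = Coin r"
| "subst x N (Let y M P) = Let y (subst x N M) (if x = y then P else subst x N P)"
| "subst x N (If M P Q) = If (subst x N M) (subst x N P) (subst x N Q)"
| "subst x N (App M P) = App (subst x N M) (subst x N P)"
| "subst x N (Lam y \<sigma> M) = Lam y \<sigma> (if x = y then M else subst x N M)"
| "subst x N (Fix M) = Fix (subst x N M)"

definition Omega :: "ty \<Rightarrow> tm" where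
  "Omega \<sigma> = Fix (Lam 0 \<sigma> (Var 0))"


section \<open>Operational semantics\<close>

datatype frame = FArg tm | FSucc | FPred | FIf tm tm | FLet vname tm

type_synonym state = "tm \<times> frame list"

text \<open>\<open>Eval s \<alpha> q\<close> is the graph of the partial function \<open>Eval(s, \<alpha>) = q\<close> (see
  \<open>Eval_functional\<close> below); being defined inductively, it is the least one. The bits
  \<open>0\<close> and \<open>1\<close> of \<open>\<alpha>\<close> are \<open>False\<close> and \<open>True\<close>.\<close>

definition coin_weight :: "bool \<Rightarrow> rat \<Rightarrow> real" where
  "coin_weight i r = (if i then 1 - of_rat r else of_rat r)"

inductive Eval :: "state \<Rightarrow> bool list \<Rightarrow> real \<Rightarrow> bool" where
  E_Let:   "Eval (M, FLet x N # \<pi>) \<alpha> q \<Longrightarrow> Eval (Let x M N, \<pi>) \<alpha> q"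
| E_App:   "Eval (M, FArg N # \<pi>) \<alpha> q \<Longrightarrow> Eval (App M N, \<pi>) \<alpha> q"
| E_If:    "Eval (M, FIf N P # \<pi>) \<alpha> q \<Longrightarrow> Eval (If M N P, \<pi>) \<alpha> q"
| E_Fix:   "Eval (M, FArg (Fix M) # \<pi>) \<alpha> q \<Longrightarrow> Eval (Fix M, \<pi>) \<alpha> q"
| E_Succ:  "Eval (M, FSucc # \<pi>) \<alpha> q \<Longrightarrow> Eval (Succ M, \<pi>) \<alpha> q"
| E_Pred:  "Eval (M, FPred # \<pi>) \<alpha> q \<Longrightarrow> Eval (Pred M, \<pi>) \<alpha> q"
| E_NLet:  "Eval (subst x (Num n) N, \<pi>) \<alpha> q \<Longrightarrow> Eval (Num n, FLet x N # \<pi>) \<alpha> q"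
| E_Beta:  "Eval (subst x N M, \<pi>) \<alpha> q \<Longrightarrow> Eval (Lam x \<sigma> M, FArg N # \<pi>) \<alpha> q"
| E_If0:   "Eval (N, \<pi>) \<alpha> q \<Longrightarrow> Eval (Num 0, FIf N P # \<pi>) \<alpha> q"
| E_IfS:   "Eval (P, \<pi>) \<alpha> q \<Longrightarrow> Eval (Num (Suc n), FIf N P # \<pi>) \<alpha> q"
| E_NSucc: "Eval (Num (Suc n), \<pi>) \<alpha> q \<Longrightarrow> Eval (Num n, FSucc # \<pi>) \<alpha> q"
| E_Pred0: "Eval (Num 0, \<pi>) \<alpha> q \<Longrightarrow> Eval (Num 0, FPred # \<pi>) \<alpha> q"
| E_PredS: "Eval (Num n, \<pi>) \<alpha> q \<Longrightarrow> Eval (Num (Suc n), FPred # \<pi>) \<alpha> q"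
| E_Coin:  "Eval (Num (of_bool i), \<pi>) \<alpha> q \<Longrightarrow> Eval (Coin r, \<pi>) (i # \<alpha>) (q * coin_weight i r)"
| E_Zero:  "Eval (Num 0, []) [] 1"

lemma Eval_functional: "Eval s \<alpha> q \<Longrightarrow> Eval s \<alpha> q' \<Longrightarrow> q = q'"
proof (induction arbitrary: q' rule: Eval.induct)
  case (E_Coin i \<pi> \<alpha> q r)
  from E_Coin.prems E_Coin.IH show ?case by cases auto
qed (erule Eval.cases; simp)+

definition prob0 :: "tm \<Rightarrow> real" where
  "prob0 M = (\<Sum>\<^sub>\<infinity>(\<alpha>, q) \<in> {(\<alpha>, q). Eval (M, []) \<alpha> q}. q)"


section \<open>The tamed observational distance\<close>

definition tamed :: "rat \<Rightarrow> ty \<Rightarrow> tm \<Rightarrow> tm" where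
  "tamed p \<sigma> C = Lam 0 \<sigma> (App C (If (Coin p) (Var 0) (Omega \<sigma>)))"

definition d_obs :: "rat \<Rightarrow> ty \<Rightarrow> tm \<Rightarrow> tm \<Rightarrow> real" where
  "d_obs p \<sigma> M M' =
     (SUP C \<in> closed_terms (\<sigma> \<rightarrow> TNat).
        \<bar>prob0 (App (tamed p \<sigma> C) M) - prob0 (App (tamed p \<sigma> C) M')\<bar>)"


section \<open>Probabilistic coherence spaces\<close>

text \<open>A vector of non-negative reals indexed by the web \<open>A\<close> is a function into \<^typ>\<open>ennreal\<close>
  that takes finite values and vanishes outside \<open>A\<close>. All sums below are therefore taken over the
  whole index type, and are defined in \<open>[0, \<infinity>]\<close>.\<close>

type_synonym 'a vec = "'a \<Rightarrow> ennreal"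

record 'a pcs =
  web :: "'a set"
  car :: "'a vec set"

definition vecs :: "'a set \<Rightarrow> 'a vec set" where
  "vecs A = {u. (\<forall>a. u a < \<infinity>) \<and> (\<forall>a. a \<notin> A \<longrightarrow> u a = 0)}"

definition polar :: "'a set \<Rightarrow> 'a vec set \<Rightarrow> 'a vec set" where
  "polar A Q = {u' \<in> vecs A. \<forall>u\<in>Q. (\<Sum>\<^sub>\<infinity>a. u a * u' a) \<le> 1}"

definition pcs_nat :: "nat pcs" where
  "pcs_nat = \<lparr>web = UNIV, car = {u \<in> vecs UNIV. (\<Sum>\<^sub>\<infinity>n. u n) \<le> 1}\<rparr>"

definition mat_app :: "('a \<times> 'b) vec \<Rightarrow> 'a vec \<Rightarrow> 'b vec" where
  "mat_app t u = (\<lambda>b. \<Sum>\<^sub>\<infinity>a. t (a, b) * u a)"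

definition pcs_lin :: "'a pcs \<Rightarrow> 'b pcs \<Rightarrow> ('a \<times> 'b) pcs" where
  "pcs_lin X Y =
     \<lparr>web = web X \<times> web Y,
      car = {t \<in> vecs (web X \<times> web Y). \<forall>u\<in>car X. mat_app t u \<in> car Y}\<rparr>"

definition promote :: "'a vec \<Rightarrow> 'a multiset vec" where
  "promote u = (\<lambda>\<mu>. \<Prod>\<^sub># (image_mset u \<mu>))"

definition pcs_bang :: "'a pcs \<Rightarrow> 'a multiset pcs" where
  "pcs_bang X =
     (let A = {\<mu>. set_mset \<mu> \<subseteq> web X}
      in \<lparr>web = A, car = polar A (polar A (promote ` car X))\<rparr>)"

definition pcs_norm :: "'a pcs \<Rightarrow> 'a vec \<Rightarrow> real" where
  "pcs_norm X x = Inf {r. r > 0 \<and> (\<exists>y\<in>car X. x = (\<lambda>a. ennreal r * y a))}"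

definition pcs_dist :: "'a pcs \<Rightarrow> 'a vec \<Rightarrow> 'a vec \<Rightarrow> real" where
  "pcs_dist X x y =
     pcs_norm X (\<lambda>a. x a - min (x a) (y a)) + pcs_norm X (\<lambda>a. y a - min (x a) (y a))"


section \<open>Denotational semantics\<close>

text \<open>The webs of all types live in one type of points: \<open>PFun \<mu> b\<close> stands for the element
  \<open>(\<mu>, b)\<close> of the web of \<open>!X \<multimap> Y\<close>. Renaming a web along an injective \<open>f\<close> transports the PCS structure.\<close>

datatype point = PNat nat | PFun "point multiset" point

definition pcs_rename :: "('a \<Rightarrow> 'b) \<Rightarrow> 'a pcs \<Rightarrow> 'b pcs" where
  "pcs_rename f X = \<lparr>web = f ` web X, car = {u \<in> vecs (f ` web X). u \<circ> f \<in> car X}\<rparr>"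

primrec ty_sem :: "ty \<Rightarrow> point pcs" where
  "ty_sem TNat = pcs_rename PNat pcs_nat"
| "ty_sem (\<sigma> \<rightarrow> \<tau>) = pcs_rename (\<lambda>(\<mu>, b). PFun \<mu> b) (pcs_lin (pcs_bang (ty_sem \<sigma>)) (ty_sem \<tau>))"

definition fun_app :: "point vec \<Rightarrow> point vec \<Rightarrow> point vec" where
  "fun_app t u = mat_app (t \<circ> (\<lambda>(\<mu>, b). PFun \<mu> b)) (promote u)"

definition nat_vec :: "nat vec \<Rightarrow> point vec" where
  "nat_vec f = (\<lambda>a. case a of PNat n \<Rightarrow> f n | PFun \<mu> b \<Rightarrow> 0)"

definition dirac :: "nat \<Rightarrow> point vec" where
  "dirac n = nat_vec (\<lambda>k. if k = n then 1 else 0)"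

lemma size_subst_Num: "size (subst x (Num n) M) = size M"
  by (induction M) auto

text \<open>\<open>sem \<Gamma> M \<rho>\<close> is the value at \<open>\<rho>\<close> of the function denoted by \<open>M\<close> in context \<open>\<Gamma>\<close>. An abstraction
  denotes the matrix \<open>t \<in> P(!\<sigma> \<multimap> \<tau>)\<close> identified with the function \<open>u \<mapsto> \<lbrakk>M\<rbrakk>(\<rho>, u)\<close> on \<open>P(\<sigma>)\<close>; it is
  unique because a power series is determined by its values on \<open>P(\<sigma>)\<close>.\<close>

function sem :: "ctx \<Rightarrow> tm \<Rightarrow> (vname \<Rightarrow> point vec) \<Rightarrow> point vec" where
  "sem \<Gamma> (Num n) \<rho> = dirac n"
| "sem \<Gamma> (Succ M) \<rho> =
     nat_vec (\<lambda>n. case n of 0 \<Rightarrow> 0 | Suc k \<Rightarrow> sem \<Gamma> M \<rho> (PNat k))"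
| "sem \<Gamma> (Pred M) \<rho> =
     nat_vec (\<lambda>n. (if n = 0 then sem \<Gamma> M \<rho> (PNat 0) else 0) + sem \<Gamma> M \<rho> (PNat (Suc n)))"
| "sem \<Gamma> (Var x) \<rho> = \<rho> x"
| "sem \<Gamma> (Coin r) \<rho> =
     (\<lambda>a. ennreal (of_rat r) * dirac 0 a + ennreal (1 - of_rat r) * dirac 1 a)"
| "sem \<Gamma> (Let x M N) \<rho> =
     (\<lambda>a. \<Sum>\<^sub>\<infinity>n. sem \<Gamma> M \<rho> (PNat n) * sem \<Gamma> (subst x (Num n) N) \<rho> a)"
| "sem \<Gamma> (If M N P) \<rho> =
     (\<lambda>a. sem \<Gamma> M \<rho> (PNat 0) * sem \<Gamma> N \<rho> a
        + (\<Sum>\<^sub>\<infinity>n. sem \<Gamma> M \<rho> (PNat (Suc n))) * sem \<Gamma> P \<rho> a)"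
| "sem \<Gamma> (App M N) \<rho> = fun_app (sem \<Gamma> M \<rho>) (sem \<Gamma> N \<rho>)"
| "sem \<Gamma> (Lam x \<sigma> M) \<rho> =
     (THE t. \<exists>\<tau>. \<Gamma>(x \<mapsto> \<sigma>) \<turnstile> M : \<tau> \<and> t \<in> car (ty_sem (\<sigma> \<rightarrow> \<tau>)) \<and>
        (\<forall>u \<in> car (ty_sem \<sigma>). fun_app t u = sem (\<Gamma>(x \<mapsto> \<sigma>)) M (\<rho>(x := u))))"
| "sem \<Gamma> (Fix M) \<rho> = (\<lambda>a. SUP n. (fun_app (sem \<Gamma> M \<rho>) ^^ n) (\<lambda>_. 0) a)"
  by pat_completeness auto
termination
  by (relation "Wellfounded.measure (\<lambda>(\<Gamma>, M, \<rho>). size M)") (auto simp: size_subst_Num)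

definition closed_sem :: "tm \<Rightarrow> point vec" where
  "closed_sem M = sem Map.empty M (\<lambda>_ _. 0)"

end

(*
The number P(M -> 0) is the coefficient of e_0 in the denotation of M. Both inequalities of this
adequacy theorem come from one step-indexed logical relation between closed terms (run against
arbitrary stacks) and cliques; fix is handled by induction on the steps for the upper bound and by
Scott continuity for the lower bound. Hence (C_p) M observes t(p x), where x denotes M and t, the
denotation of C, is a power series with nonnegative coefficients and values in [0, 1].

Let z be the meet of x and y, and x - z = r w with w a clique. As s varies, t(p z + s w) is convex on
[0, 1 - p], because p z + (1 - p) w is still a clique, so its increment on [0, p r] is at most
p r / (1 - p). Taking the infimum over r gives t(p x) - t(p z) <= p / (1 - p) ||x - z||, and likewise
for y; since t(p z) lies below both values, the two bounds combine to the claim.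
*)
theory Submission imports Defs begin

section \<open>Sums in the extended nonnegative reals\<close>

text \<open>\<open>sem\<close> gives an abstraction by a definite description, so the described
  matrix must first be shown to exist and to be unique. Uniqueness is the recovery of nonnegative
  coefficients from the values on cliques. Existence forces a stronger induction: the body must be a
  power series in the whole environment before one variable can be curried, so membership in the
  cliques and analyticity are proved together. Values in \<open>ennreal\<close> let sums be
  exchanged freely, and the series are never subtracted.

  Function spaces are defined by double polars. The families \<open>tests\<close> replace them by
  inequalities linear in the vector, so closure under suprema, subconvex combinations and smaller
  vectors has one proof for all types.

  The budget k of \<open>ev k\<close> counts steps along a single path. It gives \<open>fix\<close>
  an induction, and finitely many paths always fit under one budget. The logical relation carries a
  list of pending arguments, so that every type reduces to running a term against arbitrary stacks
  and comparing with a mixture of numerals.\<close>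

lemma ennreal_summable_on: "f summable_on A" for f :: "'a \<Rightarrow> ennreal"
  by (rule nonneg_summable_on_complete) simp

lemma infsum_ennreal_SUP:
  fixes f :: "'a \<Rightarrow> ennreal"
  shows "infsum f A = (SUP F\<in>{F. finite F \<and> F \<subseteq> A}. sum f F)"
  by (rule nonneg_infsum_complete) simp

lemma infsum_ennreal_mono:
  fixes f g :: "'a \<Rightarrow> ennreal"
  assumes "\<And>a. a \<in> A \<Longrightarrow> f a \<le> g a"
  shows "infsum f A \<le> infsum g A"
  by (rule infsum_mono) (auto simp: assms ennreal_summable_on)

lemma sum_le_infsum_ennreal:
  fixes f :: "'a \<Rightarrow> ennreal"
  assumes "finite F" "F \<subseteq> A"
  shows "sum f F \<le> infsum f A"
  unfolding infsum_ennreal_SUP by (rule SUP_upper) (use assms in auto)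

lemma le_infsum_ennreal:
  fixes f :: "'a \<Rightarrow> ennreal"
  shows "f a \<le> infsum f UNIV"
  using sum_le_infsum_ennreal[of "{a}" UNIV f] by simp

lemma infsum_ennreal_least:
  fixes f :: "'a \<Rightarrow> ennreal"
  assumes "\<And>F. finite F \<Longrightarrow> F \<subseteq> A \<Longrightarrow> sum f F \<le> c"
  shows "infsum f A \<le> c"
  unfolding infsum_ennreal_SUP by (rule SUP_least) (use assms in auto)

lemma infsum_ennreal_add:
  fixes f g :: "'a \<Rightarrow> ennreal"
  shows "infsum (\<lambda>a. f a + g a) A = infsum f A + infsum g A"
  by (rule infsum_add) (rule ennreal_summable_on)+

lemma infsum_ennreal_cmult:
  fixes f :: "'a \<Rightarrow> ennreal"
  shows "infsum (\<lambda>a. c * f a) A = c * infsum f A"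
proof -
  have "{F. finite F \<and> F \<subseteq> A} \<noteq> {}" by auto
  then show ?thesis
    unfolding infsum_ennreal_SUP by (simp add: SUP_mult_left_ennreal sum_distrib_left)
qed

lemma infsum_ennreal_cmult_right:
  fixes f :: "'a \<Rightarrow> ennreal"
  shows "infsum (\<lambda>a. f a * c) A = infsum f A * c"
  using infsum_ennreal_cmult[of c f A] by (simp add: mult.commute)

lemma infsum_ennreal_sum:
  fixes f :: "'i \<Rightarrow> 'a \<Rightarrow> ennreal"
  shows "infsum (\<lambda>a. \<Sum>i\<in>I. f i a) A = (\<Sum>i\<in>I. infsum (f i) A)"
  by (induction I rule: infinite_finite_induct) (auto simp: infsum_ennreal_add)

text \<open>Tonelli for sums. A finite set of pairs fits into a finite rectangle, which gives one
  inequality; for the other, a finite outer sum is moved inside the infinite inner one.\<close>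

lemma infsum_ennreal_prod:
  fixes f :: "'a \<Rightarrow> 'b \<Rightarrow> ennreal"
  shows "infsum (\<lambda>(a, b). f a b) UNIV = infsum (\<lambda>a. infsum (f a) UNIV) UNIV"
proof (rule antisym)
  show "infsum (\<lambda>(a, b). f a b) UNIV \<le> infsum (\<lambda>a. infsum (f a) UNIV) UNIV"
  proof (rule infsum_ennreal_least)
    fix F :: "('a \<times> 'b) set" assume F: "finite F"
    have "(\<Sum>(a, b)\<in>F. f a b) \<le> (\<Sum>(a, b)\<in>fst ` F \<times> snd ` F. f a b)"
      by (rule sum_mono2) (use F in \<open>auto intro: rev_image_eqI\<close>)
    also have "\<dots> = (\<Sum>a\<in>fst ` F. \<Sum>b\<in>snd ` F. f a b)"
      by (simp add: sum.cartesian_product)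
    also have "\<dots> \<le> (\<Sum>a\<in>fst ` F. infsum (f a) UNIV)"
      by (rule sum_mono, rule sum_le_infsum_ennreal) (use F in auto)
    also have "\<dots> \<le> infsum (\<lambda>a. infsum (f a) UNIV) UNIV"
      by (rule sum_le_infsum_ennreal) (use F in auto)
    finally show "(\<Sum>(a, b)\<in>F. f a b) \<le> infsum (\<lambda>a. infsum (f a) UNIV) UNIV" .
  qed
  show "infsum (\<lambda>a. infsum (f a) UNIV) UNIV \<le> infsum (\<lambda>(a, b). f a b) UNIV"
  proof (rule infsum_ennreal_least)
    fix F :: "'a set" assume F: "finite F"
    have "(\<Sum>a\<in>F. infsum (f a) UNIV) = infsum (\<lambda>b. \<Sum>a\<in>F. f a b) UNIV"
      by (simp add: infsum_ennreal_sum)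
    also have "\<dots> \<le> infsum (\<lambda>(a, b). f a b) UNIV"
    proof (rule infsum_ennreal_least)
      fix G :: "'b set" assume G: "finite G"
      have "(\<Sum>b\<in>G. \<Sum>a\<in>F. f a b) = (\<Sum>(a, b)\<in>F \<times> G. f a b)"
        by (subst sum.swap) (simp add: sum.cartesian_product)
      also have "\<dots> \<le> infsum (\<lambda>(a, b). f a b) UNIV"
        by (rule sum_le_infsum_ennreal) (use F G in auto)
      finally show "(\<Sum>b\<in>G. \<Sum>a\<in>F. f a b) \<le> infsum (\<lambda>(a, b). f a b) UNIV" .
    qed
    finally show "(\<Sum>a\<in>F. infsum (f a) UNIV) \<le> infsum (\<lambda>(a, b). f a b) UNIV" .
  qed
qed

lemma infsum_ennreal_swap:
  fixes f :: "'a \<Rightarrow> 'b \<Rightarrow> ennreal"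
  shows "infsum (\<lambda>a. infsum (f a) UNIV) UNIV = infsum (\<lambda>b. infsum (\<lambda>a. f a b) UNIV) UNIV"
proof -
  have "infsum (\<lambda>(a, b). f a b) UNIV = infsum (\<lambda>(b, a). f a b) UNIV"
    by (rule infsum_reindex_bij_witness[of UNIV prod.swap prod.swap]) auto
  then show ?thesis by (simp add: infsum_ennreal_prod)
qed

lemma infsum_ennreal_single:
  fixes f :: "'a \<Rightarrow> ennreal"
  assumes "\<And>b. b \<noteq> a \<Longrightarrow> f b = 0"
  shows "infsum f UNIV = f a"
proof -
  have "infsum f UNIV = infsum f {a}"
    by (rule infsum_cong_neutral) (use assms in auto)
  then show ?thesis by simp
qed

lemma infsum_ennreal_Suc:
  fixes f :: "nat \<Rightarrow> ennreal"
  shows "infsum f UNIV = f 0 + infsum (\<lambda>n. f (Suc n)) UNIV"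
proof -
  have "infsum f UNIV = infsum f ({0} \<union> range Suc)"
    by (rule arg_cong[where f = "infsum f"]) (use UNIV_nat_eq in auto)
  also have "\<dots> = infsum f {0} + infsum f (range Suc)"
    by (rule infsum_Un_disjoint) (auto simp: ennreal_summable_on)
  also have "infsum f (range Suc) = infsum (\<lambda>n. f (Suc n)) UNIV"
    by (subst infsum_reindex) (auto simp: o_def)
  finally show ?thesis by simp
qed

lemma infsum_ennreal_inj:
  fixes f :: "'a \<Rightarrow> ennreal"
  assumes "inj g" "\<And>a. a \<notin> range g \<Longrightarrow> f a = 0"
  shows "infsum f UNIV = infsum (\<lambda>b. f (g b)) UNIV"
proof -
  have "infsum f UNIV = infsum f (range g)"
    by (rule infsum_cong_neutral) (use assms in auto)
  also have "\<dots> = infsum (\<lambda>b. f (g b)) UNIV"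
    using assms(1) by (subst infsum_reindex) (auto simp: o_def)
  finally show ?thesis .
qed

lemma SUP_sum_ennreal:
  fixes f :: "nat \<Rightarrow> 'a \<Rightarrow> ennreal"
  assumes "\<And>a. incseq (\<lambda>n. f n a)"
  shows "(\<Sum>a\<in>F. SUP n. f n a) = (SUP n. \<Sum>a\<in>F. f n a)"
proof (induction F rule: infinite_finite_induct)
  case (insert x F)
  have "incseq (\<lambda>n. \<Sum>a\<in>F. f n a)"
    using assms by (auto simp: incseq_def intro: sum_mono)
  then show ?case using insert assms[of x] by (simp add: ennreal_SUP_add)
qed auto

text \<open>Monotone convergence: an infinite sum is a supremum of finite sums, so once finite sums
  commute with the chain only two suprema remain to be exchanged.\<close>

lemma infsum_ennreal_SUP_swap:
  fixes f :: "nat \<Rightarrow> 'a \<Rightarrow> ennreal"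
  assumes "\<And>a. incseq (\<lambda>n. f n a)"
  shows "infsum (\<lambda>a. SUP n. f n a) A = (SUP n. infsum (f n) A)"
  unfolding infsum_ennreal_SUP SUP_sum_ennreal[OF assms] by (rule SUP_commute)

text \<open>Each mixed product \<open>f m * g n\<close> lies below the diagonal one at
  \<open>max m n\<close>.\<close>

lemma SUP_mult_ennreal:
  fixes f g :: "nat \<Rightarrow> ennreal"
  assumes "incseq f" "incseq g"
  shows "(SUP n. f n * g n) = (SUP n. f n) * (SUP n. g n)"
proof (rule antisym)
  show "(SUP n. f n * g n) \<le> (SUP n. f n) * (SUP n. g n)"
    by (rule SUP_least) (auto intro!: mult_mono SUP_upper)
  have "f m * g n \<le> (SUP n. f n * g n)" for m n
  proof -
    have "f m * g n \<le> f (max m n) * g (max m n)"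
      using assms by (intro mult_mono) (auto simp: incseq_def)
    also have "\<dots> \<le> (SUP n. f n * g n)" by (rule SUP_upper) simp
    finally show ?thesis .
  qed
  then show "(SUP n. f n) * (SUP n. g n) \<le> (SUP n. f n * g n)"
    by (simp add: SUP_mult_left_ennreal SUP_mult_right_ennreal SUP_le_iff)
qed

text \<open>Telescoping, with every finite set of indices contained in some initial segment.\<close>

lemma SUP_partial_sums_ennreal:
  fixes s d :: "nat \<Rightarrow> ennreal"
  assumes "s 0 = 0" "\<And>n. s (Suc n) = s n + d n"
  shows "(SUP n. s n) = infsum d UNIV"
proof -
  have s: "s n = sum d {..<n}" for n
    by (induction n) (auto simp: assms add.commute)
  show ?thesis
  proof (rule antisym)
    show "(SUP n. s n) \<le> infsum d UNIV"
      by (rule SUP_least) (auto simp: s intro: sum_le_infsum_ennreal)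
    show "infsum d UNIV \<le> (SUP n. s n)"
    proof (rule infsum_ennreal_least)
      fix F :: "nat set" assume "finite F"
      then obtain n where "F \<subseteq> {..<n}" using finite_nat_iff_bounded by blast
      then have "sum d F \<le> s n" unfolding s by (intro sum_mono2) auto
      also have "\<dots> \<le> (SUP n. s n)" by (rule SUP_upper) simp
      finally show "sum d F \<le> (SUP n. s n)" .
    qed
  qed
qed

section \<open>The coherence spaces of the types\<close>

abbreviation web_of :: "ty \<Rightarrow> point set" where "web_of \<sigma> \<equiv> web (ty_sem \<sigma>)"
abbreviation cliques :: "ty \<Rightarrow> point vec set" where "cliques \<sigma> \<equiv> car (ty_sem \<sigma>)"

declare ty_sem.simps [simp del]

text \<open>The rank-one tensor of the promotion of u with q. Pairing a matrix t with it is the same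
  as pairing \<open>fun_app t u\<close> with q, as \<open>infsum_points_test_fun\<close>
  shows.\<close>

definition test_fun :: "point vec \<Rightarrow> point vec \<Rightarrow> point vec" where
  "test_fun u q = (\<lambda>a. case a of PNat n \<Rightarrow> 0 | PFun \<mu> b \<Rightarrow> promote u \<mu> * q b)"

text \<open>A family whose polar is \<open>cliques \<sigma>\<close>, so that membership of a vector becomes a family of
  inequalities that are linear in that vector.\<close>

primrec tests :: "ty \<Rightarrow> point vec set" where
  "tests TNat = {\<lambda>_. 1}"
| "tests (\<sigma> \<rightarrow> \<tau>) = {test_fun u q | u q. u \<in> cliques \<sigma> \<and> q \<in> tests \<tau>}"

lemma promote_empty [simp]: "promote u {#} = 1"
  by (simp add: promote_def)

lemma promote_add_mset [simp]: "promote u (add_mset a \<mu>) = u a * promote u \<mu>"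
  by (simp add: promote_def)

lemma promote_union: "promote u (\<mu> + \<nu>) = promote u \<mu> * promote u \<nu>"
  by (simp add: promote_def)

lemma promote_mono: "(\<And>a. u a \<le> v a) \<Longrightarrow> promote u \<mu> \<le> promote v \<mu>"
  by (induction \<mu>) (auto intro: mult_mono)

lemma promote_pos: "(\<And>a. a \<in># \<mu> \<Longrightarrow> u a > 0) \<Longrightarrow> promote u \<mu> > 0"
  by (induction \<mu>) (auto simp: ennreal_zero_less_mult_iff)

lemma promote_finite: "(\<And>a. a \<in># \<mu> \<Longrightarrow> u a < \<infinity>) \<Longrightarrow> promote u \<mu> < \<infinity>"
  by (induction \<mu>) (auto simp: ennreal_mult_less_top)

lemma promote_zero: "a \<in># \<mu> \<Longrightarrow> u a = 0 \<Longrightarrow> promote u \<mu> = 0"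
  by (induction \<mu>) auto

lemma incseq_promote: "(\<And>a. incseq (\<lambda>n. u n a)) \<Longrightarrow> incseq (\<lambda>n. promote (u n) \<mu>)"
  by (auto simp: incseq_def intro: promote_mono)

lemma promote_SUP:
  assumes "\<And>a. incseq (\<lambda>n. u n a)"
  shows "promote (\<lambda>a. SUP n. u n a) \<mu> = (SUP n. promote (u n) \<mu>)"
  by (induction \<mu>) (auto simp: SUP_mult_ennreal assms incseq_promote)

lemma fun_app_eq: "fun_app t u b = (\<Sum>\<^sub>\<infinity>\<mu>. t (PFun \<mu> b) * promote u \<mu>)"
  by (simp add: fun_app_def mat_app_def)

lemma fun_app_mono:
  assumes "\<And>a. t a \<le> t' a" "\<And>a. u a \<le> u' a"
  shows "fun_app t u b \<le> fun_app t' u' b"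
  unfolding fun_app_eq by (intro infsum_ennreal_mono mult_mono promote_mono assms) auto

lemma fun_app_SUP_arg:
  assumes "\<And>a. incseq (\<lambda>n. u n a)"
  shows "fun_app t (\<lambda>a. SUP n. u n a) b = (SUP n. fun_app t (u n) b)"
proof -
  have "incseq (\<lambda>n. t (PFun \<mu> b) * promote (u n) \<mu>)" for \<mu>
    using incseq_promote[of u, OF assms] by (auto simp: incseq_def intro: mult_left_mono)
  then show ?thesis
    unfolding fun_app_eq promote_SUP[OF assms]
    by (simp add: SUP_mult_left_ennreal infsum_ennreal_SUP_swap)
qed

lemma fun_app_SUP_fun:
  assumes "\<And>a. incseq (\<lambda>n. t n a)"
  shows "fun_app (\<lambda>a. SUP n. t n a) u b = (SUP n. fun_app (t n) u b)"
proof -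
  have "incseq (\<lambda>n. t n (PFun \<mu> b) * promote u \<mu>)" for \<mu>
    using assms[of "PFun \<mu> b"] by (auto simp: incseq_def intro: mult_right_mono)
  then show ?thesis
    unfolding fun_app_eq by (simp add: SUP_mult_right_ennreal infsum_ennreal_SUP_swap)
qed

text \<open>Application is linear in the matrix, though not in its argument. This is what lets
  mixtures pass through application.\<close>

lemma fun_app_infsum:
  "fun_app (\<lambda>a. \<Sum>\<^sub>\<infinity>i. c i * t i a) u b = (\<Sum>\<^sub>\<infinity>i. c i * fun_app (t i) u b)"
proof -
  have "fun_app (\<lambda>a. \<Sum>\<^sub>\<infinity>i. c i * t i a) u b
      = (\<Sum>\<^sub>\<infinity>\<mu>. \<Sum>\<^sub>\<infinity>i. c i * t i (PFun \<mu> b) * promote u \<mu>)"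
    by (simp add: fun_app_eq infsum_ennreal_cmult_right)
  also have "\<dots> = (\<Sum>\<^sub>\<infinity>i. \<Sum>\<^sub>\<infinity>\<mu>. c i * t i (PFun \<mu> b) * promote u \<mu>)"
    by (rule infsum_ennreal_swap)
  finally show ?thesis
    by (simp add: fun_app_eq mult.assoc infsum_ennreal_cmult)
qed

lemma fun_app_zero [simp]: "fun_app (\<lambda>_. 0) u = (\<lambda>_. 0)"
  by (simp add: fun_app_eq fun_eq_iff)

lemma infsum_points_test_fun:
  "(\<Sum>\<^sub>\<infinity>a. t a * test_fun u q a) = (\<Sum>\<^sub>\<infinity>b. fun_app t u b * q b)"
proof -
  have "(\<Sum>\<^sub>\<infinity>a. t a * test_fun u q a)
      = (\<Sum>\<^sub>\<infinity>x. t (case x of (\<mu>, b) \<Rightarrow> PFun \<mu> b) * test_fun u q (case x of (\<mu>, b) \<Rightarrow> PFun \<mu> b))"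
  proof (rule infsum_ennreal_inj)
    show "inj (\<lambda>(\<mu>, b). PFun \<mu> b)" by (auto simp: inj_on_def)
    fix a assume "a \<notin> range (\<lambda>(\<mu>, b). PFun \<mu> b)"
    then show "t a * test_fun u q a = 0"
      by (cases a) (auto simp: test_fun_def)
  qed
  also have "\<dots> = (\<Sum>\<^sub>\<infinity>(\<mu>, b). t (PFun \<mu> b) * promote u \<mu> * q b)"
    by (rule infsum_cong) (auto simp: test_fun_def mult.assoc)
  also have "\<dots> = (\<Sum>\<^sub>\<infinity>\<mu>. \<Sum>\<^sub>\<infinity>b. t (PFun \<mu> b) * promote u \<mu> * q b)"
    by (rule infsum_ennreal_prod)
  also have "\<dots> = (\<Sum>\<^sub>\<infinity>b. \<Sum>\<^sub>\<infinity>\<mu>. t (PFun \<mu> b) * promote u \<mu> * q b)"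
    by (rule infsum_ennreal_swap)
  finally show ?thesis by (simp add: fun_app_eq infsum_ennreal_cmult_right)
qed

lemma web_TNat: "web_of TNat = range PNat"
  by (simp add: ty_sem.simps pcs_rename_def pcs_nat_def)

lemma web_fun: "web_of (\<sigma> \<rightarrow> \<tau>) = {PFun \<mu> b | \<mu> b. set_mset \<mu> \<subseteq> web_of \<sigma> \<and> b \<in> web_of \<tau>}"
  by (auto simp: ty_sem.simps pcs_rename_def pcs_lin_def pcs_bang_def Let_def image_iff)

lemma cliques_vecs: "u \<in> cliques \<sigma> \<Longrightarrow> u \<in> vecs (web_of \<sigma>)"
  by (cases \<sigma>) (auto simp: ty_sem.simps pcs_rename_def)

lemma clique_finite: "u \<in> cliques \<sigma> \<Longrightarrow> u a < \<infinity>"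
  using cliques_vecs by (auto simp: vecs_def)

lemma clique_outside: "u \<in> cliques \<sigma> \<Longrightarrow> a \<notin> web_of \<sigma> \<Longrightarrow> u a = 0"
  using cliques_vecs by (auto simp: vecs_def)

lemma finite_of_mult_le_1: "x * y \<le> 1 \<Longrightarrow> 0 < y \<Longrightarrow> x < \<infinity>" for x y :: ennreal
  by (metis ennreal_mult_eq_top_iff ennreal_one_less_top infinity_ennreal_def leD not_gr_zero
      order_less_le top.not_eq_extremum)

text \<open>The bound \<open>1 / q a\<close> depends on the test alone, so it is uniform over all
  vectors that pass the test.\<close>

lemma bounded_of_test:
  assumes "q a > 0"
  shows "\<exists>C<\<infinity>. \<forall>u. (\<Sum>\<^sub>\<infinity>b. u b * q b) \<le> 1 \<longrightarrow> u a \<le> (C::ennreal)"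
proof (intro exI conjI allI impI)
  show "1 / q a < \<infinity>"
    using assms unfolding infinity_ennreal_def less_top[symmetric]
    by (simp add: ennreal_divide_eq_top_iff zero_less_iff_neq_zero)
  fix u :: "'a \<Rightarrow> ennreal" assume "(\<Sum>\<^sub>\<infinity>b. u b * q b) \<le> 1"
  then have le: "u a * q a \<le> 1" using le_infsum_ennreal[of "\<lambda>b. u b * q b" a] by auto
  show "u a \<le> 1 / q a"
  \<comment> \<open>An infinite test value forces \<open>u a = 0\<close>, because a positive
    multiple of infinity would exceed 1.\<close>
  proof (cases "q a = \<infinity>")
    case True
    then have "u a = 0" using le by (cases "u a = 0") (auto simp: ennreal_mult_top top_unique)
    then show ?thesis by simp
  next
    case False
    then have "u a = u a * q a / q a"
      using assms by (simp add: mult_divide_eq_ennreal)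
    also have "\<dots> \<le> 1 / q a" by (intro divide_right_mono_ennreal le)
    finally show ?thesis .
  qed
qed


text \<open>The invariant of the induction on types. The two positivity clauses are the two halves
  of 0 < sup x_a < \<infinity>: a clique positive at a gives the lower half, a test positive at a
  bounds all cliques there.\<close>

definition pcs_ok :: "ty \<Rightarrow> bool" where
  "pcs_ok \<sigma> \<longleftrightarrow>
     cliques \<sigma> = {u \<in> vecs (web_of \<sigma>). \<forall>q\<in>tests \<sigma>. (\<Sum>\<^sub>\<infinity>a. u a * q a) \<le> 1} \<and>
     (\<forall>a\<in>web_of \<sigma>. \<exists>q\<in>tests \<sigma>. q a > 0) \<and> (\<forall>a\<in>web_of \<sigma>. \<exists>u\<in>cliques \<sigma>. u a > 0)"

text \<open>Finiteness comes for free: each point of the web has a positive test, and passing that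
  test bounds the value there.\<close>

lemma pcs_ok_cliqueI:
  assumes "pcs_ok \<sigma>" "\<And>a. a \<notin> web_of \<sigma> \<Longrightarrow> u a = 0"
    and le: "\<And>q. q \<in> tests \<sigma> \<Longrightarrow> (\<Sum>\<^sub>\<infinity>a. u a * q a) \<le> 1"
  shows "u \<in> cliques \<sigma>"
proof -
  have "u a < \<infinity>" for a
  proof (cases "a \<in> web_of \<sigma>")
    case True
    then obtain q where q: "q \<in> tests \<sigma>" "q a > 0"
      using assms(1) unfolding pcs_ok_def by blast
    obtain C where C: "C < \<infinity>" "\<forall>u. (\<Sum>\<^sub>\<infinity>b. u b * q b) \<le> 1 \<longrightarrow> u a \<le> C"
      using bounded_of_test[of q a, OF q(2)] by blast
    show ?thesis by (rule le_less_trans[OF C(2)[rule_format, OF le[OF q(1)]] C(1)])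
  qed (simp add: assms)
  then have "u \<in> vecs (web_of \<sigma>)" using assms(2) by (auto simp: vecs_def)
  then show ?thesis using assms(1) le unfolding pcs_ok_def by blast
qed

lemma pcs_ok_test:
  "pcs_ok \<sigma> \<Longrightarrow> u \<in> cliques \<sigma> \<Longrightarrow> q \<in> tests \<sigma> \<Longrightarrow> (\<Sum>\<^sub>\<infinity>a. u a * q a) \<le> 1"
  unfolding pcs_ok_def by blast

lemma pcs_ok_downward:
  assumes "pcs_ok \<sigma>" "v \<in> cliques \<sigma>" "\<And>a. u a \<le> v a"
  shows "u \<in> cliques \<sigma>"
proof (rule pcs_ok_cliqueI[OF assms(1)])
  fix a assume "a \<notin> web_of \<sigma>"
  then have "v a = 0" using clique_outside assms(2) by blast
  then show "u a = 0" using assms(3)[of a] by simp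
next
  fix q assume "q \<in> tests \<sigma>"
  have "(\<Sum>\<^sub>\<infinity>a. u a * q a) \<le> (\<Sum>\<^sub>\<infinity>a. v a * q a)"
    by (intro infsum_ennreal_mono mult_right_mono assms(3)) auto
  also have "\<dots> \<le> 1" using pcs_ok_test assms \<open>q \<in> tests \<sigma>\<close> by blast
  finally show "(\<Sum>\<^sub>\<infinity>a. u a * q a) \<le> 1" .
qed

text \<open>Tests are linear in the vector, so the two sums can be exchanged and each
  \<open>v i\<close> contributes at most \<open>c i\<close>. The guard \<open>c i \<noteq> 0\<close>
  allows a family that consists of cliques only on a subset of its indices.\<close>

lemma pcs_ok_infsum:
  assumes "pcs_ok \<sigma>" "\<And>i. c i \<noteq> 0 \<Longrightarrow> v i \<in> cliques \<sigma>" "(\<Sum>\<^sub>\<infinity>i. c i) \<le> 1"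
  shows "(\<lambda>a. \<Sum>\<^sub>\<infinity>i. c i * v i a) \<in> cliques \<sigma>"
proof (rule pcs_ok_cliqueI[OF assms(1)])
  fix a assume "a \<notin> web_of \<sigma>"
  then have "c i * v i a = 0" for i
    using clique_outside[OF assms(2)[of i]] by (cases "c i = 0") auto
  then show "(\<Sum>\<^sub>\<infinity>i. c i * v i a) = 0" by (intro infsum_0)
next
  fix q assume q: "q \<in> tests \<sigma>"
  have "(\<Sum>\<^sub>\<infinity>a. (\<Sum>\<^sub>\<infinity>i. c i * v i a) * q a) = (\<Sum>\<^sub>\<infinity>i. \<Sum>\<^sub>\<infinity>a. c i * v i a * q a)"
    by (subst infsum_ennreal_swap) (simp add: infsum_ennreal_cmult_right)
  also have "\<dots> = (\<Sum>\<^sub>\<infinity>i. c i * (\<Sum>\<^sub>\<infinity>a. v i a * q a))"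
    by (simp add: mult.assoc infsum_ennreal_cmult)
  also have "\<dots> \<le> (\<Sum>\<^sub>\<infinity>i. c i)"
  proof (rule infsum_ennreal_mono)
    fix i
    show "c i * (\<Sum>\<^sub>\<infinity>a. v i a * q a) \<le> c i"
      using pcs_ok_test[OF assms(1) assms(2)[of i] q] mult_left_mono[of "(\<Sum>\<^sub>\<infinity>a. v i a * q a)" 1 "c i"]
      by (cases "c i = 0") auto
  qed
  finally show "(\<Sum>\<^sub>\<infinity>a. (\<Sum>\<^sub>\<infinity>i. c i * v i a) * q a) \<le> 1" using assms(3) by simp
qed

lemma pcs_ok_zero: "pcs_ok \<sigma> \<Longrightarrow> (\<lambda>_. 0) \<in> cliques \<sigma>"
  by (rule pcs_ok_cliqueI) auto

lemma pcs_ok_SUP: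
  assumes "pcs_ok \<sigma>" "\<And>n. v n \<in> cliques \<sigma>" "\<And>a. incseq (\<lambda>n::nat. v n a)"
  shows "(\<lambda>a. SUP n. v n a) \<in> cliques \<sigma>"
proof (rule pcs_ok_cliqueI[OF assms(1)])
  fix a assume "a \<notin> web_of \<sigma>"
  then show "(SUP n. v n a) = 0" using clique_outside[OF assms(2)] by simp
next
  fix q assume q: "q \<in> tests \<sigma>"
  have "incseq (\<lambda>n. v n a * q a)" for a
    using assms(3) by (auto simp: incseq_def intro: mult_right_mono)
  then have "(\<Sum>\<^sub>\<infinity>a. (SUP n. v n a) * q a) = (SUP n. \<Sum>\<^sub>\<infinity>a. v n a * q a)"
    by (simp add: SUP_mult_right_ennreal infsum_ennreal_SUP_swap)
  also have "\<dots> \<le> 1" using pcs_ok_test assms q by (auto intro: SUP_least)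
  finally show "(\<Sum>\<^sub>\<infinity>a. (SUP n. v n a) * q a) \<le> 1" .
qed

lemma pcs_ok_bounded:
  assumes "pcs_ok \<sigma>" "a \<in> web_of \<sigma>"
  obtains C :: ennreal where "C < \<infinity>" "\<And>u. u \<in> cliques \<sigma> \<Longrightarrow> u a \<le> C"
proof -
  obtain q where q: "q \<in> tests \<sigma>" "q a > 0" using assms unfolding pcs_ok_def by blast
  obtain C where C: "C < \<infinity>" "\<forall>u. (\<Sum>\<^sub>\<infinity>b. u b * q b) \<le> 1 \<longrightarrow> u a \<le> C"
    using bounded_of_test[of q a, OF q(2)] by blast
  show ?thesis
    using that[OF C(1)] C(2) pcs_ok_test[OF assms(1) _ q(1)] by blast
qed

text \<open>Used to scale a matrix with a single entry until it maps all cliques below a given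
  one.\<close>

lemma pcs_ok_promote_bounded:
  assumes "pcs_ok \<sigma>"
  shows "set_mset \<mu> \<subseteq> web_of \<sigma> \<Longrightarrow> \<exists>C<\<infinity>. \<forall>u\<in>cliques \<sigma>. promote u \<mu> \<le> (C::ennreal)"
proof (induction \<mu>)
  case empty
  show ?case by (auto intro!: exI[of _ 1])
next
  case (add a \<mu>)
  then obtain C where C: "C < \<infinity>" "\<forall>u\<in>cliques \<sigma>. promote u \<mu> \<le> C" by auto
  obtain D where D: "D < \<infinity>" "\<And>u. u \<in> cliques \<sigma> \<Longrightarrow> u a \<le> D"
    using pcs_ok_bounded[OF assms, of a] add.prems by auto
  show ?case
    by (rule exI[of _ "D * C"]) (use C D in \<open>auto simp: ennreal_mult_less_top intro: mult_mono\<close>)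
qed

text \<open>One clique per point of F, averaged. The promotion of the result is positive at every
  multiset supported in F, which makes it possible to divide by it.\<close>

lemma pcs_ok_positive:
  assumes "pcs_ok \<sigma>" "finite F" "F \<subseteq> web_of \<sigma>"
  shows "\<exists>u\<in>cliques \<sigma>. \<forall>a\<in>F. u a > 0"
proof -
  have "\<forall>a\<in>F. \<exists>u\<in>cliques \<sigma>. u a > 0" using assms unfolding pcs_ok_def by blast
  then obtain v where v: "\<And>a. a \<in> F \<Longrightarrow> v a \<in> cliques \<sigma>" "\<And>a. a \<in> F \<Longrightarrow> v a a > 0"
    by metis
  \<comment> \<open>Uniform weights on F; if F is empty they all vanish and the average is the zero
    clique.\<close>
  define c :: "point \<Rightarrow> ennreal" where "c a = (if a \<in> F then 1 / of_nat (card F) else 0)" for a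
  have "(\<Sum>\<^sub>\<infinity>a. c a) = (\<Sum>\<^sub>\<infinity>a\<in>F. 1 / of_nat (card F))"
    by (rule infsum_cong_neutral) (auto simp: c_def)
  also have "\<dots> \<le> 1"
    using assms(2) ennreal_divide_self[of "of_nat (card F)"]
    by (cases "F = {}") (simp_all add: ennreal_times_divide card_gt_0_iff of_nat_less_top)
  finally have "(\<lambda>a. \<Sum>\<^sub>\<infinity>i. c i * v i a) \<in> cliques \<sigma>"
    by (intro pcs_ok_infsum assms(1)) (auto simp: c_def v split: if_splits)
  moreover have "(\<Sum>\<^sub>\<infinity>i. c i * v i a) > 0" if "a \<in> F" for a
  proof -
    have "0 < c a * v a a"
      using that v(2) by (simp add: c_def ennreal_zero_less_mult_iff ennreal_zero_less_divide of_nat_less_top)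
    also have "\<dots> \<le> (\<Sum>\<^sub>\<infinity>i. c i * v i a)" by (rule le_infsum_ennreal)
    finally show ?thesis .
  qed
  ultimately show ?thesis by (intro bexI[of _ "\<lambda>a. \<Sum>\<^sub>\<infinity>i. c i * v i a"] ballI)
qed

section \<open>Cliques of function types, tested on promotions alone\<close>

lemma mat_app_promote:
  "mat_app (t \<circ> (\<lambda>(\<mu>, b). PFun \<mu> b)) (promote u) = fun_app t u"
  by (simp add: fun_app_def)

text \<open>The definition asks t to act on the whole double polar of the promotions. Acting on
  promotions suffices: a test q of \<tau> pulls back along t to a vector in the polar of the
  promotions, and every element of the double polar pairs with it to at most 1.\<close>

lemma pcs_ok_fun_cliques:
  assumes \<sigma>: "pcs_ok \<sigma>" and \<tau>: "pcs_ok \<tau>"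
  shows "t \<in> cliques (\<sigma> \<rightarrow> \<tau>) \<longleftrightarrow>
    t \<in> vecs (web_of (\<sigma> \<rightarrow> \<tau>)) \<and> (\<forall>u\<in>cliques \<sigma>. fun_app t u \<in> cliques \<tau>)"
proof -
  define A where "A = {\<mu>. set_mset \<mu> \<subseteq> web_of \<sigma>}"
  define T where "T = t \<circ> (\<lambda>(\<mu>, b). PFun \<mu> b)"
  have web_bang: "web (pcs_bang (ty_sem \<sigma>)) = A"
    by (simp add: pcs_bang_def Let_def A_def)
  have car_bang: "car (pcs_bang (ty_sem \<sigma>)) = polar A (polar A (promote ` cliques \<sigma>))"
    by (simp add: pcs_bang_def Let_def A_def)
  have T_vecs: "T \<in> vecs (A \<times> web_of \<tau>)" if "t \<in> vecs (web_of (\<sigma> \<rightarrow> \<tau>))"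
    using that unfolding T_def vecs_def web_fun A_def by auto
  have web_eq: "(\<lambda>(\<mu>, b). PFun \<mu> b) ` (A \<times> web_of \<tau>) = web_of (\<sigma> \<rightarrow> \<tau>)"
    by (auto simp: web_fun A_def)
  have def: "t \<in> cliques (\<sigma> \<rightarrow> \<tau>) \<longleftrightarrow> t \<in> vecs (web_of (\<sigma> \<rightarrow> \<tau>)) \<and>
      (\<forall>v\<in>polar A (polar A (promote ` cliques \<sigma>)). mat_app T v \<in> cliques \<tau>)"
  proof -
    have "cliques (\<sigma> \<rightarrow> \<tau>) = {u \<in> vecs (web_of (\<sigma> \<rightarrow> \<tau>)). u \<circ> (\<lambda>(\<mu>, b). PFun \<mu> b) \<in>
        {T \<in> vecs (A \<times> web_of \<tau>). \<forall>v\<in>polar A (polar A (promote ` cliques \<sigma>)). mat_app T v \<in> cliques \<tau>}}"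
      unfolding web_eq[symmetric] by (simp add: ty_sem.simps pcs_rename_def pcs_lin_def web_bang car_bang)
    then show ?thesis using T_vecs unfolding T_def by blast
  qed
  have promote_vecs: "promote u \<in> vecs A" if "u \<in> cliques \<sigma>" for u
  proof -
    have "promote u \<mu> < \<infinity>" for \<mu>
      using clique_finite[OF that] by (intro promote_finite)
    moreover have "promote u \<mu> = 0" if "\<mu> \<notin> A" for \<mu>
      using that clique_outside[OF \<open>u \<in> cliques \<sigma>\<close>] promote_zero[of _ \<mu> u] unfolding A_def by blast
    ultimately show ?thesis unfolding vecs_def by blast
  qed
  have promote_bang: "promote u \<in> polar A (polar A (promote ` cliques \<sigma>))" if "u \<in> cliques \<sigma>" for u
    using promote_vecs[OF that] that by (auto simp: polar_def mult.commute)
  have "mat_app T v \<in> cliques \<tau>"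
    if t: "t \<in> vecs (web_of (\<sigma> \<rightarrow> \<tau>))" and app: "\<forall>u\<in>cliques \<sigma>. fun_app t u \<in> cliques \<tau>"
      and v: "v \<in> polar A (polar A (promote ` cliques \<sigma>))" for v
  proof (rule pcs_ok_cliqueI[OF \<tau>])
    fix b assume "b \<notin> web_of \<tau>"
    then show "mat_app T v b = 0"
      using T_vecs[OF t] by (auto simp: mat_app_def vecs_def)
  next
    fix q assume q: "q \<in> tests \<tau>"
    \<comment> \<open>The transpose of the matrix applied to q; \<open>pair\<close> is the
      corresponding adjunction.\<close>
    define w where "w = (\<lambda>\<mu>. \<Sum>\<^sub>\<infinity>b. T (\<mu>, b) * q b)"
    have pair: "(\<Sum>\<^sub>\<infinity>b. mat_app T x b * q b) = (\<Sum>\<^sub>\<infinity>\<mu>. x \<mu> * w \<mu>)" for x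
    proof -
      have "(\<Sum>\<^sub>\<infinity>b. mat_app T x b * q b) = (\<Sum>\<^sub>\<infinity>b. \<Sum>\<^sub>\<infinity>\<mu>. x \<mu> * (T (\<mu>, b) * q b))"
        unfolding mat_app_def infsum_ennreal_cmult_right[symmetric]
        by (intro infsum_cong) (simp add: ac_simps)
      also have "\<dots> = (\<Sum>\<^sub>\<infinity>\<mu>. \<Sum>\<^sub>\<infinity>b. x \<mu> * (T (\<mu>, b) * q b))" by (rule infsum_ennreal_swap)
      finally show ?thesis by (simp add: w_def infsum_ennreal_cmult)
    qed
    have le: "(\<Sum>\<^sub>\<infinity>\<mu>. promote u \<mu> * w \<mu>) \<le> 1" if "u \<in> cliques \<sigma>" for u
      using pcs_ok_test[OF \<tau> _ q] app that unfolding pair[symmetric] T_def mat_app_promote by blast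
    \<comment> \<open>\<open>polar\<close> contains only finite-valued vectors, so the entries of w
      must be bounded first. A clique positive on the support of \<mu> does this for the entry at
      \<mu>.\<close>
    have "w \<in> vecs A"
    proof -
      have "w \<mu> < \<infinity>" if \<mu>: "\<mu> \<in> A" for \<mu>
      proof -
        obtain u where u: "u \<in> cliques \<sigma>" "\<And>a. a \<in># \<mu> \<Longrightarrow> u a > 0"
          using pcs_ok_positive[OF \<sigma>, of "set_mset \<mu>"] finite_set_mset[of \<mu>] \<mu> unfolding A_def by blast
        then have "promote u \<mu> > 0" by (intro promote_pos) auto
        moreover have "promote u \<mu> * w \<mu> \<le> 1"
          using le[OF u(1)] le_infsum_ennreal[of "\<lambda>\<mu>. promote u \<mu> * w \<mu>" \<mu>] by auto
        ultimately show ?thesis by (metis finite_of_mult_le_1 mult.commute)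
      qed
      moreover have w0: "w \<mu> = 0" if "\<mu> \<notin> A" for \<mu>
        using T_vecs[OF t] that by (simp add: w_def vecs_def)
      ultimately have "w \<mu> < \<infinity>" for \<mu> by (cases "\<mu> \<in> A") auto
      then show ?thesis using w0 by (simp add: vecs_def)
    qed
    then have "w \<in> polar A (promote ` cliques \<sigma>)" using le by (auto simp: polar_def)
    then show "(\<Sum>\<^sub>\<infinity>b. mat_app T v b * q b) \<le> 1"
      using v unfolding pair by (auto simp: polar_def mult.commute)
  qed
  then show ?thesis
    unfolding def using promote_bang mat_app_promote[of t] unfolding T_def by metis
qed

lemma pcs_ok: "pcs_ok \<sigma>"
proof (induction \<sigma>)
  case TNat
  have sum: "(\<Sum>\<^sub>\<infinity>a. u a) = (\<Sum>\<^sub>\<infinity>n. u (PNat n))" if "u \<in> vecs (range PNat)" for u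
    using that by (intro infsum_ennreal_inj) (auto simp: inj_on_def vecs_def)
  have cl: "cliques TNat = {u \<in> vecs (range PNat). (\<Sum>\<^sub>\<infinity>a. u a) \<le> 1}"
    using sum by (auto simp: ty_sem.simps pcs_rename_def pcs_nat_def o_def) (auto simp: vecs_def)
  have "(\<lambda>b. if b = a then 1 else 0) \<in> cliques TNat" if "a \<in> range PNat" for a
    unfolding cl using that infsum_ennreal_single[of a "\<lambda>b. if b = a then 1 else 0"]
    by (auto simp: vecs_def)
  then have "\<exists>u\<in>cliques TNat. u a > 0" if "a \<in> range PNat" for a
    using that by (intro bexI[of _ "\<lambda>b. if b = a then 1 else 0"]) auto
  moreover have "cliques TNat
      = {u \<in> vecs (web_of TNat). \<forall>q\<in>tests TNat. (\<Sum>\<^sub>\<infinity>a. u a * q a) \<le> 1}"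
    unfolding cl web_TNat by simp
  ultimately show ?case unfolding pcs_ok_def web_TNat by simp
next
  case (TFun \<sigma> \<tau>)
  note cl = pcs_ok_fun_cliques[OF TFun]
  have app0: "fun_app t u b = 0" if "t \<in> vecs (web_of (\<sigma> \<rightarrow> \<tau>))" "b \<notin> web_of \<tau>" for t u b
    using that by (simp add: fun_app_eq vecs_def web_fun)
  have "cliques (\<sigma> \<rightarrow> \<tau>)
      = {t \<in> vecs (web_of (\<sigma> \<rightarrow> \<tau>)). \<forall>q\<in>tests (\<sigma> \<rightarrow> \<tau>). (\<Sum>\<^sub>\<infinity>a. t a * q a) \<le> 1}"
  proof (intro set_eqI iffI)
    fix t assume "t \<in> cliques (\<sigma> \<rightarrow> \<tau>)"
    then show "t \<in> {t \<in> vecs (web_of (\<sigma> \<rightarrow> \<tau>)). \<forall>q\<in>tests (\<sigma> \<rightarrow> \<tau>). (\<Sum>\<^sub>\<infinity>a. t a * q a) \<le> 1}"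
      unfolding cl using pcs_ok_test[OF TFun(2)] by (auto simp: infsum_points_test_fun)
  next
    fix t assume t: "t \<in> {t \<in> vecs (web_of (\<sigma> \<rightarrow> \<tau>)). \<forall>q\<in>tests (\<sigma> \<rightarrow> \<tau>). (\<Sum>\<^sub>\<infinity>a. t a * q a) \<le> 1}"
    have "fun_app t u \<in> cliques \<tau>" if "u \<in> cliques \<sigma>" for u
    proof (rule pcs_ok_cliqueI[OF TFun(2)])
      fix q assume "q \<in> tests \<tau>"
      then show "(\<Sum>\<^sub>\<infinity>b. fun_app t u b * q b) \<le> 1"
        using t that by (auto simp: infsum_points_test_fun[symmetric])
    qed (use app0 t in auto)
    then show "t \<in> cliques (\<sigma> \<rightarrow> \<tau>)" unfolding cl using t by simp
  qed
  moreover have "\<exists>q\<in>tests (\<sigma> \<rightarrow> \<tau>). q a > 0" if "a \<in> web_of (\<sigma> \<rightarrow> \<tau>)" for a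
  proof -
    from that obtain \<mu> b where a: "a = PFun \<mu> b" "set_mset \<mu> \<subseteq> web_of \<sigma>" "b \<in> web_of \<tau>"
      unfolding web_fun by blast
    obtain u where u: "u \<in> cliques \<sigma>" "\<And>a. a \<in># \<mu> \<Longrightarrow> u a > 0"
      using pcs_ok_positive[OF TFun(1), of "set_mset \<mu>"] finite_set_mset[of \<mu>] a(2) by blast
    obtain q where q: "q \<in> tests \<tau>" "q b > 0" using TFun(2) a unfolding pcs_ok_def by blast
    have "test_fun u q a > 0"
      using promote_pos[of \<mu> u] u q by (simp add: a test_fun_def ennreal_zero_less_mult_iff)
    then show ?thesis using u q by auto
  qed
  moreover have "\<exists>t\<in>cliques (\<sigma> \<rightarrow> \<tau>). t a > 0" if "a \<in> web_of (\<sigma> \<rightarrow> \<tau>)" for a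
  proof -
    from that obtain \<mu> b where a: "a = PFun \<mu> b" "set_mset \<mu> \<subseteq> web_of \<sigma>" "b \<in> web_of \<tau>"
      unfolding web_fun by blast
    obtain v where v: "v \<in> cliques \<tau>" "v b > 0" using TFun(2) a unfolding pcs_ok_def by blast
    obtain C :: ennreal where C: "C < \<infinity>" "\<And>u. u \<in> cliques \<sigma> \<Longrightarrow> promote u \<mu> \<le> C"
      using pcs_ok_promote_bounded[OF TFun(1)] a by blast
    \<comment> \<open>The matrix with the single entry \<epsilon> at a maps u to \<epsilon> times
      \<open>promote u \<mu>\<close> at b, and this has to stay below \<open>v b\<close> for every
      clique u. Dividing by \<open>C + 1\<close> instead of C avoids a zero denominator.\<close>
    define \<epsilon> where "\<epsilon> = v b / (C + 1)"
    have "v b < \<infinity>" by (rule clique_finite[OF v(1)])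
    have C1: "C + 1 \<noteq> 0" "C + 1 < \<infinity>" using C(1) by auto
    have "\<epsilon> > 0" unfolding \<epsilon>_def using v(2) C1 by (simp add: ennreal_zero_less_divide less_top)
    have "\<epsilon> < \<infinity>"
      unfolding \<epsilon>_def infinity_ennreal_def less_top[symmetric]
      using \<open>v b < \<infinity>\<close> C1 by (auto simp: ennreal_divide_eq_top_iff)
    have \<epsilon>_le: "\<epsilon> * promote u \<mu> \<le> v b" if "u \<in> cliques \<sigma>" for u
    proof -
      have "\<epsilon> * promote u \<mu> \<le> \<epsilon> * (C + 1)"
        using C(2)[OF that] by (intro mult_left_mono) (auto intro: order_trans)
      also have "\<dots> = v b"
        using C1 by (simp add: \<epsilon>_def ennreal_divide_times ennreal_times_divide mult_divide_eq_ennreal less_top)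
      finally show ?thesis .
    qed
    define t where "t = (\<lambda>c. if c = a then \<epsilon> else 0)"
    have app: "fun_app t u = (\<lambda>c. if c = b then \<epsilon> * promote u \<mu> else 0)" for u
    proof
      fix c
      show "fun_app t u c = (if c = b then \<epsilon> * promote u \<mu> else 0)"
        unfolding fun_app_eq t_def a
        by (subst infsum_ennreal_single[of \<mu>]) auto
    qed
    have "t \<in> cliques (\<sigma> \<rightarrow> \<tau>)"
      unfolding cl
    proof (intro conjI ballI)
      show "t \<in> vecs (web_of (\<sigma> \<rightarrow> \<tau>))"
        using that \<open>\<epsilon> < \<infinity>\<close> by (auto simp: t_def vecs_def)
      fix u assume "u \<in> cliques \<sigma>"
      then show "fun_app t u \<in> cliques \<tau>"
        using \<epsilon>_le by (intro pcs_ok_downward[OF TFun(2) v(1)]) (auto simp: app)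
    qed
    moreover have "t a > 0" using \<open>\<epsilon> > 0\<close> by (simp add: t_def)
    ultimately show ?thesis by (intro bexI[of _ t])
  qed
  ultimately show ?case unfolding pcs_ok_def by blast
qed

lemmas cliqueI = pcs_ok_cliqueI[OF pcs_ok]
  and clique_downward = pcs_ok_downward[OF pcs_ok]
  and clique_infsum = pcs_ok_infsum[OF pcs_ok]
  and clique_zero = pcs_ok_zero[OF pcs_ok]
  and clique_SUP = pcs_ok_SUP[OF pcs_ok]
  and clique_positive = pcs_ok_positive[OF pcs_ok]
  and clique_fun_iff = pcs_ok_fun_cliques[OF pcs_ok pcs_ok]

lemma clique_fun_app: "t \<in> cliques (\<sigma> \<rightarrow> \<tau>) \<Longrightarrow> u \<in> cliques \<sigma> \<Longrightarrow> fun_app t u \<in> cliques \<tau>"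
  by (simp add: clique_fun_iff)

lemma clique_TNat_iff:
  "u \<in> cliques TNat \<longleftrightarrow> (\<forall>\<mu> b. u (PFun \<mu> b) = 0) \<and> (\<Sum>\<^sub>\<infinity>n. u (PNat n)) \<le> 1"
proof -
  have sum: "(\<Sum>\<^sub>\<infinity>a. u a) = (\<Sum>\<^sub>\<infinity>n. u (PNat n))" if "\<forall>\<mu> b. u (PFun \<mu> b) = 0"
  proof (rule infsum_ennreal_inj)
    fix a assume "a \<notin> range PNat"
    then show "u a = 0" using that by (cases a) auto
  qed (auto simp: inj_on_def)
  show ?thesis
  proof
    assume u: "u \<in> cliques TNat"
    then have "\<forall>\<mu> b. u (PFun \<mu> b) = 0"
      using clique_outside[OF u] by (auto simp: web_TNat)
    then show "(\<forall>\<mu> b. u (PFun \<mu> b) = 0) \<and> (\<Sum>\<^sub>\<infinity>n. u (PNat n)) \<le> 1"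
      using sum pcs_ok_test[OF pcs_ok u, of "\<lambda>_. 1"] by simp
  next
    assume u: "(\<forall>\<mu> b. u (PFun \<mu> b) = 0) \<and> (\<Sum>\<^sub>\<infinity>n. u (PNat n)) \<le> 1"
    show "u \<in> cliques TNat"
    proof (rule cliqueI)
      fix a assume "a \<notin> web_of TNat"
      then show "u a = 0" using u by (cases a) (auto simp: web_TNat)
    qed (use sum u in auto)
  qed
qed

section \<open>Power series with nonnegative coefficients\<close>

lemma powser_split_head_ennreal:
  fixes a :: "nat \<Rightarrow> ennreal"
  shows "(\<Sum>\<^sub>\<infinity>k. a k * s ^ k) = a 0 + s * (\<Sum>\<^sub>\<infinity>k. a (Suc k) * s ^ k)"
  by (subst infsum_ennreal_Suc) (simp add: infsum_ennreal_cmult[symmetric] ac_simps)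

text \<open>At a point close enough to 0 the tail of b is below any given e, while the series of a
  is still at least \<open>a 0\<close>. Only positive s are used, since the induction in
  \<open>powser_coeff_unique\<close> divides by s.\<close>

lemma powser_head_le:
  fixes a b :: "nat \<Rightarrow> ennreal"
  assumes le: "\<And>s. 0 < s \<Longrightarrow> s \<le> s0 \<Longrightarrow> (\<Sum>\<^sub>\<infinity>k. a k * s ^ k) \<le> (\<Sum>\<^sub>\<infinity>k. b k * s ^ k)"
    and s0: "0 < s0" and fin: "(\<Sum>\<^sub>\<infinity>k. b k * s0 ^ k) < \<infinity>"
  shows "a 0 \<le> b 0"
proof (rule ennreal_le_epsilon)
  fix e :: real assume e: "0 < e"
  obtain c where c: "(\<Sum>\<^sub>\<infinity>k. b k * s0 ^ k) = ennreal c" "c \<ge> 0"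
    using fin by (metis infinity_ennreal_def less_top_ennreal)
  \<comment> \<open>\<open>\<theta> \<le> 1\<close> keeps the point within the range of the
    assumption, and \<open>\<theta> * c \<le> e\<close> controls the tail. The summand 1 avoids
    division by 0.\<close>
  define \<theta> where "\<theta> = min 1 (e / (c + 1))"
  have \<theta>: "0 < \<theta>" "\<theta> \<le> 1" using e c by (auto simp: \<theta>_def)
  have \<theta>c: "\<theta> * c \<le> e"
  proof -
    have "\<theta> * c \<le> e / (c + 1) * c" unfolding \<theta>_def using c by (intro mult_right_mono) auto
    also have "\<dots> \<le> e" using c e by (simp add: field_simps)
    finally show ?thesis .
  qed
  define s where "s = ennreal \<theta> * s0"
  have "0 < s" using \<theta> s0 by (simp add: s_def ennreal_zero_less_mult_iff)
  moreover have "s \<le> s0"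
    using \<theta> mult_right_mono[of "ennreal \<theta>" 1 s0] by (simp add: s_def)
  ultimately have "(\<Sum>\<^sub>\<infinity>k. a k * s ^ k) \<le> (\<Sum>\<^sub>\<infinity>k. b k * s ^ k)" by (rule le)
  moreover have "a 0 \<le> (\<Sum>\<^sub>\<infinity>k. a k * s ^ k)"
    unfolding powser_split_head_ennreal[of a s] by simp
  moreover have "(\<Sum>\<^sub>\<infinity>k. b k * s ^ k) \<le> b 0 + ennreal e"
  proof -
    have "s * (\<Sum>\<^sub>\<infinity>k. b (Suc k) * s ^ k) \<le> ennreal \<theta> * (s0 * (\<Sum>\<^sub>\<infinity>k. b (Suc k) * s0 ^ k))"
      unfolding s_def[symmetric] mult.assoc[symmetric]
      by (intro mult_left_mono infsum_ennreal_mono power_mono \<open>s \<le> s0\<close>) auto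
    also have "\<dots> \<le> ennreal \<theta> * ennreal c"
      unfolding c(1)[symmetric] powser_split_head_ennreal[of b s0] by (intro mult_left_mono) auto
    also have "\<dots> \<le> ennreal e" using \<theta>c \<theta> c by (simp add: ennreal_mult[symmetric] ennreal_leI)
    finally show ?thesis unfolding powser_split_head_ennreal[of b s] by (intro add_left_mono)
  qed
  ultimately show "a 0 \<le> b 0 + ennreal e" by (meson order_trans)
qed

text \<open>The constant coefficients agree by \<open>powser_head_le\<close> in both directions;
  being finite they cancel, and division by s leaves the same situation for the shifted
  sequences.\<close>

lemma powser_coeff_unique:
  fixes a b :: "nat \<Rightarrow> ennreal"
  assumes "\<And>s. 0 < s \<Longrightarrow> s \<le> s0 \<Longrightarrow> (\<Sum>\<^sub>\<infinity>k. a k * s ^ k) = (\<Sum>\<^sub>\<infinity>k. b k * s ^ k)"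
    and s0: "0 < s0" "s0 < \<infinity>" and "(\<Sum>\<^sub>\<infinity>k. a k * s0 ^ k) < \<infinity>"
  shows "a k = b k"
  using assms(1,4)
proof (induction k arbitrary: a b)
  case 0
  then show ?case
    using powser_head_le[of s0 a b] powser_head_le[of s0 b a] s0 by (simp add: antisym)
next
  case (Suc k)
  have fin_b: "(\<Sum>\<^sub>\<infinity>k. b k * s0 ^ k) < \<infinity>" using Suc.prems s0 by simp
  have head: "a 0 = b 0"
    using powser_head_le[of s0 a b] powser_head_le[of s0 b a] s0 Suc.prems fin_b by (simp add: antisym)
  have fin: "a 0 < \<infinity>" "s0 * (\<Sum>\<^sub>\<infinity>k. a (Suc k) * s0 ^ k) < \<infinity>"
    using Suc.prems(2) unfolding powser_split_head_ennreal[of a s0] by auto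
  show ?case
  proof (rule Suc.IH)
    fix s :: ennreal assume s: "0 < s" "s \<le> s0"
    have "a 0 + s * (\<Sum>\<^sub>\<infinity>k. a (Suc k) * s ^ k) = a 0 + s * (\<Sum>\<^sub>\<infinity>k. b (Suc k) * s ^ k)"
      using Suc.prems(1)[OF s] head
      unfolding powser_split_head_ennreal[of a s] powser_split_head_ennreal[of b s] by simp
    then have "s * (\<Sum>\<^sub>\<infinity>k. a (Suc k) * s ^ k) = s * (\<Sum>\<^sub>\<infinity>k. b (Suc k) * s ^ k)"
      using fin(1) by (auto simp: ennreal_add_left_cancel)
    moreover have "s \<noteq> top" using s s0 by auto
    ultimately show "(\<Sum>\<^sub>\<infinity>k. a (Suc k) * s ^ k) = (\<Sum>\<^sub>\<infinity>k. b (Suc k) * s ^ k)"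
      using s(1) by (auto simp: ennreal_mult_cancel_left)
  next
    show "(\<Sum>\<^sub>\<infinity>k. a (Suc k) * s0 ^ k) < \<infinity>"
      using fin(2) s0 by (auto simp: ennreal_mult_less_top)
  qed
qed

text \<open>A multiset is, in a unique way, k copies of x added to a multiset without x. The
  conditional keeps the inner sum over the whole type.\<close>

lemma infsum_mset_split:
  fixes f :: "'a multiset \<Rightarrow> ennreal"
  shows "infsum f UNIV = (\<Sum>\<^sub>\<infinity>k. \<Sum>\<^sub>\<infinity>\<mu>. if x \<in># \<mu> then 0 else f (\<mu> + replicate_mset k x))"
proof -
  have bij: "bij_betw (\<lambda>(k, \<mu>). \<mu> + replicate_mset k x) (UNIV \<times> {\<mu>. x \<notin># \<mu>}) UNIV"
  proof (rule bij_betwI[where g = "\<lambda>\<mu>. (count \<mu> x, filter_mset (\<lambda>y. y \<noteq> x) \<mu>)"])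
    fix p :: "nat \<times> 'a multiset" assume "p \<in> UNIV \<times> {\<mu>. x \<notin># \<mu>}"
    then show "(count (case p of (k, \<mu>) \<Rightarrow> \<mu> + replicate_mset k x) x,
        filter_mset (\<lambda>y. y \<noteq> x) (case p of (k, \<mu>) \<Rightarrow> \<mu> + replicate_mset k x)) = p"
      by (auto simp: not_in_iff intro!: multiset_eqI)
  next
    fix \<mu> :: "'a multiset"
    show "(case (count \<mu> x, filter_mset (\<lambda>y. y \<noteq> x) \<mu>) of (k, \<mu>) \<Rightarrow> \<mu> + replicate_mset k x) = \<mu>"
      by (auto intro!: multiset_eqI)
  qed auto
  have "infsum f UNIV = infsum (\<lambda>(k, \<mu>). f (\<mu> + replicate_mset k x)) (UNIV \<times> {\<mu>. x \<notin># \<mu>})"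
    using infsum_reindex_bij_betw[OF bij, of f] by (simp add: case_prod_unfold)
  also have "\<dots> = infsum (\<lambda>(k, \<mu>). if x \<in># \<mu> then 0 else f (\<mu> + replicate_mset k x)) UNIV"
    by (rule infsum_cong_neutral) auto
  also have "\<dots> = (\<Sum>\<^sub>\<infinity>k. \<Sum>\<^sub>\<infinity>\<mu>. if x \<in># \<mu> then 0 else f (\<mu> + replicate_mset k x))"
    by (rule infsum_ennreal_prod)
  finally show ?thesis .
qed

lemma promote_replicate [simp]: "promote u (replicate_mset k x) = u x ^ k"
  by (induction k) auto

lemma promote_cong: "(\<And>a. a \<in># \<mu> \<Longrightarrow> u a = v a) \<Longrightarrow> promote u \<mu> = promote v \<mu>"
  by (induction \<mu>) auto

lemma infsum_promote_upd:
  assumes "r x = 0"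
  shows "(\<Sum>\<^sub>\<infinity>\<mu>. c \<mu> * promote (r(x := s)) \<mu>)
    = (\<Sum>\<^sub>\<infinity>k. (\<Sum>\<^sub>\<infinity>\<mu>. c (\<mu> + replicate_mset k x) * promote r \<mu>) * s ^ k)"
proof -
  have "(if x \<in># \<mu> then 0 else c (\<mu> + replicate_mset k x) * promote (r(x := s)) (\<mu> + replicate_mset k x))
      = c (\<mu> + replicate_mset k x) * promote r \<mu> * s ^ k" for k \<mu>
  proof (cases "x \<in># \<mu>")
    case True
    then show ?thesis using promote_zero[of x \<mu> r] assms by simp
  next
    case False
    then have "promote (r(x := s)) \<mu> = promote r \<mu>" by (intro promote_cong) auto
    then show ?thesis using False by (simp add: promote_union mult.assoc)
  qed
  then show ?thesis
    by (subst infsum_mset_split[of _ x]) (simp add: infsum_ennreal_cmult_right)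
qed

text \<open>Induction on the variables. With the others frozen, one-variable uniqueness identifies
  the factor of each power of x, and these factors are series in the remaining variables.\<close>

lemma multivariate_coeff_unique:
  fixes c c' :: "'a multiset \<Rightarrow> ennreal" and v :: "'a \<Rightarrow> ennreal"
  assumes "finite F" "\<And>a. a \<in> F \<Longrightarrow> 0 < v a" "\<And>a. a \<in> F \<Longrightarrow> v a < \<infinity>"
    and "\<And>r. (\<And>a. r a \<le> (if a \<in> F then v a else 0)) \<Longrightarrow>
      (\<Sum>\<^sub>\<infinity>\<mu>. c \<mu> * promote r \<mu>) = (\<Sum>\<^sub>\<infinity>\<mu>. c' \<mu> * promote r \<mu>) \<and>
      (\<Sum>\<^sub>\<infinity>\<mu>. c \<mu> * promote r \<mu>) < \<infinity>"
    and "set_mset \<nu> \<subseteq> F"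
  shows "c \<nu> = c' \<nu>"
  using assms
proof (induction F arbitrary: c c' \<nu> rule: finite_induct)
  case empty
  have "promote (\<lambda>_. 0) \<mu> = 0" if "\<mu> \<noteq> {#}" for \<mu> :: "'a multiset"
    using that by (metis multiset_nonemptyE promote_zero)
  then have "(\<Sum>\<^sub>\<infinity>\<mu>. c \<mu> * promote (\<lambda>_. 0) \<mu>) = c {#}" for c :: "'a multiset \<Rightarrow> ennreal"
    by (subst infsum_ennreal_single[of "{#}"]) auto
  then show ?case using empty.prems(3)[of "\<lambda>_. 0"] empty.prems(4) by simp
next
  case (insert x F)
  have eq: "c (\<nu>' + replicate_mset k x) = c' (\<nu>' + replicate_mset k x)" if "set_mset \<nu>' \<subseteq> F" for \<nu>' k
  proof (rule insert.IH[where c = "\<lambda>\<mu>. c (\<mu> + replicate_mset k x)"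
        and c' = "\<lambda>\<mu>. c' (\<mu> + replicate_mset k x)" and \<nu> = \<nu>'])
    fix r :: "'a \<Rightarrow> ennreal" assume r: "\<And>a. r a \<le> (if a \<in> F then v a else 0)"
    have rx: "r x = 0" using r[of x] insert.hyps by simp
    define A where "A c k = (\<Sum>\<^sub>\<infinity>\<mu>. c (\<mu> + replicate_mset k x) * promote r \<mu>)"
      for c :: "'a multiset \<Rightarrow> ennreal" and k
    have upd: "(\<Sum>\<^sub>\<infinity>k. A c k * s ^ k) = (\<Sum>\<^sub>\<infinity>\<mu>. c \<mu> * promote (r(x := s)) \<mu>)" for c s
      unfolding A_def infsum_promote_upd[of r, OF rx] ..
    have prem: "(\<Sum>\<^sub>\<infinity>k. A c k * s ^ k) = (\<Sum>\<^sub>\<infinity>k. A c' k * s ^ k) \<and> (\<Sum>\<^sub>\<infinity>k. A c k * s ^ k) < \<infinity>"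
      if "s \<le> v x" for s
      unfolding upd
    proof (rule insert.prems(3))
      show "(r(x := s)) a \<le> (if a \<in> insert x F then v a else 0)" for a
        using r[of a] that by auto
    qed
    have "A c k = A c' k"
    proof (rule powser_coeff_unique[of "v x" "A c" "A c'"])
      show "(\<Sum>\<^sub>\<infinity>k. A c k * s ^ k) = (\<Sum>\<^sub>\<infinity>k. A c' k * s ^ k)" if "s \<le> v x" for s
        using prem[OF that] by (rule conjunct1)
      show "(\<Sum>\<^sub>\<infinity>k. A c k * v x ^ k) < \<infinity>"
        using prem[OF order_refl] by (rule conjunct2)
    qed (use insert.prems(1,2) in simp_all)
    \<comment> \<open>The induction hypothesis also asks for finite values; a term of a finite
      series with \<open>v x > 0\<close> provides them.\<close>
    moreover have "A c k < \<infinity>"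
    proof -
      have "A c k * v x ^ k \<le> (\<Sum>\<^sub>\<infinity>k. A c k * v x ^ k)"
        by (rule le_infsum_ennreal[of "\<lambda>k. A c k * v x ^ k"])
      also have "\<dots> < \<infinity>" using prem[OF order_refl] by (rule conjunct2)
      finally have "A c k * v x ^ k < \<infinity>" .
      moreover have "v x ^ k \<noteq> 0" using insert.prems(1)[of x] by simp
      ultimately show ?thesis by (auto simp: ennreal_mult_less_top)
    qed
    ultimately show "(\<Sum>\<^sub>\<infinity>\<mu>. c (\<mu> + replicate_mset k x) * promote r \<mu>)
        = (\<Sum>\<^sub>\<infinity>\<mu>. c' (\<mu> + replicate_mset k x) * promote r \<mu>) \<and>
        (\<Sum>\<^sub>\<infinity>\<mu>. c (\<mu> + replicate_mset k x) * promote r \<mu>) < \<infinity>"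
      unfolding A_def by simp
  qed (use insert.prems that in auto)
  have "\<nu> = filter_mset (\<lambda>y. y \<noteq> x) \<nu> + replicate_mset (count \<nu> x) x"
    by (auto intro!: multiset_eqI)
  moreover have "set_mset (filter_mset (\<lambda>y. y \<noteq> x) \<nu>) \<subseteq> F" using insert.prems(4) by auto
  ultimately show ?case using eq by metis
qed

text \<open>For the coefficient at \<nu>, only vectors supported on \<nu> and below a clique
  positive there are tried. By downward closure they are cliques, so the two functions agree on
  them.\<close>

lemma clique_fun_eqI:
  assumes t: "t \<in> cliques (\<sigma> \<rightarrow> \<tau>)" and t': "t' \<in> cliques (\<sigma> \<rightarrow> \<tau>)"
    and eq: "\<And>u. u \<in> cliques \<sigma> \<Longrightarrow> fun_app t u = fun_app t' u"
  shows "t = t'"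
proof
  fix a
  show "t a = t' a"
  proof (cases "a \<in> web_of (\<sigma> \<rightarrow> \<tau>)")
    case True
    then obtain \<nu> b where a: "a = PFun \<nu> b" "set_mset \<nu> \<subseteq> web_of \<sigma>" unfolding web_fun by blast
    obtain v where v: "v \<in> cliques \<sigma>" "\<forall>a\<in>#\<nu>. 0 < v a"
      using clique_positive[OF finite_set_mset a(2)] by blast
    have "t (PFun \<nu> b) = t' (PFun \<nu> b)"
    proof (rule multivariate_coeff_unique[of "set_mset \<nu>" v "\<lambda>\<nu>. t (PFun \<nu> b)" "\<lambda>\<nu>. t' (PFun \<nu> b)"])
      fix r assume r: "\<And>a. r a \<le> (if a \<in># \<nu> then v a else 0)"
      have "r \<in> cliques \<sigma>"
      proof (rule clique_downward[OF v(1)])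
        show "r a \<le> v a" for a using r[of a] by (auto split: if_splits)
      qed
      then show "(\<Sum>\<^sub>\<infinity>\<mu>. t (PFun \<mu> b) * promote r \<mu>) = (\<Sum>\<^sub>\<infinity>\<mu>. t' (PFun \<mu> b) * promote r \<mu>) \<and>
          (\<Sum>\<^sub>\<infinity>\<mu>. t (PFun \<mu> b) * promote r \<mu>) < \<infinity>"
        unfolding fun_app_eq[symmetric] using eq clique_finite[OF clique_fun_app[OF t]] by auto
    qed (use v clique_finite[OF v(1)] in auto)
    then show ?thesis by (simp add: a)
  next
    case False
    then show ?thesis using clique_outside[OF t] clique_outside[OF t'] by simp
  qed
qed

section \<open>A generated class of power series in the environment, closed under currying and fixed
  points\<close>

type_synonym env = "vname \<Rightarrow> point vec"

text \<open>Coefficients are not stored, and with values in \<open>ennreal\<close> there is no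
  convergence condition. Sums over point multisets are what application and currying produce; the
  rule needs one fixed index type, and other countable sums are embedded into it.\<close>

inductive power_series :: "(env \<Rightarrow> ennreal) \<Rightarrow> bool" where
  const: "power_series (\<lambda>_. c)"
| coord: "power_series (\<lambda>\<rho>. \<rho> x a)"
| mult: "power_series f \<Longrightarrow> power_series g \<Longrightarrow> power_series (\<lambda>\<rho>. f \<rho> * g \<rho>)"
| msum: "(\<And>i :: point multiset. power_series (f i)) \<Longrightarrow> power_series (\<lambda>\<rho>. \<Sum>\<^sub>\<infinity>i. f i \<rho>)"

text \<open>The number n is coded as the multiset with n copies of \<open>PNat 0\<close>, and
  multisets that are not codes contribute 0.\<close>

lemma power_series_nat_sum:
  assumes "\<And>n::nat. power_series (f n)"
  shows "power_series (\<lambda>\<rho>. \<Sum>\<^sub>\<infinity>n. f n \<rho>)"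
proof -
  define g where "g n = replicate_mset n (PNat 0)" for n
  have g: "inj g" by (metis g_def injI size_replicate_mset)
  define h where "h i = (if i \<in> range g then f (inv g i) else (\<lambda>_. 0))" for i
  have "power_series (h i)" for i by (simp add: h_def assms const)
  then have "power_series (\<lambda>\<rho>. \<Sum>\<^sub>\<infinity>i. h i \<rho>)" by (rule msum)
  moreover have "(\<Sum>\<^sub>\<infinity>i. h i \<rho>) = (\<Sum>\<^sub>\<infinity>n. f n \<rho>)" for \<rho>
    by (subst infsum_ennreal_inj[OF g]) (auto simp: h_def g)
  ultimately show ?thesis by simp
qed

lemma power_series_add:
  assumes "power_series f" "power_series g"
  shows "power_series (\<lambda>\<rho>. f \<rho> + g \<rho>)"
proof -
  define h where "h n = (if n = 0 then f else if n = Suc 0 then g else (\<lambda>_. 0))" for n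
  have "power_series (h n)" for n by (simp add: h_def assms const)
  then have "power_series (\<lambda>\<rho>. \<Sum>\<^sub>\<infinity>n. h n \<rho>)" by (rule power_series_nat_sum)
  moreover have "(\<Sum>\<^sub>\<infinity>n. h n \<rho>) = f \<rho> + g \<rho>" for \<rho>
    by (subst infsum_ennreal_Suc, subst infsum_ennreal_Suc) (simp add: h_def)
  ultimately show ?thesis by simp
qed

lemma power_series_promote:
  "(\<And>a. power_series (u a)) \<Longrightarrow> power_series (\<lambda>\<rho>. promote (\<lambda>a. u a \<rho>) \<mu>)"
  by (induction \<mu>) (auto intro: power_series.intros)

lemma power_series_fun_app:
  assumes "\<And>a. power_series (t a)" "\<And>a. power_series (u a)"
  shows "power_series (\<lambda>\<rho>. fun_app (\<lambda>a. t a \<rho>) (\<lambda>a. u a \<rho>) b)"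
  unfolding fun_app_eq by (intro msum mult power_series_promote assms)

text \<open>Induction over the generation of G yields the coefficients in the variable x, each again
  a power series in the rest of the environment.\<close>

lemma power_series_curry:
  assumes "power_series G"
  shows "\<exists>H. (\<forall>\<mu>. power_series (H \<mu>)) \<and> (\<forall>\<rho> u. G (\<rho>(x := u)) = (\<Sum>\<^sub>\<infinity>\<mu>. H \<mu> \<rho> * promote u \<mu>))"
  using assms
proof induction
  case (const c)
  define H where "H \<mu> = (\<lambda>\<rho>::env. if \<mu> = {#} then c else 0)" for \<mu> :: "point multiset"
  have "power_series (H \<mu>)" for \<mu> unfolding H_def by (rule power_series.const)
  moreover have "c = (\<Sum>\<^sub>\<infinity>\<mu>. H \<mu> \<rho> * promote u \<mu>)" for \<rho> u
    by (subst infsum_ennreal_single[of "{#}"]) (auto simp: H_def)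
  ultimately show ?case by (intro exI[of _ H] conjI allI)
next
  case (coord y a)
  show ?case
  proof (cases "y = x")
    case True
    define H where "H \<mu> = (\<lambda>\<rho>::env. if \<mu> = {#a#} then 1 else 0 :: ennreal)" for \<mu>
    have "power_series (H \<mu>)" for \<mu> unfolding H_def by (rule power_series.const)
    moreover have "(\<rho>(x := u)) y a = (\<Sum>\<^sub>\<infinity>\<mu>. H \<mu> \<rho> * promote u \<mu>)" for \<rho> u
      by (subst infsum_ennreal_single[of "{#a#}"]) (auto simp: H_def True)
    ultimately show ?thesis by (intro exI[of _ H] conjI allI)
  next
    case False
    define H where "H \<mu> = (\<lambda>\<rho>. if \<mu> = {#} then \<rho> y a else 0 :: ennreal)" for \<mu> :: "point multiset"
    have "power_series (H \<mu>)" for \<mu> unfolding H_def by (cases "\<mu> = {#}") (auto intro: power_series.intros)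
    moreover have "(\<rho>(x := u)) y a = (\<Sum>\<^sub>\<infinity>\<mu>. H \<mu> \<rho> * promote u \<mu>)" for \<rho> u
      by (subst infsum_ennreal_single[of "{#}"]) (auto simp: H_def False)
    ultimately show ?thesis by (intro exI[of _ H] conjI allI)
  qed
next
  case (mult f g)
  obtain F where F: "\<forall>\<mu>. power_series (F \<mu>)"
      "\<forall>\<rho> u. f (\<rho>(x := u)) = (\<Sum>\<^sub>\<infinity>\<mu>. F \<mu> \<rho> * promote u \<mu>)"
    using mult.IH(1) by (elim exE conjE)
  obtain G where G: "\<forall>\<mu>. power_series (G \<mu>)"
      "\<forall>\<rho> u. g (\<rho>(x := u)) = (\<Sum>\<^sub>\<infinity>\<mu>. G \<mu> \<rho> * promote u \<mu>)"
    using mult.IH(2) by (elim exE conjE)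
  note F = F[rule_format] and G = G[rule_format]
  \<comment> \<open>The Cauchy product over multiset union. The sum over decompositions of \<mu> is
    written with an indicator, so that it is built by the rules \<open>msum\<close> and
    \<open>mult\<close>.\<close>
  define H where "H \<mu> = (\<lambda>\<rho>. \<Sum>\<^sub>\<infinity>k. \<Sum>\<^sub>\<infinity>l. (if k + l = \<mu> then 1 else 0) * (F k \<rho> * G l \<rho>))" for \<mu>
  have "power_series (H \<mu>)" for \<mu>
    unfolding H_def by (intro power_series.intros F G)
  moreover have "f (\<rho>(x := u)) * g (\<rho>(x := u)) = (\<Sum>\<^sub>\<infinity>\<mu>. H \<mu> \<rho> * promote u \<mu>)" for \<rho> u
  proof -
    let ?e = "\<lambda>\<mu> k l. (if k + l = \<mu> then 1 else 0) * (F k \<rho> * G l \<rho>) * promote u \<mu>"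
    have "(\<Sum>\<^sub>\<infinity>\<mu>. H \<mu> \<rho> * promote u \<mu>) = (\<Sum>\<^sub>\<infinity>\<mu>. \<Sum>\<^sub>\<infinity>k. \<Sum>\<^sub>\<infinity>l. ?e \<mu> k l)"
      by (simp add: H_def infsum_ennreal_cmult_right)
    also have "\<dots> = (\<Sum>\<^sub>\<infinity>k. \<Sum>\<^sub>\<infinity>\<mu>. \<Sum>\<^sub>\<infinity>l. ?e \<mu> k l)" by (rule infsum_ennreal_swap)
    also have "\<dots> = (\<Sum>\<^sub>\<infinity>k. \<Sum>\<^sub>\<infinity>l. \<Sum>\<^sub>\<infinity>\<mu>. ?e \<mu> k l)"
      by (intro infsum_cong infsum_ennreal_swap)
    also have "\<dots> = (\<Sum>\<^sub>\<infinity>k. \<Sum>\<^sub>\<infinity>l. (F k \<rho> * promote u k) * (G l \<rho> * promote u l))"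
    proof (intro infsum_cong)
      fix k l
      show "(\<Sum>\<^sub>\<infinity>\<mu>. ?e \<mu> k l) = (F k \<rho> * promote u k) * (G l \<rho> * promote u l)"
        by (subst infsum_ennreal_single[of "k + l"]) (auto simp: promote_union ac_simps)
    qed
    also have "\<dots> = f (\<rho>(x := u)) * g (\<rho>(x := u))"
      unfolding F G by (simp add: infsum_ennreal_cmult infsum_ennreal_cmult_right)
    finally show ?thesis by simp
  qed
  ultimately show ?case by (intro exI[of _ H] conjI allI)
next
  case (msum f)
  from choice[OF allI[OF msum.IH]] obtain H where
    "\<forall>i. (\<forall>\<mu>. power_series (H i \<mu>)) \<and>
      (\<forall>\<rho> u. f i (\<rho>(x := u)) = (\<Sum>\<^sub>\<infinity>\<mu>. H i \<mu> \<rho> * promote u \<mu>))" ..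
  then have H: "\<And>i \<mu>. power_series (H i \<mu>)"
      "\<And>i \<rho> u. f i (\<rho>(x := u)) = (\<Sum>\<^sub>\<infinity>\<mu>. H i \<mu> \<rho> * promote u \<mu>)" by simp_all
  have "(\<Sum>\<^sub>\<infinity>i. f i (\<rho>(x := u))) = (\<Sum>\<^sub>\<infinity>\<mu>. (\<Sum>\<^sub>\<infinity>i. H i \<mu> \<rho>) * promote u \<mu>)" for \<rho> u
  proof -
    have "(\<Sum>\<^sub>\<infinity>i. f i (\<rho>(x := u))) = (\<Sum>\<^sub>\<infinity>\<mu>. \<Sum>\<^sub>\<infinity>i. H i \<mu> \<rho> * promote u \<mu>)"
      unfolding H by (rule infsum_ennreal_swap)
    then show ?thesis by (simp add: infsum_ennreal_cmult_right)
  qed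
  moreover have "power_series (\<lambda>\<rho>. \<Sum>\<^sub>\<infinity>i. H i \<mu> \<rho>)" for \<mu> by (intro power_series.msum H)
  ultimately show ?case by (intro exI[of _ "\<lambda>\<mu> \<rho>. \<Sum>\<^sub>\<infinity>i. H i \<mu> \<rho>"] conjI allI)
qed

text \<open>A difference of power series need not have nonnegative coefficients, so the increment is
  produced explicitly by expanding the product factor by factor.\<close>

lemma promote_increment:
  assumes "\<And>a. power_series (u a)" "\<And>a. power_series (v a)"
  shows "\<exists>w. power_series w \<and>
    (\<forall>\<rho>. promote (\<lambda>a. u a \<rho> + v a \<rho>) \<mu> = promote (\<lambda>a. u a \<rho>) \<mu> + w \<rho>)"
proof (induction \<mu>)
  case empty
  show ?case by (intro exI[of _ "\<lambda>_. 0"]) (auto intro: power_series.const)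
next
  case (add a \<mu>)
  then obtain w where w: "power_series w"
    "\<forall>\<rho>. promote (\<lambda>a. u a \<rho> + v a \<rho>) \<mu> = promote (\<lambda>a. u a \<rho>) \<mu> + w \<rho>" by (elim exE conjE)
  show ?case
    by (rule exI[of _ "\<lambda>\<rho>. u a \<rho> * w \<rho> + v a \<rho> * (promote (\<lambda>a. u a \<rho>) \<mu> + w \<rho>)"])
      (auto simp: w algebra_simps intro!: power_series_add power_series.mult power_series_promote assms)
qed

lemma fun_app_increment:
  assumes t: "\<And>a. power_series (t a)" and "\<And>a. power_series (u a)" "\<And>a. power_series (v a)"
  shows "\<exists>w. (\<forall>b. power_series (w b)) \<and>
    (\<forall>\<rho> b. fun_app (\<lambda>a. t a \<rho>) (\<lambda>a. u a \<rho> + v a \<rho>) b = fun_app (\<lambda>a. t a \<rho>) (\<lambda>a. u a \<rho>) b + w b \<rho>)"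
proof -
  from choice[OF allI[OF promote_increment[of u v, OF assms(2,3)]]] obtain w where
    "\<forall>\<mu>. power_series (w \<mu>) \<and>
      (\<forall>\<rho>. promote (\<lambda>a. u a \<rho> + v a \<rho>) \<mu> = promote (\<lambda>a. u a \<rho>) \<mu> + w \<mu> \<rho>)" ..
  then have w: "\<And>\<mu>. power_series (w \<mu>)"
    "\<And>\<mu> \<rho>. promote (\<lambda>a. u a \<rho> + v a \<rho>) \<mu> = promote (\<lambda>a. u a \<rho>) \<mu> + w \<mu> \<rho>"
    by simp_all
  show ?thesis
    by (rule exI[of _ "\<lambda>b \<rho>. \<Sum>\<^sub>\<infinity>\<mu>. t (PFun \<mu> b) \<rho> * w \<mu> \<rho>"])
      (auto simp: fun_app_eq w(2) distrib_left infsum_ennreal_add intro!: power_series.intros t w(1))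
qed

lemma incseq_fun_app_iterates:
  fixes t :: "point vec"
  shows "incseq (\<lambda>n. (fun_app t ^^ n) (\<lambda>_. 0) b)"
proof (rule incseq_SucI)
  show "(fun_app t ^^ n) (\<lambda>_. 0) b \<le> (fun_app t ^^ Suc n) (\<lambda>_. 0) b" for n
    by (induction n arbitrary: b) (auto intro: fun_app_mono)
qed

text \<open>The limit is rewritten as the sum of the increments of the iteration, which are again power
  series with nonnegative coefficients; monotonicity of the approximants alone would not give
  convergence of their coefficients.\<close>

lemma power_series_fix:
  assumes t: "\<And>a. power_series (t a)"
  shows "power_series (\<lambda>\<rho>. SUP n. (fun_app (\<lambda>a. t a \<rho>) ^^ n) (\<lambda>_. 0) b)"
proof -
  define s where "s n a = (\<lambda>\<rho>. (fun_app (\<lambda>a. t a \<rho>) ^^ n) (\<lambda>_. 0) a)" for n a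
  have s: "power_series (s n a)" for n a
  proof (induction n arbitrary: a)
    case (Suc n)
    then show ?case using power_series_fun_app[OF t, where u = "s n" and b = a] by (simp add: s_def)
  qed (simp add: s_def power_series.const)
  \<comment> \<open>The increments are built recursively: the next one is the change of
    \<open>fun_app\<close> when its argument grows from \<open>s n\<close> to \<open>s n\<close>
    plus the current increment.\<close>
  have "\<exists>d. (\<forall>a. power_series (d a)) \<and> (\<forall>\<rho> a. s (Suc n) a \<rho> = s n a \<rho> + d a \<rho>)" for n
  proof (induction n)
    case 0
    show ?case using s[of 1] by (intro exI[of _ "s 1"]) (simp add: s_def)
  next
    case (Suc n)
    then obtain d where "\<forall>a. power_series (d a)" "\<forall>\<rho> a. s (Suc n) a \<rho> = s n a \<rho> + d a \<rho>"
      by (elim exE conjE)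
    note d = this[rule_format]
    obtain w where "\<forall>a. power_series (w a)" "\<forall>\<rho> a.
        fun_app (\<lambda>a. t a \<rho>) (\<lambda>a. s n a \<rho> + d a \<rho>) a = fun_app (\<lambda>a. t a \<rho>) (\<lambda>a. s n a \<rho>) a + w a \<rho>"
      using fun_app_increment[of t "s n" d, OF t s d(1)] by (elim exE conjE)
    note w = this[rule_format]
    have step: "s (Suc n) a \<rho> = fun_app (\<lambda>a. t a \<rho>) (\<lambda>a. s n a \<rho>) a" for n a \<rho>
      by (simp add: s_def)
    have "s (Suc (Suc n)) a \<rho> = s (Suc n) a \<rho> + w a \<rho>" for a \<rho>
      unfolding step[of "Suc n"] d(2) w(2) by (simp add: step[symmetric] d(2)[symmetric])
    then show ?case using w(1) by (intro exI[of _ w]) simp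
  qed
  then obtain d where "\<forall>n. (\<forall>a. power_series (d n a)) \<and> (\<forall>\<rho> a. s (Suc n) a \<rho> = s n a \<rho> + d n a \<rho>)"
    using choice[of "\<lambda>n d. (\<forall>a. power_series (d a)) \<and> (\<forall>\<rho> a. s (Suc n) a \<rho> = s n a \<rho> + d a \<rho>)"]
    by blast
  then have d: "\<And>n a. power_series (d n a)" "\<And>n \<rho> a. s (Suc n) a \<rho> = s n a \<rho> + d n a \<rho>"
    by simp_all
  have "(SUP n. s n b \<rho>) = (\<Sum>\<^sub>\<infinity>n. d n b \<rho>)" for \<rho>
  proof (rule SUP_partial_sums_ennreal)
    show "s 0 b \<rho> = 0" by (simp add: s_def)
  qed (rule d(2))
  moreover have "power_series (\<lambda>\<rho>. \<Sum>\<^sub>\<infinity>n. d n b \<rho>)" by (intro power_series_nat_sum d)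
  ultimately show ?thesis unfolding s_def by simp
qed

section \<open>Well-definedness of the denotational semantics\<close>

inductive_cases typing_NumE: "\<Gamma> \<turnstile> Num n : \<tau>"
inductive_cases typing_SuccE: "\<Gamma> \<turnstile> Succ M : \<tau>"
inductive_cases typing_PredE: "\<Gamma> \<turnstile> Pred M : \<tau>"
inductive_cases typing_VarE: "\<Gamma> \<turnstile> Var x : \<tau>"
inductive_cases typing_CoinE: "\<Gamma> \<turnstile> Coin r : \<tau>"
inductive_cases typing_LetE: "\<Gamma> \<turnstile> Let x M N : \<tau>"
inductive_cases typing_IfE: "\<Gamma> \<turnstile> If M N P : \<tau>"
inductive_cases typing_AppE: "\<Gamma> \<turnstile> App M N : \<tau>"
inductive_cases typing_LamE: "\<Gamma> \<turnstile> Lam x \<sigma> M : \<tau>"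
inductive_cases typing_FixE: "\<Gamma> \<turnstile> Fix M : \<tau>"

text \<open>The definite description for abstractions in \<open>sem\<close> quantifies the result
  type existentially; uniqueness of types pins it down.\<close>

lemma typing_unique: "\<Gamma> \<turnstile> M : \<tau> \<Longrightarrow> \<Gamma> \<turnstile> M : \<tau>' \<Longrightarrow> \<tau> = \<tau>'"
proof (induction arbitrary: \<tau>' rule: typing.induct)
  case (T_App \<Gamma> M \<sigma> \<tau> N)
  from T_App.prems T_App.IH(1) show ?case by (auto elim!: typing_AppE)
next
  case (T_Lam \<Gamma> x \<sigma> M \<tau>)
  from T_Lam.prems T_Lam.IH show ?case by (auto elim!: typing_LamE simp del: fun_upd_apply)
next
  case (T_Fix \<Gamma> M \<sigma>)
  from T_Fix.prems T_Fix.IH show ?case by (auto elim!: typing_FixE)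
next
  case (T_If \<Gamma> M N \<sigma> P)
  from T_If.prems T_If.IH(2) show ?case by (auto elim!: typing_IfE)
next
  case (T_Let \<Gamma> M x N \<sigma>)
  from T_Let.prems T_Let.IH(2) show ?case by (auto elim!: typing_LetE simp del: fun_upd_apply)
next
  case (T_Var \<Gamma> x \<sigma>)
  from T_Var.prems T_Var.hyps show ?case by (auto elim!: typing_VarE)
qed (auto elim: typing_NumE typing_SuccE typing_PredE typing_CoinE)

lemma typing_subst_Num:
  assumes "\<Gamma>(x \<mapsto> TNat) \<turnstile> M : \<tau>"
  shows "\<Gamma> \<turnstile> subst x (Num n) M : \<tau>"
  using assms
proof (induction M arbitrary: \<Gamma> \<tau>)
  case (Var y)
  then show ?case by (auto elim!: typing_VarE intro: typing.intros split: if_splits)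
next
  case (Let y M N)
  from Let.prems have M: "\<Gamma>(x \<mapsto> TNat) \<turnstile> M : TNat" and N: "\<Gamma>(x \<mapsto> TNat, y \<mapsto> TNat) \<turnstile> N : \<tau>"
    by (auto elim!: typing_LetE simp del: fun_upd_apply)
  have "\<Gamma>(y \<mapsto> TNat) \<turnstile> (if x = y then N else subst x (Num n) N) : \<tau>"
    using N Let.IH(2)[of "\<Gamma>(y \<mapsto> TNat)" \<tau>]
    by (auto simp: fun_upd_twist simp del: fun_upd_apply)
  then show ?case using Let.IH(1)[OF M] by (auto intro: typing.intros)
next
  case (Lam y \<sigma> M)
  from Lam.prems obtain \<tau>' where \<tau>: "\<tau> = \<sigma> \<rightarrow> \<tau>'" and M: "\<Gamma>(x \<mapsto> TNat, y \<mapsto> \<sigma>) \<turnstile> M : \<tau>'"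
    by (auto elim!: typing_LamE simp del: fun_upd_apply)
  have "\<Gamma>(y \<mapsto> \<sigma>) \<turnstile> (if x = y then M else subst x (Num n) M) : \<tau>'"
    using M Lam.IH[of "\<Gamma>(y \<mapsto> \<sigma>)" \<tau>'] by (auto simp: fun_upd_twist simp del: fun_upd_apply)
  then show ?case by (auto simp: \<tau> intro: typing.intros)
next
  case (App M N)
  from App.prems obtain \<sigma> where "\<Gamma>(x \<mapsto> TNat) \<turnstile> M : \<sigma> \<rightarrow> \<tau>" "\<Gamma>(x \<mapsto> TNat) \<turnstile> N : \<sigma>"
    by (rule typing_AppE)
  then show ?case using T_App[OF App.IH(1)[of \<Gamma> "\<sigma> \<rightarrow> \<tau>"] App.IH(2)[of \<Gamma> \<sigma>]] by (simp del: fun_upd_apply)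
qed (auto elim!: typing_NumE typing_SuccE typing_PredE typing_CoinE typing_IfE
      typing_FixE intro: typing.intros)

definition env_ok :: "ctx \<Rightarrow> env \<Rightarrow> bool" where
  "env_ok \<Gamma> \<rho> \<longleftrightarrow> (\<forall>x \<sigma>. \<Gamma> x = Some \<sigma> \<longrightarrow> \<rho> x \<in> cliques \<sigma>)"

lemma env_ok_upd: "env_ok \<Gamma> \<rho> \<Longrightarrow> u \<in> cliques \<sigma> \<Longrightarrow> env_ok (\<Gamma>(x \<mapsto> \<sigma>)) (\<rho>(x := u))"
  by (auto simp: env_ok_def)

text \<open>Agreement is required only on environments of cliques, since elsewhere the definite
  description of an abstraction may be meaningless.\<close>

definition analytic :: "ctx \<Rightarrow> (env \<Rightarrow> ennreal) \<Rightarrow> bool" where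
  "analytic \<Gamma> f \<longleftrightarrow> (\<exists>g. power_series g \<and> (\<forall>\<rho>. env_ok \<Gamma> \<rho> \<longrightarrow> f \<rho> = g \<rho>))"

lemma analyticI: "power_series g \<Longrightarrow> (\<And>\<rho>. env_ok \<Gamma> \<rho> \<Longrightarrow> f \<rho> = g \<rho>) \<Longrightarrow> analytic \<Gamma> f"
  unfolding analytic_def by (intro exI[of _ g]) simp

lemma analyticE:
  assumes "analytic \<Gamma> f"
  obtains g where "power_series g" "\<And>\<rho>. env_ok \<Gamma> \<rho> \<Longrightarrow> f \<rho> = g \<rho>"
  using assms unfolding analytic_def by (elim exE conjE) (rule that, simp_all)

lemma analytic_family:
  assumes "\<And>i. analytic \<Gamma> (f i)"
  obtains g where "\<And>i. power_series (g i)" "\<And>i \<rho>. env_ok \<Gamma> \<rho> \<Longrightarrow> f i \<rho> = g i \<rho>"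
proof -
  from choice[OF allI[OF assms[unfolded analytic_def]]] obtain g where
    "\<forall>i. power_series (g i) \<and> (\<forall>\<rho>. env_ok \<Gamma> \<rho> \<longrightarrow> f i \<rho> = g i \<rho>)" ..
  then show ?thesis by (intro that[of g]) simp_all
qed

lemma analytic_const: "analytic \<Gamma> (\<lambda>_. c)"
  by (rule analyticI[OF power_series.const]) simp

lemma analytic_mult:
  assumes "analytic \<Gamma> f" "analytic \<Gamma> g"
  shows "analytic \<Gamma> (\<lambda>\<rho>. f \<rho> * g \<rho>)"
proof -
  obtain f' where f': "power_series f'" "\<And>\<rho>. env_ok \<Gamma> \<rho> \<Longrightarrow> f \<rho> = f' \<rho>"
    using assms(1) by (rule analyticE) (rule that)
  obtain g' where g': "power_series g'" "\<And>\<rho>. env_ok \<Gamma> \<rho> \<Longrightarrow> g \<rho> = g' \<rho>"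
    using assms(2) by (rule analyticE) (rule that)
  show ?thesis by (rule analyticI[OF power_series.mult[OF f'(1) g'(1)]]) (simp add: f' g')
qed

lemma analytic_add:
  assumes "analytic \<Gamma> f" "analytic \<Gamma> g"
  shows "analytic \<Gamma> (\<lambda>\<rho>. f \<rho> + g \<rho>)"
proof -
  obtain f' where f': "power_series f'" "\<And>\<rho>. env_ok \<Gamma> \<rho> \<Longrightarrow> f \<rho> = f' \<rho>"
    using assms(1) by (rule analyticE) (rule that)
  obtain g' where g': "power_series g'" "\<And>\<rho>. env_ok \<Gamma> \<rho> \<Longrightarrow> g \<rho> = g' \<rho>"
    using assms(2) by (rule analyticE) (rule that)
  show ?thesis by (rule analyticI[OF power_series_add[OF f'(1) g'(1)]]) (simp add: f' g')
qed

lemma analytic_nat_sum: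
  assumes "\<And>n::nat. analytic \<Gamma> (f n)"
  shows "analytic \<Gamma> (\<lambda>\<rho>. \<Sum>\<^sub>\<infinity>n. f n \<rho>)"
proof -
  obtain g where g: "\<And>i. power_series (g i)" "\<And>i \<rho>. env_ok \<Gamma> \<rho> \<Longrightarrow> f i \<rho> = g i \<rho>"
    using analytic_family[of \<Gamma> f, OF assms] by metis
  show ?thesis by (rule analyticI[OF power_series_nat_sum[of g, OF g(1)]]) (simp add: g(2))
qed

lemma analytic_fun_app:
  assumes "\<And>a. analytic \<Gamma> (\<lambda>\<rho>. t \<rho> a)" "\<And>a. analytic \<Gamma> (\<lambda>\<rho>. u \<rho> a)"
  shows "analytic \<Gamma> (\<lambda>\<rho>. fun_app (t \<rho>) (u \<rho>) b)"
proof -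
  obtain t' where t': "\<And>a. power_series (t' a)" "\<And>a \<rho>. env_ok \<Gamma> \<rho> \<Longrightarrow> t \<rho> a = t' a \<rho>"
    using analytic_family[of \<Gamma> "\<lambda>a \<rho>. t \<rho> a", OF assms(1)] by metis
  obtain u' where u': "\<And>a. power_series (u' a)" "\<And>a \<rho>. env_ok \<Gamma> \<rho> \<Longrightarrow> u \<rho> a = u' a \<rho>"
    using analytic_family[of \<Gamma> "\<lambda>a \<rho>. u \<rho> a", OF assms(2)] by metis
  show ?thesis
    by (rule analyticI[OF power_series_fun_app[of t' u' b, OF t'(1) u'(1)]])
      (simp add: t'(2)[symmetric] u'(2)[symmetric])
qed

lemma analytic_fix:
  assumes "\<And>a. analytic \<Gamma> (\<lambda>\<rho>. t \<rho> a)"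
  shows "analytic \<Gamma> (\<lambda>\<rho>. SUP n. (fun_app (t \<rho>) ^^ n) (\<lambda>_. 0) b)"
proof -
  obtain t' where t': "\<And>a. power_series (t' a)" "\<And>a \<rho>. env_ok \<Gamma> \<rho> \<Longrightarrow> t \<rho> a = t' a \<rho>"
    using analytic_family[of \<Gamma> "\<lambda>a \<rho>. t \<rho> a", OF assms(1)] by metis
  show ?thesis
    by (rule analyticI[OF power_series_fix[of t' b, OF t'(1)]]) (simp add: t'(2)[symmetric])
qed

lemma analytic_nat_vec:
  assumes "\<And>n. analytic \<Gamma> (\<lambda>\<rho>. f \<rho> n)"
  shows "analytic \<Gamma> (\<lambda>\<rho>. nat_vec (f \<rho>) a)"
  by (cases a) (simp_all add: nat_vec_def assms analytic_const)

text \<open>Supplies the matrix of an abstraction. Values on cliques make its entries finite: an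
  entry times a positive promotion is bounded by a finite value of F.\<close>

lemma analytic_curry:
  assumes an: "\<And>b. analytic (\<Gamma>(x \<mapsto> \<sigma>)) (\<lambda>\<rho>. F \<rho> b)"
    and cl: "\<And>\<rho>. env_ok (\<Gamma>(x \<mapsto> \<sigma>)) \<rho> \<Longrightarrow> F \<rho> \<in> cliques \<tau>"
  obtains T where "\<And>a. power_series (\<lambda>\<rho>. T \<rho> a)"
    "\<And>\<rho>. env_ok \<Gamma> \<rho> \<Longrightarrow> T \<rho> \<in> cliques (\<sigma> \<rightarrow> \<tau>)"
    "\<And>\<rho> u. env_ok \<Gamma> \<rho> \<Longrightarrow> u \<in> cliques \<sigma> \<Longrightarrow> fun_app (T \<rho>) u = F (\<rho>(x := u))"
proof -
  obtain G where G: "\<And>b. power_series (G b)" "\<And>b \<rho>. env_ok (\<Gamma>(x \<mapsto> \<sigma>)) \<rho> \<Longrightarrow> F \<rho> b = G b \<rho>"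
    using analytic_family[of "\<Gamma>(x \<mapsto> \<sigma>)" "\<lambda>b \<rho>. F \<rho> b", OF an] by metis
  from choice[OF allI[OF power_series_curry[OF G(1), where x = x]]] obtain H where
    "\<forall>b. (\<forall>\<mu>. power_series (H b \<mu>)) \<and>
      (\<forall>\<rho> u. G b (\<rho>(x := u)) = (\<Sum>\<^sub>\<infinity>\<mu>. H b \<mu> \<rho> * promote u \<mu>))" ..
  then have H: "\<And>b \<mu>. power_series (H b \<mu>)"
    "\<And>b \<rho> u. G b (\<rho>(x := u)) = (\<Sum>\<^sub>\<infinity>\<mu>. H b \<mu> \<rho> * promote u \<mu>)" by simp_all
  have F: "F (\<rho>(x := u)) b = (\<Sum>\<^sub>\<infinity>\<mu>. H b \<mu> \<rho> * promote u \<mu>)"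
    if "env_ok \<Gamma> \<rho>" "u \<in> cliques \<sigma>" for \<rho> u b
    using that by (simp add: G(2) env_ok_upd H(2) del: fun_upd_apply)
  \<comment> \<open>The curried coefficients, cut off outside the web. The values on cliques do not
    change: there the promotion vanishes off the web of \<sigma>, and F vanishes off the web of
    \<tau>.\<close>
  define T where "T \<rho> a = (if a \<in> web_of (\<sigma> \<rightarrow> \<tau>) then
      (case a of PNat n \<Rightarrow> 0 | PFun \<mu> b \<Rightarrow> H b \<mu> \<rho>) else 0)" for \<rho> a
  have "power_series (\<lambda>\<rho>. T \<rho> a)" for a
    by (cases a; cases "a \<in> web_of (\<sigma> \<rightarrow> \<tau>)") (auto simp: T_def intro: power_series.const H(1))
  moreover have app: "fun_app (T \<rho>) u = F (\<rho>(x := u))"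
    if \<rho>: "env_ok \<Gamma> \<rho>" and u: "u \<in> cliques \<sigma>" for \<rho> u
  proof
    fix b
    have Fcl: "F (\<rho>(x := u)) \<in> cliques \<tau>" using \<rho> u by (intro cl env_ok_upd)
    show "fun_app (T \<rho>) u b = F (\<rho>(x := u)) b"
    proof (cases "b \<in> web_of \<tau>")
      case True
      have "T \<rho> (PFun \<mu> b) * promote u \<mu> = H b \<mu> \<rho> * promote u \<mu>" for \<mu>
      proof (cases "set_mset \<mu> \<subseteq> web_of \<sigma>")
        case False
        then have "promote u \<mu> = 0" using clique_outside[OF u] promote_zero[of _ \<mu> u] by blast
        then show ?thesis by simp
      qed (use True in \<open>auto simp: T_def web_fun\<close>)
      then show ?thesis using \<rho> u by (simp add: fun_app_eq F)
    next
      case False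
      then have "F (\<rho>(x := u)) b = 0" by (rule clique_outside[OF Fcl])
      moreover have "T \<rho> (PFun \<mu> b) = 0" for \<mu> using False by (simp add: T_def web_fun)
      ultimately show ?thesis by (simp add: fun_app_eq)
    qed
  qed
  moreover have "T \<rho> \<in> cliques (\<sigma> \<rightarrow> \<tau>)" if \<rho>: "env_ok \<Gamma> \<rho>" for \<rho>
    unfolding clique_fun_iff
  proof (intro conjI ballI)
    have "T \<rho> a < \<infinity>" for a
    proof (cases "a \<in> web_of (\<sigma> \<rightarrow> \<tau>)")
      case True
      then obtain \<mu> b where a: "a = PFun \<mu> b" "set_mset \<mu> \<subseteq> web_of \<sigma>" unfolding web_fun by blast
      obtain u where u: "u \<in> cliques \<sigma>" "\<forall>a\<in>#\<mu>. 0 < u a"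
        using clique_positive[OF finite_set_mset a(2)] by blast
      have "T \<rho> (PFun \<mu> b) * promote u \<mu> \<le> fun_app (T \<rho>) u b"
        unfolding fun_app_eq by (rule le_infsum_ennreal)
      also have "\<dots> < \<infinity>"
        unfolding app[OF \<rho> u(1)] by (rule clique_finite[OF cl[OF env_ok_upd[OF \<rho> u(1)]]])
      finally have "T \<rho> (PFun \<mu> b) * promote u \<mu> < \<infinity>" .
      moreover have "promote u \<mu> \<noteq> 0" using promote_pos[of \<mu> u] u(2) by fastforce
      ultimately show ?thesis by (auto simp: a ennreal_mult_less_top)
    qed (simp add: T_def)
    then show "T \<rho> \<in> vecs (web_of (\<sigma> \<rightarrow> \<tau>))" by (simp add: vecs_def T_def)
    show "fun_app (T \<rho>) u \<in> cliques \<tau>" if "u \<in> cliques \<sigma>" for u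
      unfolding app[OF \<rho> that] by (intro cl env_ok_upd \<rho> that)
  qed
  ultimately show ?thesis by (intro that[of T])
qed

section \<open>Denotations are cliques and depend analytically on the environment\<close>

lemma nat_vec_PNat [simp]: "nat_vec f (PNat n) = f n"
  and nat_vec_PFun [simp]: "nat_vec f (PFun \<mu> b) = 0"
  by (simp_all add: nat_vec_def)

lemma nat_vec_clique: "nat_vec f \<in> cliques TNat \<longleftrightarrow> (\<Sum>\<^sub>\<infinity>n. f n) \<le> 1"
  by (simp add: clique_TNat_iff)

lemma infsum_dirac: "(\<Sum>\<^sub>\<infinity>n. dirac m (PNat n) * f n) = f m"
  by (subst infsum_ennreal_single[of m]) (auto simp: dirac_def)

lemma dirac_clique: "dirac m \<in> cliques TNat"
  using infsum_dirac[of m "\<lambda>_. 1"] by (simp add: dirac_def nat_vec_clique)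

text \<open>Writes a conditional as a mixture over all values n of the test, the same shape as the
  denotation of \<open>let\<close>.\<close>

definition if_branch :: "'b \<Rightarrow> 'b \<Rightarrow> nat \<Rightarrow> 'b" where
  "if_branch x y n = (case n of 0 \<Rightarrow> x | Suc _ \<Rightarrow> y)"

lemma sem_If_eq:
  "sem \<Gamma> (If M N P) \<rho> =
     (\<lambda>a. \<Sum>\<^sub>\<infinity>n. sem \<Gamma> M \<rho> (PNat n) * if_branch (sem \<Gamma> N \<rho>) (sem \<Gamma> P \<rho>) n a)"
  by (rule ext, subst infsum_ennreal_Suc) (simp add: if_branch_def infsum_ennreal_cmult_right)

text \<open>The same convex-combination form, which lets \<open>coin\<close> share the treatment of \<open>let\<close> and \<open>if\<close>.\<close>

definition coin_dist :: "rat \<Rightarrow> nat \<Rightarrow> ennreal" where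
  "coin_dist r n = (if n = 0 then ennreal (of_rat r) else if n = 1 then ennreal (1 - of_rat r) else 0)"

lemma infsum_coin_dist:
  "(\<Sum>\<^sub>\<infinity>n. coin_dist r n * f n) = ennreal (of_rat r) * f 0 + ennreal (1 - of_rat r) * f 1"
  by (subst infsum_ennreal_Suc, subst infsum_ennreal_Suc) (simp add: coin_dist_def)

lemma sem_Coin_eq: "sem \<Gamma> (Coin r) \<rho> = (\<lambda>a. \<Sum>\<^sub>\<infinity>n. coin_dist r n * dirac n a)"
  by (simp add: infsum_coin_dist)

lemma coin_dist_sum:
  assumes "0 \<le> r" "r \<le> 1"
  shows "(\<Sum>\<^sub>\<infinity>n. coin_dist r n) = 1"
proof -
  have "(0::real) \<le> of_rat r" "of_rat r \<le> (1::real)" using assms by auto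
  then have "ennreal (of_rat r) + ennreal (1 - of_rat r) = 1"
    by (subst ennreal_plus[symmetric]) auto
  then show ?thesis using infsum_coin_dist[of r "\<lambda>_. 1"] by simp
qed

lemma iterates_clique:
  "t \<in> cliques (\<sigma> \<rightarrow> \<sigma>) \<Longrightarrow> (fun_app t ^^ n) (\<lambda>_. 0) \<in> cliques \<sigma>"
  by (induction n) (auto intro: clique_zero clique_fun_app)

lemma sem_Lam_eqI:
  assumes "\<Gamma>(x \<mapsto> \<sigma>) \<turnstile> M : \<tau>" "t \<in> cliques (\<sigma> \<rightarrow> \<tau>)"
    and "\<And>u. u \<in> cliques \<sigma> \<Longrightarrow> fun_app t u = sem (\<Gamma>(x \<mapsto> \<sigma>)) M (\<rho>(x := u))"
  shows "sem \<Gamma> (Lam x \<sigma> M) \<rho> = t"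
  unfolding sem.simps
proof (rule the_equality)
  show "\<exists>\<tau>. \<Gamma>(x \<mapsto> \<sigma>) \<turnstile> M : \<tau> \<and> t \<in> cliques (\<sigma> \<rightarrow> \<tau>) \<and>
      (\<forall>u\<in>cliques \<sigma>. fun_app t u = sem (\<Gamma>(x \<mapsto> \<sigma>)) M (\<rho>(x := u)))"
    using assms by blast
next
  fix t' assume "\<exists>\<tau>. \<Gamma>(x \<mapsto> \<sigma>) \<turnstile> M : \<tau> \<and> t' \<in> cliques (\<sigma> \<rightarrow> \<tau>) \<and>
      (\<forall>u\<in>cliques \<sigma>. fun_app t' u = sem (\<Gamma>(x \<mapsto> \<sigma>)) M (\<rho>(x := u)))"
  then have "t' \<in> cliques (\<sigma> \<rightarrow> \<tau>)"
    and "\<And>u. u \<in> cliques \<sigma> \<Longrightarrow> fun_app t' u = sem (\<Gamma>(x \<mapsto> \<sigma>)) M (\<rho>(x := u))"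
    using typing_unique[OF assms(1)] by blast+
  then show "t' = t" using assms by (intro clique_fun_eqI[of t' \<sigma> \<tau> t]) simp_all
qed

text \<open>The two halves are needed together: analyticity of the body gives an abstraction its
  coefficients, and clique values of the body make them a clique of the function type.\<close>

definition sem_ok :: "ctx \<Rightarrow> tm \<Rightarrow> ty \<Rightarrow> bool" where
  "sem_ok \<Gamma> M \<tau> \<longleftrightarrow> (\<forall>\<rho>. env_ok \<Gamma> \<rho> \<longrightarrow> sem \<Gamma> M \<rho> \<in> cliques \<tau>) \<and> (\<forall>a. analytic \<Gamma> (\<lambda>\<rho>. sem \<Gamma> M \<rho> a))"

lemma sem_ok_clique: "sem_ok \<Gamma> M \<tau> \<Longrightarrow> env_ok \<Gamma> \<rho> \<Longrightarrow> sem \<Gamma> M \<rho> \<in> cliques \<tau>"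
  and sem_ok_analytic: "sem_ok \<Gamma> M \<tau> \<Longrightarrow> analytic \<Gamma> (\<lambda>\<rho>. sem \<Gamma> M \<rho> a)"
  by (simp_all add: sem_ok_def)

lemma sem_ok_nat_sum:
  assumes "sem_ok \<Gamma> M TNat" "env_ok \<Gamma> \<rho>"
  shows "(\<Sum>\<^sub>\<infinity>n. sem \<Gamma> M \<rho> (PNat n)) \<le> 1"
  using sem_ok_clique[OF assms] by (simp add: clique_TNat_iff)

lemma sem_Lam_ok:
  assumes "\<Gamma>(x \<mapsto> \<sigma>) \<turnstile> M : \<tau>" "sem_ok (\<Gamma>(x \<mapsto> \<sigma>)) M \<tau>"
  shows "sem_ok \<Gamma> (Lam x \<sigma> M) (\<sigma> \<rightarrow> \<tau>)" (is ?ok)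
    and "env_ok \<Gamma> \<rho> \<Longrightarrow> u \<in> cliques \<sigma> \<Longrightarrow>
      fun_app (sem \<Gamma> (Lam x \<sigma> M) \<rho>) u = sem (\<Gamma>(x \<mapsto> \<sigma>)) M (\<rho>(x := u))"
proof -
  obtain T where T: "\<And>a. power_series (\<lambda>\<rho>. T \<rho> a)"
    "\<And>\<rho>. env_ok \<Gamma> \<rho> \<Longrightarrow> T \<rho> \<in> cliques (\<sigma> \<rightarrow> \<tau>)"
    "\<And>\<rho> u. env_ok \<Gamma> \<rho> \<Longrightarrow> u \<in> cliques \<sigma> \<Longrightarrow> fun_app (T \<rho>) u = sem (\<Gamma>(x \<mapsto> \<sigma>)) M (\<rho>(x := u))"
    using analytic_curry[of \<Gamma> x \<sigma> "sem (\<Gamma>(x \<mapsto> \<sigma>)) M" \<tau>] sem_ok_analytic[OF assms(2)]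
      sem_ok_clique[OF assms(2)] by metis
  have eq: "sem \<Gamma> (Lam x \<sigma> M) \<rho> = T \<rho>" if "env_ok \<Gamma> \<rho>" for \<rho>
    using that T by (intro sem_Lam_eqI[OF assms(1)]) (simp_all del: fun_upd_apply)
  show ?ok unfolding sem_ok_def
  proof (intro conjI allI impI)
    show "sem \<Gamma> (Lam x \<sigma> M) \<rho> \<in> cliques (\<sigma> \<rightarrow> \<tau>)" if "env_ok \<Gamma> \<rho>" for \<rho>
      unfolding eq[OF that] by (rule T(2)[OF that])
    show "analytic \<Gamma> (\<lambda>\<rho>. sem \<Gamma> (Lam x \<sigma> M) \<rho> a)" for a
      by (rule analyticI[OF T(1)[of a]]) (simp only: eq)
  qed
  show "fun_app (sem \<Gamma> (Lam x \<sigma> M) \<rho>) u = sem (\<Gamma>(x \<mapsto> \<sigma>)) M (\<rho>(x := u))"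
    if "env_ok \<Gamma> \<rho>" "u \<in> cliques \<sigma>"
    unfolding eq[OF that(1)] by (rule T(3)[OF that])
qed

text \<open>Induction on the size, because \<open>Let\<close> is interpreted through
  \<open>subst x (Num n) N\<close>, which is not a subterm but has the size of N.\<close>

lemma sem_ok: "\<Gamma> \<turnstile> M : \<tau> \<Longrightarrow> sem_ok \<Gamma> M \<tau>"
proof (induction M arbitrary: \<Gamma> \<tau> rule: measure_induct_rule[of size])
  case (less M)
  note IH = less.IH
  from less.prems show ?case
  proof cases
    case (T_Num n)
    then show ?thesis by (simp add: sem_ok_def dirac_clique analytic_const)
  next
    case (T_Succ M')
    then have ok: "sem_ok \<Gamma> M' TNat" by (intro IH) simp_all
    have "sem \<Gamma> M \<rho> \<in> cliques TNat" if "env_ok \<Gamma> \<rho>" for \<rho>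
      using sem_ok_nat_sum[OF ok that] by (simp add: T_Succ nat_vec_clique, subst infsum_ennreal_Suc) simp
    moreover have "analytic \<Gamma> (\<lambda>\<rho>. case n of 0 \<Rightarrow> 0 | Suc k \<Rightarrow> sem \<Gamma> M' \<rho> (PNat k))" for n
      by (cases n) (simp_all add: analytic_const sem_ok_analytic[OF ok])
    ultimately show ?thesis by (simp add: sem_ok_def T_Succ analytic_nat_vec)
  next
    case (T_Pred M')
    then have ok: "sem_ok \<Gamma> M' TNat" by (intro IH) simp_all
    have "sem \<Gamma> M \<rho> \<in> cliques TNat" if "env_ok \<Gamma> \<rho>" for \<rho>
    proof -
      have "(\<Sum>\<^sub>\<infinity>n. (if n = 0 then sem \<Gamma> M' \<rho> (PNat 0) else 0) + sem \<Gamma> M' \<rho> (PNat (Suc n)))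
          = (\<Sum>\<^sub>\<infinity>n. sem \<Gamma> M' \<rho> (PNat n))"
        by (subst infsum_ennreal_add, subst infsum_ennreal_single[of 0],
            simp, subst infsum_ennreal_Suc[of "\<lambda>n. sem \<Gamma> M' \<rho> (PNat n)"]) simp
      then show ?thesis using sem_ok_nat_sum[OF ok that] by (simp add: T_Pred nat_vec_clique)
    qed
    moreover have "analytic \<Gamma> (\<lambda>\<rho>. (if n = 0 then sem \<Gamma> M' \<rho> (PNat 0) else 0) + sem \<Gamma> M' \<rho> (PNat (Suc n)))" for n
      by (cases n) (simp_all add: analytic_add sem_ok_analytic[OF ok])
    ultimately show ?thesis by (simp add: sem_ok_def T_Pred analytic_nat_vec)
  next
    case (T_Var x)
    have "analytic \<Gamma> (\<lambda>\<rho>. \<rho> x a)" for a by (rule analyticI[OF power_series.coord]) simp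
    then show ?thesis using T_Var by (auto simp: sem_ok_def env_ok_def)
  next
    case (T_Coin r)
    have "sem \<Gamma> M \<rho> \<in> cliques TNat" for \<rho>
      unfolding T_Coin(1) sem_Coin_eq
      using coin_dist_sum T_Coin by (intro clique_infsum dirac_clique) simp_all
    then show ?thesis by (simp add: sem_ok_def T_Coin analytic_const)
  next
    case (T_Let M' x N)
    then have ok: "sem_ok \<Gamma> M' TNat" by (intro IH) simp_all
    have okN: "sem_ok \<Gamma> (subst x (Num n) N) \<tau>" for n
      using T_Let by (intro IH typing_subst_Num) (simp_all add: size_subst_Num)
    have "sem \<Gamma> M \<rho> \<in> cliques \<tau>" if "env_ok \<Gamma> \<rho>" for \<rho>
      unfolding T_Let(1) sem.simps
      by (intro clique_infsum sem_ok_clique[OF okN that] sem_ok_nat_sum[OF ok that])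
    moreover have "analytic \<Gamma> (\<lambda>\<rho>. sem \<Gamma> M \<rho> a)" for a
      unfolding T_Let(1) sem.simps
      by (intro analytic_nat_sum analytic_mult sem_ok_analytic[OF okN] sem_ok_analytic[OF ok])
    ultimately show ?thesis by (simp add: sem_ok_def)
  next
    case (T_If M' N P)
    then have ok: "sem_ok \<Gamma> M' TNat" "sem_ok \<Gamma> N \<tau>" "sem_ok \<Gamma> P \<tau>" by (auto intro!: IH)
    have "sem \<Gamma> M \<rho> \<in> cliques \<tau>" if "env_ok \<Gamma> \<rho>" for \<rho>
      unfolding T_If(1) sem_If_eq
      by (intro clique_infsum sem_ok_nat_sum[OF ok(1) that])
        (auto simp: if_branch_def ok sem_ok_clique that split: nat.split)
    moreover have "analytic \<Gamma> (\<lambda>\<rho>. sem \<Gamma> M \<rho> a)" for a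
      unfolding T_If(1) sem.simps
      by (intro analytic_nat_sum analytic_mult analytic_add ok[THEN sem_ok_analytic])
    ultimately show ?thesis by (simp add: sem_ok_def)
  next
    case (T_App M' \<sigma> N)
    then have ok: "sem_ok \<Gamma> M' (\<sigma> \<rightarrow> \<tau>)" "sem_ok \<Gamma> N \<sigma>" by (auto intro!: IH)
    have "sem \<Gamma> M \<rho> \<in> cliques \<tau>" if "env_ok \<Gamma> \<rho>" for \<rho>
      unfolding T_App(1) sem.simps
      by (rule clique_fun_app[OF sem_ok_clique[OF ok(1) that] sem_ok_clique[OF ok(2) that]])
    moreover have "analytic \<Gamma> (\<lambda>\<rho>. sem \<Gamma> M \<rho> a)" for a
      unfolding T_App(1) sem.simps
      by (rule analytic_fun_app[OF sem_ok_analytic[OF ok(1)] sem_ok_analytic[OF ok(2)]])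
    ultimately show ?thesis by (simp add: sem_ok_def)
  next
    case (T_Lam x \<sigma> M' \<tau>')
    then have "sem_ok (\<Gamma>(x \<mapsto> \<sigma>)) M' \<tau>'" by (intro IH) (simp_all del: fun_upd_apply)
    then show ?thesis using sem_Lam_ok(1)[OF T_Lam(3)] T_Lam(1,2) by (simp del: fun_upd_apply)
  next
    case (T_Fix M')
    then have ok: "sem_ok \<Gamma> M' (\<tau> \<rightarrow> \<tau>)" by (intro IH) simp_all
    have "sem \<Gamma> M \<rho> \<in> cliques \<tau>" if "env_ok \<Gamma> \<rho>" for \<rho>
      unfolding T_Fix(1) sem.simps
      by (intro clique_SUP iterates_clique incseq_fun_app_iterates sem_ok_clique[OF ok that])
    moreover have "analytic \<Gamma> (\<lambda>\<rho>. sem \<Gamma> M \<rho> a)" for a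
      unfolding T_Fix(1) sem.simps
      by (rule analytic_fix[OF sem_ok_analytic[OF ok]])
    ultimately show ?thesis by (simp add: sem_ok_def)
  qed
qed

lemmas sem_clique = sem_ok_clique[OF sem_ok]

lemma fun_app_sem_Lam:
  assumes "\<Gamma>(x \<mapsto> \<sigma>) \<turnstile> M : \<tau>" "env_ok \<Gamma> \<rho>" "u \<in> cliques \<sigma>"
  shows "fun_app (sem \<Gamma> (Lam x \<sigma> M) \<rho>) u = sem (\<Gamma>(x \<mapsto> \<sigma>)) M (\<rho>(x := u))"
  by (rule sem_Lam_ok(2)[OF assms(1) sem_ok[OF assms(1)] assms(2,3)])

section \<open>Step-indexed evaluation\<close>

text \<open>The deterministic part of the machine; coins, final and stuck states give
  \<open>None\<close>. Truncated subtraction merges the two rules for the predecessor frame.\<close>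

fun step :: "state \<Rightarrow> state option" where
  "step (Let x M N, \<pi>) = Some (M, FLet x N # \<pi>)"
| "step (App M N, \<pi>) = Some (M, FArg N # \<pi>)"
| "step (If M N P, \<pi>) = Some (M, FIf N P # \<pi>)"
| "step (Fix M, \<pi>) = Some (M, FArg (Fix M) # \<pi>)"
| "step (Succ M, \<pi>) = Some (M, FSucc # \<pi>)"
| "step (Pred M, \<pi>) = Some (M, FPred # \<pi>)"
| "step (Num n, FLet x N # \<pi>) = Some (subst x (Num n) N, \<pi>)"
| "step (Lam x \<sigma> M, FArg N # \<pi>) = Some (subst x N M, \<pi>)"
| "step (Num 0, FIf N P # \<pi>) = Some (N, \<pi>)"
| "step (Num (Suc n), FIf N P # \<pi>) = Some (P, \<pi>)"
| "step (Num n, FSucc # \<pi>) = Some (Num (Suc n), \<pi>)"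
| "step (Num n, FPred # \<pi>) = Some (Num (n - 1), \<pi>)"
| "step _ = None"

text \<open>A total version of \<open>Eval\<close> with a budget k. Exhausted budget and
  undefinedness both give 0, which makes the weight nondecreasing in k. Stopping at
  \<open>Num 0\<close> also costs one unit.\<close>

primrec path_weight :: "nat \<Rightarrow> state \<Rightarrow> bool list \<Rightarrow> ennreal" where
  "path_weight 0 s \<alpha> = 0"
| "path_weight (Suc k) s \<alpha> = (case step s of
      Some s' \<Rightarrow> path_weight k s' \<alpha>
    | None \<Rightarrow> (case s of
        (Coin r, \<pi>) \<Rightarrow> (case \<alpha> of
            [] \<Rightarrow> 0
          | i # \<beta> \<Rightarrow> path_weight k (Num (of_bool i), \<pi>) \<beta> * ennreal (coin_weight i r))
      | _ \<Rightarrow> if s = (Num 0, []) \<and> \<alpha> = [] then 1 else 0))"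

lemma path_weight_step: "step s = Some s' \<Longrightarrow> path_weight (Suc k) s \<alpha> = path_weight k s' \<alpha>"
  by simp

lemma path_weight_Coin:
  "path_weight (Suc k) (Coin r, \<pi>) [] = 0"
  "path_weight (Suc k) (Coin r, \<pi>) (i # \<beta>)
    = path_weight k (Num (of_bool i), \<pi>) \<beta> * ennreal (coin_weight i r)"
  by simp_all

lemma path_weight_stuck:
  assumes "step s = None" "\<nexists>r \<pi>. s = (Coin r, \<pi>)"
  shows "path_weight (Suc k) s \<alpha> = (if s = (Num 0, []) \<and> \<alpha> = [] then 1 else 0)"
  using assms by (cases s; cases "fst s") auto

declare path_weight.simps(2) [simp del]

definition ev :: "nat \<Rightarrow> state \<Rightarrow> ennreal" where
  "ev k s = (\<Sum>\<^sub>\<infinity>\<alpha>. path_weight k s \<alpha>)"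

definition ev_lim :: "state \<Rightarrow> ennreal" where
  "ev_lim s = (SUP k. ev k s)"

lemma infsum_bool_list:
  fixes f :: "bool list \<Rightarrow> ennreal"
  shows "infsum f UNIV = f [] + (\<Sum>\<^sub>\<infinity>\<beta>. f (False # \<beta>)) + (\<Sum>\<^sub>\<infinity>\<beta>. f (True # \<beta>))"
proof -
  have Cons: "infsum f (range ((#) i)) = (\<Sum>\<^sub>\<infinity>\<beta>. f (i # \<beta>))" for i
    by (subst infsum_reindex) (auto simp: o_def)
  have "\<alpha> \<in> {[]} \<union> range ((#) False) \<union> range ((#) True)" for \<alpha> :: "bool list"
    by (cases \<alpha>; cases "hd \<alpha>") auto
  then have UNIV: "(UNIV :: bool list set) = {[]} \<union> range ((#) False) \<union> range ((#) True)" by blast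
  have "infsum f UNIV = infsum f ({[]} \<union> range ((#) False) \<union> range ((#) True))"
    by (rule arg_cong[OF UNIV])
  also have "\<dots> = infsum f ({[]} \<union> range ((#) False)) + infsum f (range ((#) True))"
    by (rule infsum_Un_disjoint) (auto intro: ennreal_summable_on)
  also have "infsum f ({[]} \<union> range ((#) False)) = infsum f {[]} + infsum f (range ((#) False))"
    by (rule infsum_Un_disjoint) (auto intro: ennreal_summable_on)
  finally show ?thesis by (simp add: Cons)
qed

lemma ev_0 [simp]: "ev 0 s = 0"
  by (simp add: ev_def)

lemma ev_step: "step s = Some s' \<Longrightarrow> ev (Suc k) s = ev k s'"
  by (simp add: ev_def path_weight_step)

lemma ev_Coin:
  "ev (Suc k) (Coin r, \<pi>) = (\<Sum>\<^sub>\<infinity>n. coin_dist r n * ev k (Num n, \<pi>))"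
  unfolding infsum_coin_dist ev_def
  by (subst infsum_bool_list) (simp add: path_weight_Coin infsum_ennreal_cmult coin_weight_def mult.commute)

lemma ev_Num_Nil: "ev (Suc k) (Num n, []) = (if n = 0 then 1 else 0)"
  unfolding ev_def by (subst infsum_ennreal_single[of "[]"]) (auto simp: path_weight_stuck)

lemma path_weight_Suc_mono: "path_weight k s \<alpha> \<le> path_weight (Suc k) s \<alpha>"
proof (induction k arbitrary: s \<alpha>)
  case (Suc k)
  show ?case
  proof (cases "step s")
    case (Some s')
    then show ?thesis using Suc by (simp add: path_weight_step)
  next
    case None
    show ?thesis
    proof (cases "\<exists>r \<pi>. s = (Coin r, \<pi>)")
      case True
      then show ?thesis
        by (cases \<alpha>) (auto simp: path_weight_Coin intro!: mult_right_mono Suc)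
    qed (simp add: path_weight_stuck[OF None])
  qed
qed simp

lemma incseq_ev: "incseq (\<lambda>k. ev k s)"
  by (rule incseq_SucI) (auto simp only: ev_def intro!: infsum_ennreal_mono path_weight_Suc_mono)

lemma ev_le_lim: "ev k s \<le> ev_lim s"
  unfolding ev_lim_def by (rule SUP_upper) simp

lemma incseq_SUP_Suc: "incseq f \<Longrightarrow> (SUP n. f (Suc n)) = (SUP n. f n)" for f :: "nat \<Rightarrow> ennreal"
  by (rule antisym) (auto intro!: SUP_mono intro: incseq_SucD)

lemma ev_lim_Suc: "ev_lim s = (SUP k. ev (Suc k) s)"
  unfolding ev_lim_def by (rule incseq_SUP_Suc[OF incseq_ev, symmetric])

lemma ev_lim_step: "step s = Some s' \<Longrightarrow> ev_lim s = ev_lim s'"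
  unfolding ev_lim_Suc[of s] by (simp add: ev_step ev_lim_def)

lemma ev_lim_Coin: "ev_lim (Coin r, \<pi>) = (\<Sum>\<^sub>\<infinity>n. coin_dist r n * ev_lim (Num n, \<pi>))"
proof -
  have "incseq (\<lambda>k. coin_dist r n * ev k (Num n, \<pi>))" for n
    using incseq_ev[of "(Num n, \<pi>)"] by (auto simp: incseq_def intro: mult_left_mono)
  then show ?thesis
    unfolding ev_lim_Suc[of "(Coin r, \<pi>)"] ev_Coin
    by (simp add: ev_lim_def SUP_mult_left_ennreal infsum_ennreal_SUP_swap)
qed

lemma ev_lim_Num_Nil: "ev_lim (Num n, []) = (if n = 0 then 1 else 0)"
  by (simp add: ev_lim_Suc ev_Num_Nil)

text \<open>Coins with a parameter outside \<open>[0, 1]\<close> would give paths of negative weight; typing excludes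
  them, and the exclusion is stable under reduction.\<close>

primrec coins_ok :: "tm \<Rightarrow> bool" where
  "coins_ok (Num n) = True"
| "coins_ok (Succ M) = coins_ok M"
| "coins_ok (Pred M) = coins_ok M"
| "coins_ok (Var x) = True"
| "coins_ok (Coin r) = (0 \<le> r \<and> r \<le> 1)"
| "coins_ok (Let x M N) = (coins_ok M \<and> coins_ok N)"
| "coins_ok (If M N P) = (coins_ok M \<and> coins_ok N \<and> coins_ok P)"
| "coins_ok (App M N) = (coins_ok M \<and> coins_ok N)"
| "coins_ok (Lam x \<sigma> M) = coins_ok M"
| "coins_ok (Fix M) = coins_ok M"

primrec frame_ok :: "frame \<Rightarrow> bool" where
  "frame_ok (FArg M) = coins_ok M"
| "frame_ok FSucc = True"
| "frame_ok FPred = True"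
| "frame_ok (FIf N P) = (coins_ok N \<and> coins_ok P)"
| "frame_ok (FLet x N) = coins_ok N"

definition state_ok :: "state \<Rightarrow> bool" where
  "state_ok s \<longleftrightarrow> coins_ok (fst s) \<and> list_all frame_ok (snd s)"

lemma coins_ok_typing: "\<Gamma> \<turnstile> M : \<tau> \<Longrightarrow> coins_ok M"
  by (induction rule: typing.induct) auto

lemma coins_ok_subst: "coins_ok N \<Longrightarrow> coins_ok M \<Longrightarrow> coins_ok (subst x N M)"
  by (induction M) auto

lemma state_ok_step: "step s = Some s' \<Longrightarrow> state_ok s \<Longrightarrow> state_ok s'"
  by (induction s rule: step.induct) (auto simp: state_ok_def coins_ok_subst)

lemma state_ok_Coin: "state_ok (Coin r, \<pi>) \<Longrightarrow> state_ok (Num n, \<pi>)"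
  by (simp add: state_ok_def)

lemma coin_weight_nonneg: "state_ok (Coin r, \<pi>) \<Longrightarrow> 0 \<le> coin_weight i r"
  by (auto simp: state_ok_def coin_weight_def)

section \<open>Agreement of budgeted path weights with \<open>Eval\<close>\<close>

lemma Eval_step: "step s = Some s' \<Longrightarrow> Eval s' \<alpha> q \<Longrightarrow> Eval s \<alpha> q"
proof (induction s rule: step.induct)
  case (12 n \<pi>)
  then show ?case by (cases n) (auto intro: Eval.intros)
qed (auto intro: Eval.intros)

text \<open>Restricted to nonzero weights, since 0 may also mean an exhausted budget or a path on
  which \<open>Eval\<close> is undefined.\<close>

lemma path_weight_Eval:
  "path_weight k s \<alpha> \<noteq> 0 \<Longrightarrow> state_ok s \<Longrightarrow> \<exists>q\<ge>0. Eval s \<alpha> q \<and> path_weight k s \<alpha> = ennreal q"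
proof (induction k arbitrary: s \<alpha>)
  case (Suc k)
  show ?case
  proof (cases "step s")
    case (Some s')
    then show ?thesis
      using Suc.IH[of s' \<alpha>] Suc.prems state_ok_step[OF Some] Eval_step[OF Some]
      by (auto simp: path_weight_step[OF Some])
  next
    case None
    show ?thesis
    proof (cases "\<exists>r \<pi>. s = (Coin r, \<pi>)")
      case True
      then obtain r \<pi> where s: "s = (Coin r, \<pi>)" by blast
      obtain i \<beta> where \<alpha>: "\<alpha> = i # \<beta>" using Suc.prems(1) by (cases \<alpha>) (auto simp: s path_weight_Coin)
      have "path_weight k (Num (of_bool i), \<pi>) \<beta> \<noteq> 0" using Suc.prems(1) by (auto simp: s \<alpha> path_weight_Coin)
      then obtain q where q: "q \<ge> 0" "Eval (Num (of_bool i), \<pi>) \<beta> q"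
        "path_weight k (Num (of_bool i), \<pi>) \<beta> = ennreal q"
        using Suc.IH[OF _ state_ok_Coin] Suc.prems(2) unfolding s by blast
      have "Eval s \<alpha> (q * coin_weight i r)" unfolding s \<alpha> by (rule E_Coin[OF q(2)])
      then show ?thesis
        using q coin_weight_nonneg[of r \<pi> i] Suc.prems(2)
        by (intro exI[of _ "q * coin_weight i r"]) (auto simp: s \<alpha> path_weight_Coin ennreal_mult)
    next
      case False
      then have "s = (Num 0, [])" "\<alpha> = []"
        using Suc.prems(1) by (auto simp: path_weight_stuck[OF None] split: if_splits)
      then show ?thesis by (intro exI[of _ 1]) (auto simp: path_weight_stuck intro: Eval.intros)
    qed
  qed
qed simp

text \<open>Settles all rules of \<open>Eval\<close> other than coin and termination at once: a step
  shifts the threshold by one.\<close>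

lemma path_weight_eventually_step:
  assumes "step s = Some s'" "state_ok s"
    and "state_ok s' \<Longrightarrow> 0 \<le> q \<and> (\<exists>k0. \<forall>k\<ge>k0. path_weight k s' \<alpha> = ennreal q)"
  shows "0 \<le> q \<and> (\<exists>k0. \<forall>k\<ge>k0. path_weight k s \<alpha> = ennreal q)"
proof -
  obtain k0 where k0: "0 \<le> q" "\<forall>k\<ge>k0. path_weight k s' \<alpha> = ennreal q"
    using assms(3) state_ok_step[OF assms(1,2)] by blast
  have "path_weight k s \<alpha> = ennreal q" if "k \<ge> Suc k0" for k
    using that k0 by (cases k) (auto simp: path_weight_step[OF assms(1)])
  then show ?thesis using k0 by blast
qed

text \<open>The weight is shown to be eventually constant in k, not merely attained, so that
  finitely many paths can share one budget.\<close>

lemma Eval_path_weight: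
  "Eval s \<alpha> q \<Longrightarrow> state_ok s \<Longrightarrow> 0 \<le> q \<and> (\<exists>k0. \<forall>k\<ge>k0. path_weight k s \<alpha> = ennreal q)"
proof (induction rule: Eval.induct)
  case (E_Coin i \<pi> \<alpha> q r)
  then obtain k0 where q: "0 \<le> q" "\<forall>k\<ge>k0. path_weight k (Num (of_bool i), \<pi>) \<alpha> = ennreal q"
    using state_ok_Coin by blast
  have w: "0 \<le> coin_weight i r" using E_Coin.prems by (rule coin_weight_nonneg)
  have "path_weight k (Coin r, \<pi>) (i # \<alpha>) = ennreal (q * coin_weight i r)" if "k \<ge> Suc k0" for k
    using that q w by (cases k) (auto simp: path_weight_Coin ennreal_mult)
  then show ?case using q w by auto
next
  case E_Zero
  have "path_weight k (Num 0, []) [] = ennreal 1" if "k \<ge> Suc 0" for k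
    using that by (cases k) (auto simp: path_weight_stuck)
  then show ?case by auto
qed (rule path_weight_eventually_step, simp, assumption, simp)+

text \<open>\<open>prob0\<close> is a sum of reals and would be 0 without summability. Finiteness of
  \<open>ev_lim\<close> bounds the finite partial sums, and nonnegativity turns this bound into
  summability.\<close>

lemma prob0_eq_ev_lim:
  assumes "coins_ok M" "ev_lim (M, []) < \<infinity>"
  shows "prob0 M = enn2real (ev_lim (M, []))"
proof -
  define A where "A = {(\<alpha>, q). Eval (M, []) \<alpha> q}"
  define f :: "bool list \<times> real \<Rightarrow> real" where "f = snd"
  have ok: "state_ok (M, [])" using assms(1) by (simp add: state_ok_def)
  have nonneg: "0 \<le> f x" if "x \<in> A" for x
    using that Eval_path_weight[OF _ ok] by (auto simp: A_def f_def)
  have finite_le: "ennreal (sum f F) \<le> ev_lim (M, [])" if F: "finite F" "F \<subseteq> A" for F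
  proof -
    have inj: "inj_on fst F"
      using F(2) Eval_functional by (fastforce simp: inj_on_def A_def)
    have "\<forall>x\<in>F. \<exists>k0. \<forall>k\<ge>k0. path_weight k (M, []) (fst x) = ennreal (f x)"
      using F(2) Eval_path_weight[OF _ ok] by (auto simp: A_def f_def)
    then obtain k0 where k0: "\<forall>x\<in>F. \<forall>k\<ge>k0 x. path_weight k (M, []) (fst x) = ennreal (f x)"
      by metis
    \<comment> \<open>A budget large enough for all paths in F; inserting 0 makes the maximum
      meaningful for empty F.\<close>
    define K where "K = Max (insert 0 (k0 ` F))"
    have K: "path_weight K (M, []) (fst x) = ennreal (f x)" if "x \<in> F" for x
      using k0 that F(1) by (auto simp: K_def)
    have "ennreal (sum f F) = (\<Sum>x\<in>F. path_weight K (M, []) (fst x))"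
      using nonneg F(2) by (subst sum_ennreal[symmetric]) (auto simp: K)
    also have "\<dots> = (\<Sum>\<alpha>\<in>fst ` F. path_weight K (M, []) \<alpha>)"
      by (simp add: sum.reindex[OF inj])
    also have "\<dots> \<le> ev K (M, [])"
      unfolding ev_def by (rule sum_le_infsum_ennreal) (use F in auto)
    also have "\<dots> \<le> ev_lim (M, [])" by (rule ev_le_lim)
    finally show ?thesis .
  qed
  have "sum f F \<le> enn2real (ev_lim (M, []))" if "finite F" "F \<subseteq> A" for F
  proof -
    have "0 \<le> sum f F" using that nonneg by (intro sum_nonneg) auto
    then show ?thesis
      using enn2real_mono[OF finite_le[OF that]] assms(2) by simp
  qed
  then have "f summable_on A"
    by (intro nonneg_bdd_above_summable_on nonneg) (auto intro!: bdd_aboveI)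
  then have "ennreal (infsum f A) = (SUP F\<in>{F. finite F \<and> F \<subseteq> A}. ennreal (sum f F))"
    by (rule infsum_nonneg_is_SUPREMUM_ennreal) (rule nonneg)
  also have "\<dots> = ev_lim (M, [])"
  proof (rule antisym)
    show "(SUP F\<in>{F. finite F \<and> F \<subseteq> A}. ennreal (sum f F)) \<le> ev_lim (M, [])"
      using finite_le by (auto intro!: SUP_least)
    have "ev k (M, []) \<le> (SUP F\<in>{F. finite F \<and> F \<subseteq> A}. ennreal (sum f F))" for k
      unfolding ev_def
    proof (rule infsum_ennreal_least)
      fix G :: "bool list set" assume G: "finite G"
      define w where "w = path_weight k (M, [])"
      \<comment> \<open>Paths of weight 0 are discarded because they need not occur in the graph of
        \<open>Eval\<close>.\<close>
      define G' where "G' = {\<alpha> \<in> G. w \<alpha> \<noteq> 0}"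
      define g where "g \<alpha> = (\<alpha>, enn2real (w \<alpha>))" for \<alpha>
      have g: "g \<alpha> \<in> A \<and> ennreal (f (g \<alpha>)) = w \<alpha>" if "\<alpha> \<in> G'" for \<alpha>
        using that path_weight_Eval[OF _ ok, of k \<alpha>] by (auto simp: G'_def g_def w_def A_def f_def)
      have "sum w G = sum w G'"
        unfolding G'_def using G by (intro sum.mono_neutral_right) auto
      also have "\<dots> = (\<Sum>\<alpha>\<in>G'. ennreal (f (g \<alpha>)))" using g by simp
      also have "\<dots> = ennreal (\<Sum>\<alpha>\<in>G'. f (g \<alpha>))"
        using g nonneg by (intro sum_ennreal) auto
      also have "(\<Sum>\<alpha>\<in>G'. f (g \<alpha>)) = sum f (g ` G')"
        by (subst sum.reindex) (auto simp: inj_on_def g_def)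
      also have "ennreal (sum f (g ` G')) \<le> (SUP F\<in>{F. finite F \<and> F \<subseteq> A}. ennreal (sum f F))"
        using g G by (intro SUP_upper) (auto simp: G'_def)
      finally show "sum (path_weight k (M, [])) G
          \<le> (SUP F\<in>{F. finite F \<and> F \<subseteq> A}. ennreal (sum f F))" unfolding w_def .
    qed
    then show "ev_lim (M, []) \<le> (SUP F\<in>{F. finite F \<and> F \<subseteq> A}. ennreal (sum f F))"
      unfolding ev_lim_def by (intro SUP_least)
  qed
  finally have "ennreal (infsum f A) = ev_lim (M, [])" .
  moreover have "0 \<le> infsum f A" by (intro infsum_nonneg nonneg)
  ultimately have "infsum f A = enn2real (ev_lim (M, []))" by (metis enn2real_ennreal)
  then show ?thesis by (simp add: prob0_def A_def f_def case_prod_unfold)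
qed

section \<open>Adequacy\<close>

text \<open>Simultaneous substitution, used to close a term in the logical relation. Like
  \<open>subst\<close> it does not rename bound variables; there all inserted terms are
  inert.\<close>

primrec csubst :: "tm \<Rightarrow> (vname \<rightharpoonup> tm) \<Rightarrow> tm" where
  "csubst (Num n) s = Num n"
| "csubst (Succ M) s = Succ (csubst M s)"
| "csubst (Pred M) s = Pred (csubst M s)"
| "csubst (Var y) s = (case s y of None \<Rightarrow> Var y | Some N \<Rightarrow> N)"
| "csubst (Coin r) s = Coin r"
| "csubst (Let y M P) s = Let y (csubst M s) (csubst P (s(y := None)))"
| "csubst (If M P Q) s = If (csubst M s) (csubst P s) (csubst Q s)"
| "csubst (App M P) s = App (csubst M s) (csubst P s)"
| "csubst (Lam y \<sigma> M) s = Lam y \<sigma> (csubst M (s(y := None)))"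
| "csubst (Fix M) s = Fix (csubst M s)"

text \<open>Closedness in the only form that the reduction of states needs.\<close>

definition inert :: "tm \<Rightarrow> bool" where
  "inert C \<longleftrightarrow> (\<forall>x N. subst x N C = C)"

definition inert_subst :: "(vname \<rightharpoonup> tm) \<Rightarrow> bool" where
  "inert_subst s \<longleftrightarrow> (\<forall>y C. s y = Some C \<longrightarrow> inert C)"

lemma inert_subst_None: "inert_subst s \<Longrightarrow> inert_subst (s(y := None))"
  by (simp add: inert_subst_def)

lemma inert_subst_upd: "inert_subst s \<Longrightarrow> inert N \<Longrightarrow> inert_subst (s(y \<mapsto> N))"
  by (simp add: inert_subst_def)

lemma csubst_empty [simp]: "csubst M Map.empty = M"
  by (induction M) auto

lemma csubst_subst_Num: "csubst (subst x (Num n) M) s = csubst M (s(x \<mapsto> Num n))"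
  by (induction M arbitrary: s) (auto simp: fun_upd_twist)

text \<open>Connects the single substitution performed by the machine with the closing substitution:
  terms inserted earlier are inert, so the later substitution does not touch them.\<close>

lemma subst_csubst:
  "inert_subst s \<Longrightarrow> subst x N (csubst M (s(x := None))) = csubst M (s(x \<mapsto> N))"
proof (induction M arbitrary: s)
  case (Var y)
  then show ?case by (auto simp: inert_subst_def inert_def split: option.split)
next
  case (Let y M P)
  then show ?case
    using Let.IH(2)[OF inert_subst_None[OF Let.prems], of y]
    by (cases "x = y") (simp_all add: fun_upd_twist[of x y] del: fun_upd_apply)
next
  case (Lam y \<sigma> M)
  then show ?case
    using Lam.IH[OF inert_subst_None[OF Lam.prems], of y]
    by (cases "x = y") (simp_all add: fun_upd_twist[of x y] del: fun_upd_apply)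
qed auto

lemma subst_csubst_id:
  "\<Gamma> \<turnstile> M : \<tau> \<Longrightarrow> inert_subst s \<Longrightarrow> \<forall>y\<in>dom \<Gamma>. y \<noteq> x \<or> s y \<noteq> None \<Longrightarrow>
    subst x N (csubst M s) = csubst M s"
proof (induction arbitrary: s rule: typing.induct)
  case (T_Var \<Gamma> y \<sigma>)
  then show ?case by (auto simp: inert_subst_def inert_def split: option.split)
next
  case (T_Let \<Gamma> M y P \<sigma>)
  have "subst x N (csubst P (s(y := None))) = csubst P (s(y := None))" if "x \<noteq> y"
    using T_Let.prems that by (intro T_Let.IH(2) inert_subst_None) auto
  then show ?case using T_Let.IH(1) T_Let.prems by (simp del: fun_upd_apply)
next
  case (T_Lam \<Gamma> y \<sigma> M \<tau>)
  have "subst x N (csubst M (s(y := None))) = csubst M (s(y := None))" if "x \<noteq> y"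
    using T_Lam.prems that by (intro T_Lam.IH inert_subst_None) auto
  then show ?case by (simp del: fun_upd_apply)
qed auto

lemma inert_csubst: "\<Gamma> \<turnstile> M : \<tau> \<Longrightarrow> inert_subst s \<Longrightarrow> dom \<Gamma> \<subseteq> dom s \<Longrightarrow> inert (csubst M s)"
  unfolding inert_def using subst_csubst_id by blast

lemma inert_closed: "M \<in> closed_terms \<sigma> \<Longrightarrow> inert M"
  using inert_csubst[of Map.empty M \<sigma> Map.empty] by (simp add: closed_terms_def inert_subst_def)

text \<open>\<open>val (Some j)\<close> evaluates with \<open>j\<close> steps, \<open>val None\<close> without a bound. The flag of
  \<open>dominated\<close> selects the direction: with \<open>True\<close> the step-indexed values are dominated from above
  (soundness), with \<open>False\<close> the limits are dominated from below (adequacy). Both directions share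
  one logical relation; they differ only in the treatment of \<open>fix\<close>.\<close>

definition val :: "nat option \<Rightarrow> state \<Rightarrow> ennreal" where
  "val j s = (case j of Some k \<Rightarrow> ev k s | None \<Rightarrow> ev_lim s)"

definition dominated :: "bool \<Rightarrow> nat \<Rightarrow> (nat option \<Rightarrow> ennreal) \<Rightarrow> (nat option \<Rightarrow> ennreal) \<Rightarrow> bool" where
  "dominated b k X Y \<longleftrightarrow> (if b then \<forall>j\<le>k. X (Some j) \<le> Y (Some j) else Y None \<le> X None)"

lemma dominated_refl: "dominated b k X X"
  by (simp add: dominated_def)

lemma dominated_trans [trans]: "dominated b k X Y \<Longrightarrow> dominated b k Y Z \<Longrightarrow> dominated b k X Z"
  unfolding dominated_def by (auto split: if_splits intro: order_trans)

lemma dominated_antimono: "dominated b k X Y \<Longrightarrow> j \<le> k \<Longrightarrow> dominated b j X Y"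
  by (auto simp: dominated_def)

lemma dominated_sum:
  assumes "\<And>n::nat. dominated b k (X n) (Y n)"
  shows "dominated b k (\<lambda>j. \<Sum>\<^sub>\<infinity>n. c n * X n j) (\<lambda>j. \<Sum>\<^sub>\<infinity>n. c n * Y n j)"
  using assms unfolding dominated_def
  by (auto split: if_splits intro!: infsum_ennreal_mono mult_left_mono)

text \<open>With a budget the step costs one unit, and monotonicity in the budget pays for it;
  without a bound the two values are equal.\<close>

lemma dominated_step:
  assumes "step s = Some s'"
  shows "dominated b k (\<lambda>j. val j s) (\<lambda>j. val j s')"
proof -
  have "ev j s \<le> ev j s'" for j
    using assms incseq_SucD[OF incseq_ev[of s']] by (cases j) (auto simp: ev_step)
  then show ?thesis using ev_lim_step[OF assms] by (auto simp: dominated_def val_def)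
qed

lemma dominated_Coin:
  "dominated b k (\<lambda>j. val j (Coin r, \<pi>)) (\<lambda>j. \<Sum>\<^sub>\<infinity>n. coin_dist r n * val j (Num n, \<pi>))"
proof -
  have "ev j (Coin r, \<pi>) \<le> (\<Sum>\<^sub>\<infinity>n. coin_dist r n * ev j (Num n, \<pi>))" for j
    by (cases j) (auto simp: ev_Coin intro!: infsum_ennreal_mono mult_left_mono incseq_SucD[OF incseq_ev])
  then show ?thesis by (auto simp: dominated_def val_def ev_lim_Coin)
qed

text \<open>At type nat, M with pending arguments \<open>as\<close> is compared on every stack \<pi>
  with the mixture of numerals given by u. At function types the term stays fixed and arguments are
  appended to \<open>as\<close>. Quantifying over \<open>j \<le> k\<close> makes the relation
  antitone in the budget.\<close>

primrec rel :: "bool \<Rightarrow> ty \<Rightarrow> nat \<Rightarrow> tm \<Rightarrow> frame list \<Rightarrow> point vec \<Rightarrow> bool" where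
  "rel b TNat k M as u \<longleftrightarrow>
     (\<forall>\<pi>. dominated b k (\<lambda>j. val j (M, as @ \<pi>)) (\<lambda>j. \<Sum>\<^sub>\<infinity>n. u (PNat n) * val j (Num n, \<pi>)))"
| "rel b (\<sigma> \<rightarrow> \<tau>) k M as t \<longleftrightarrow>
     (\<forall>j\<le>k. \<forall>N u. u \<in> cliques \<sigma> \<longrightarrow> inert N \<longrightarrow> rel b \<sigma> j N [] u \<longrightarrow>
        rel b \<tau> j M (as @ [FArg N]) (fun_app t u))"

lemma rel_natD:
  "rel b TNat k M [] u \<Longrightarrow>
    dominated b k (\<lambda>j. val j (M, \<pi>)) (\<lambda>j. \<Sum>\<^sub>\<infinity>n. u (PNat n) * val j (Num n, \<pi>))"
  by simp

lemma rel_funD: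
  "rel b (\<sigma> \<rightarrow> \<tau>) k M [] t \<Longrightarrow> j \<le> k \<Longrightarrow> u \<in> cliques \<sigma> \<Longrightarrow> inert N \<Longrightarrow> rel b \<sigma> j N [] u \<Longrightarrow>
    rel b \<tau> j M [FArg N] (fun_app t u)"
  by simp

lemma rel_antimono: "rel b \<tau> k M as u \<Longrightarrow> j \<le> k \<Longrightarrow> rel b \<tau> j M as u"
  by (cases \<tau>) (auto intro: dominated_antimono)

text \<open>Backward closure under reduction at every type: the relation only sees how the term runs
  on stacks that extend \<open>as\<close>.\<close>

lemma rel_expand:
  "(\<And>\<pi>. dominated b k (\<lambda>j. val j (M, as @ \<pi>)) (\<lambda>j. val j (M', as' @ \<pi>))) \<Longrightarrow>
    rel b \<tau> k M' as' u \<Longrightarrow> rel b \<tau> k M as u"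
proof (induction \<tau> arbitrary: k as as' u)
  case TNat
  show ?case using dominated_trans[OF TNat(1)] TNat(2) by simp
next
  case (TFun \<sigma> \<tau>)
  show ?case
    unfolding rel.simps
  proof (intro allI impI)
    fix j N v assume "j \<le> k" "v \<in> cliques \<sigma>" "inert N" "rel b \<sigma> j N [] v"
    then show "rel b \<tau> j M (as @ [FArg N]) (fun_app u v)"
      using TFun.prems(1)[of "FArg N # _"] TFun.prems(2)
      by (intro TFun.IH(2)[of j "as @ [FArg N]" "as' @ [FArg N]"]) (auto intro: dominated_antimono)
  qed
qed

text \<open>The common core of \<open>let\<close>, \<open>if\<close> and \<open>coin\<close> at
  every type. Mixtures pass through application because \<open>fun_app\<close> is linear in the
  matrix, and at nat two sums are exchanged.\<close>

lemma rel_combine: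
  "(\<And>\<pi>. dominated b k (\<lambda>j. val j (L, as @ \<pi>)) (\<lambda>j. \<Sum>\<^sub>\<infinity>n. c n * val j (K n, as @ \<pi>))) \<Longrightarrow>
    (\<And>n::nat. rel b \<tau> k (K n) as (v n)) \<Longrightarrow> rel b \<tau> k L as (\<lambda>a. \<Sum>\<^sub>\<infinity>n. c n * v n a)"
proof (induction \<tau> arbitrary: k as v)
  case TNat
  show ?case
    unfolding rel.simps
  proof
    fix \<pi>
    note TNat(1)[of \<pi>]
    also have "dominated b k (\<lambda>j. \<Sum>\<^sub>\<infinity>n. c n * val j (K n, as @ \<pi>))
        (\<lambda>j. \<Sum>\<^sub>\<infinity>n. c n * (\<Sum>\<^sub>\<infinity>m. v n (PNat m) * val j (Num m, \<pi>)))"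
      using TNat(2) by (intro dominated_sum) simp
    also have "(\<lambda>j. \<Sum>\<^sub>\<infinity>n. c n * (\<Sum>\<^sub>\<infinity>m. v n (PNat m) * val j (Num m, \<pi>)))
        = (\<lambda>j. \<Sum>\<^sub>\<infinity>m. (\<Sum>\<^sub>\<infinity>n. c n * v n (PNat m)) * val j (Num m, \<pi>))"
    proof
      fix j
      have "(\<Sum>\<^sub>\<infinity>n. c n * (\<Sum>\<^sub>\<infinity>m. v n (PNat m) * val j (Num m, \<pi>)))
          = (\<Sum>\<^sub>\<infinity>n. \<Sum>\<^sub>\<infinity>m. c n * v n (PNat m) * val j (Num m, \<pi>))"
        by (simp add: infsum_ennreal_cmult mult.assoc)
      also have "\<dots> = (\<Sum>\<^sub>\<infinity>m. \<Sum>\<^sub>\<infinity>n. c n * v n (PNat m) * val j (Num m, \<pi>))"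
        by (rule infsum_ennreal_swap)
      finally show "(\<Sum>\<^sub>\<infinity>n. c n * (\<Sum>\<^sub>\<infinity>m. v n (PNat m) * val j (Num m, \<pi>)))
          = (\<Sum>\<^sub>\<infinity>m. (\<Sum>\<^sub>\<infinity>n. c n * v n (PNat m)) * val j (Num m, \<pi>))"
        by (simp add: infsum_ennreal_cmult_right)
    qed
    finally show "dominated b k (\<lambda>j. val j (L, as @ \<pi>))
        (\<lambda>j. \<Sum>\<^sub>\<infinity>m. (\<Sum>\<^sub>\<infinity>n. c n * v n (PNat m)) * val j (Num m, \<pi>))" .
  qed
next
  case (TFun \<sigma> \<tau>)
  show ?case
    unfolding rel.simps
  proof (intro allI impI)
    fix j N u assume u: "j \<le> k" "u \<in> cliques \<sigma>" "inert N" "rel b \<sigma> j N [] u"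
    have app: "fun_app (\<lambda>a. \<Sum>\<^sub>\<infinity>n. c n * v n a) u = (\<lambda>a. \<Sum>\<^sub>\<infinity>n. c n * fun_app (v n) u a)"
      by (rule ext) (rule fun_app_infsum)
    show "rel b \<tau> j L (as @ [FArg N]) (fun_app (\<lambda>a. \<Sum>\<^sub>\<infinity>n. c n * v n a) u)"
      unfolding app
    proof (rule TFun.IH(2))
      show "dominated b j (\<lambda>j. val j (L, (as @ [FArg N]) @ \<pi>))
          (\<lambda>j. \<Sum>\<^sub>\<infinity>n. c n * val j (K n, (as @ [FArg N]) @ \<pi>))" for \<pi>
        using dominated_antimono[OF TFun.prems(1)[of "FArg N # \<pi>"] u(1)] by simp
      show "rel b \<tau> j (K n) (as @ [FArg N]) (fun_app (v n) u)" for n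
        using TFun.prems(2)[of n] u by simp
    qed
  qed
qed

text \<open>With budget 0 every evaluation is 0; this starts the induction for
  \<open>fix\<close>.\<close>

lemma rel_upper_0: "rel True \<tau> 0 M as u"
  by (induction \<tau> arbitrary: as u) (auto simp: dominated_def val_def)

text \<open>Unlike \<open>rel_expand\<close>, this counts the unit of budget that a step consumes
  and so gains one index. That gain is what makes the recursion of \<open>fix\<close> well
  founded.\<close>

lemma rel_upper_Suc:
  "(\<And>\<pi> j. ev (Suc j) (M, as @ \<pi>) \<le> ev j (M', as' @ \<pi>)) \<Longrightarrow> rel True \<tau> k M' as' u \<Longrightarrow>
    rel True \<tau> (Suc k) M as u"
proof (induction \<tau> arbitrary: k as as' u)
  case TNat
  have "ev j (M, as @ \<pi>) \<le> (\<Sum>\<^sub>\<infinity>n. u (PNat n) * ev j (Num n, \<pi>))" if "j \<le> Suc k" for j \<pi>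
  proof (cases j)
    case (Suc i)
    have "ev (Suc i) (M, as @ \<pi>) \<le> ev i (M', as' @ \<pi>)" by (rule TNat(1))
    also have "\<dots> \<le> (\<Sum>\<^sub>\<infinity>n. u (PNat n) * ev i (Num n, \<pi>))"
      using TNat(2) that Suc by (auto simp: dominated_def val_def)
    also have "\<dots> \<le> (\<Sum>\<^sub>\<infinity>n. u (PNat n) * ev (Suc i) (Num n, \<pi>))"
      by (intro infsum_ennreal_mono mult_left_mono incseq_SucD[OF incseq_ev]) simp
    finally show ?thesis by (simp add: Suc)
  qed simp
  then show ?case by (simp add: dominated_def val_def)
next
  case (TFun \<sigma> \<tau>)
  show ?case
    unfolding rel.simps
  proof (intro allI impI)
    fix j N v assume j: "j \<le> Suc k" and v: "v \<in> cliques \<sigma>" "inert N" "rel True \<sigma> j N [] v"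
    show "rel True \<tau> j M (as @ [FArg N]) (fun_app u v)"
    proof (cases j)
      case 0
      then show ?thesis by (simp add: rel_upper_0)
    next
      case (Suc i)
      then have "rel True \<tau> i M' (as' @ [FArg N]) (fun_app u v)"
        using TFun.prems(2) v j rel_antimono[OF v(3), of i] by simp
      then show ?thesis
        unfolding Suc using TFun.prems(1)[of _ "FArg N # _"]
        by (intro TFun.IH(2)[of "as @ [FArg N]" "as' @ [FArg N]"]) simp_all
    qed
  qed
qed

text \<open>Unfolding \<open>Fix M\<close> costs a step, so the claim at budget k, used for the
  recursive argument, yields the claim at k + 1. The fixed-point equation keeps v unchanged.\<close>

lemma rel_upper_fix:
  assumes "rel True (\<sigma> \<rightarrow> \<sigma>) k M [] f" "inert (Fix M)" "v \<in> cliques \<sigma>" "fun_app f v = v"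
  shows "rel True \<sigma> k (Fix M) [] v"
  using assms(1)
proof (induction k)
  case 0
  show ?case by (rule rel_upper_0)
next
  case (Suc k)
  then have "rel True \<sigma> k (Fix M) [] v" using rel_antimono[OF Suc.prems, of k] by simp
  then have "rel True \<sigma> k M [FArg (Fix M)] v"
    using rel_funD[OF Suc.prems, of k v "Fix M"] assms by simp
  then show ?case by (rule rel_upper_Suc[rotated]) (simp add: ev_step)
qed

lemma rel_lower_zero: "rel False \<tau> k M as (\<lambda>_. 0)"
  by (induction \<tau> arbitrary: k as) (auto simp: dominated_def)

text \<open>Admissibility: lower bounds survive suprema of chains, because the pairing at nat and
  application in the matrix both commute with them.\<close>

lemma rel_lower_SUP:
  "(\<And>n. rel False \<tau> k M as (u n)) \<Longrightarrow> (\<And>a. incseq (\<lambda>n::nat. u n a)) \<Longrightarrow>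
    rel False \<tau> k M as (\<lambda>a. SUP n. u n a)"
proof (induction \<tau> arbitrary: k as u)
  case TNat
  have "(\<Sum>\<^sub>\<infinity>m. (SUP n. u n (PNat m)) * x m) = (SUP n. \<Sum>\<^sub>\<infinity>m. u n (PNat m) * x m)" for x
  proof -
    have "incseq (\<lambda>n. u n (PNat m) * x m)" for m
      using TNat(2)[of "PNat m"] by (auto simp: incseq_def intro: mult_right_mono)
    then show ?thesis by (simp add: SUP_mult_right_ennreal infsum_ennreal_SUP_swap)
  qed
  then show ?case using TNat(1) by (auto simp: dominated_def intro!: SUP_least)
next
  case (TFun \<sigma> \<tau>)
  show ?case
    unfolding rel.simps
  proof (intro allI impI)
    fix j N v assume v: "j \<le> k" "v \<in> cliques \<sigma>" "inert N" "rel False \<sigma> j N [] v"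
    have "incseq (\<lambda>n. fun_app (u n) v a)" for a
      using TFun.prems(2) by (auto simp: incseq_def intro: fun_app_mono)
    moreover have "fun_app (\<lambda>a. SUP n. u n a) v = (\<lambda>a. SUP n. fun_app (u n) v a)"
      by (rule ext) (rule fun_app_SUP_fun[OF TFun.prems(2)])
    ultimately show "rel False \<tau> j M (as @ [FArg N]) (fun_app (\<lambda>a. SUP n. u n a) v)"
      using TFun.prems(1) v by (auto intro!: TFun.IH(2))
  qed
qed

text \<open>Every finite iterate is related, by unfolding \<open>Fix M\<close> once per iteration
  and starting from 0; admissibility passes to the supremum.\<close>

lemma rel_lower_fix:
  assumes f: "rel False (\<sigma> \<rightarrow> \<sigma>) k M [] f" "inert (Fix M)" "f \<in> cliques (\<sigma> \<rightarrow> \<sigma>)"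
  shows "rel False \<sigma> k (Fix M) [] (\<lambda>a. SUP n. (fun_app f ^^ n) (\<lambda>_. 0) a)"
proof (rule rel_lower_SUP)
  show "rel False \<sigma> k (Fix M) [] ((fun_app f ^^ n) (\<lambda>_. 0))" for n
  proof (induction n)
    case 0
    show ?case by (simp add: rel_lower_zero)
  next
    case (Suc n)
    have "rel False \<sigma> k M [FArg (Fix M)] ((fun_app f ^^ Suc n) (\<lambda>_. 0))"
      using rel_funD[OF f(1) order_refl iterates_clique[OF f(3)] f(2) Suc] by simp
    then show ?case by (rule rel_expand[rotated]) (simp add: dominated_step)
  qed
qed (rule incseq_fun_app_iterates)

text \<open>Application is Scott continuous in its argument, and the shifted chain has the same
  supremum. This is the fixed-point equation used in the upper direction.\<close>

lemma fun_app_fix: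
  "fun_app f (\<lambda>a. SUP n. (fun_app f ^^ n) (\<lambda>_. 0) a) = (\<lambda>a. SUP n. (fun_app f ^^ n) (\<lambda>_. 0) a)"
  (is "fun_app f ?v = ?v")
proof
  fix b
  have "fun_app f ?v b = (SUP n. (fun_app f ^^ Suc n) (\<lambda>_. 0) b)"
    by (subst fun_app_SUP_arg[OF incseq_fun_app_iterates]) simp
  also have "\<dots> = ?v b" by (rule incseq_SUP_Suc[OF incseq_fun_app_iterates])
  finally show "fun_app f ?v b = ?v b" .
qed

definition closing :: "bool \<Rightarrow> nat \<Rightarrow> ctx \<Rightarrow> env \<Rightarrow> (vname \<rightharpoonup> tm) \<Rightarrow> bool" where
  "closing b k \<Gamma> \<rho> s \<longleftrightarrow> env_ok \<Gamma> \<rho> \<and> inert_subst s \<and>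
     (\<forall>x \<sigma>. \<Gamma> x = Some \<sigma> \<longrightarrow> (\<exists>N. s x = Some N \<and> rel b \<sigma> k N [] (\<rho> x)))"

lemma closing_antimono: "closing b k \<Gamma> \<rho> s \<Longrightarrow> j \<le> k \<Longrightarrow> closing b j \<Gamma> \<rho> s"
  unfolding closing_def using rel_antimono by blast

lemma closing_upd:
  "closing b k \<Gamma> \<rho> s \<Longrightarrow> u \<in> cliques \<sigma> \<Longrightarrow> inert N \<Longrightarrow> rel b \<sigma> k N [] u \<Longrightarrow>
    closing b k (\<Gamma>(x \<mapsto> \<sigma>)) (\<rho>(x := u)) (s(x \<mapsto> N))"
  unfolding closing_def by (auto intro: env_ok_upd inert_subst_upd simp del: fun_upd_apply) auto

lemma closing_inert: "closing b k \<Gamma> \<rho> s \<Longrightarrow> \<Gamma> \<turnstile> M : \<tau> \<Longrightarrow> inert (csubst M s)"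
  unfolding closing_def by (rule inert_csubst) auto

lemma rel_Num: "rel b TNat k (Num n) [] (dirac n)"
  by (simp add: infsum_dirac dominated_refl)

text \<open>Induction on the size, again because of \<open>Let\<close>. The budget is generalized
  since an abstraction receives its arguments at smaller budgets.\<close>

lemma fundamental:
  "\<Gamma> \<turnstile> M : \<tau> \<Longrightarrow> closing b k \<Gamma> \<rho> s \<Longrightarrow> rel b \<tau> k (csubst M s) [] (sem \<Gamma> M \<rho>)"
proof (induction M arbitrary: \<Gamma> \<tau> k \<rho> s rule: measure_induct_rule[of size])
  case (less M)
  note IH = less.IH
  note cl = less.prems(2)
  have ok: "env_ok \<Gamma> \<rho>" and inert_s: "inert_subst s" using cl by (auto simp: closing_def)
  from less.prems(1) show ?case
  proof cases
    case (T_Num n)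
    then show ?thesis by (simp add: rel_Num del: rel.simps)
  next
    case (T_Succ M')
    let ?M = "csubst M' s" and ?u = "sem \<Gamma> M' \<rho>"
    have "rel b TNat k ?M [] ?u" using T_Succ cl by (intro IH) simp_all
    note M' = rel_natD[OF this]
    have "dominated b k (\<lambda>j. val j (Succ ?M, \<pi>)) (\<lambda>j. \<Sum>\<^sub>\<infinity>n. sem \<Gamma> M \<rho> (PNat n) * val j (Num n, \<pi>))" for \<pi>
    proof -
      have "dominated b k (\<lambda>j. val j (Succ ?M, \<pi>)) (\<lambda>j. val j (?M, FSucc # \<pi>))"
        by (rule dominated_step) simp
      also note M'
      also have "dominated b k (\<lambda>j. \<Sum>\<^sub>\<infinity>n. ?u (PNat n) * val j (Num n, FSucc # \<pi>))
          (\<lambda>j. \<Sum>\<^sub>\<infinity>n. ?u (PNat n) * val j (Num (Suc n), \<pi>))"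
        by (intro dominated_sum dominated_step) simp
      also have "(\<lambda>j. \<Sum>\<^sub>\<infinity>n. ?u (PNat n) * val j (Num (Suc n), \<pi>))
          = (\<lambda>j. \<Sum>\<^sub>\<infinity>n. sem \<Gamma> M \<rho> (PNat n) * val j (Num n, \<pi>))"
        \<comment> \<open>The head term vanishes since a successor is never 0; dropping it shifts
          the index by one.\<close>
        by (rule ext, subst infsum_ennreal_Suc[of "\<lambda>n. sem \<Gamma> M \<rho> (PNat n) * _ n"]) (simp add: T_Succ)
      finally show ?thesis .
    qed
    then show ?thesis by (simp add: T_Succ)
  next
    case (T_Pred M')
    let ?M = "csubst M' s" and ?u = "sem \<Gamma> M' \<rho>"
    have "rel b TNat k ?M [] ?u" using T_Pred cl by (intro IH) simp_all
    note M' = rel_natD[OF this]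
    have "dominated b k (\<lambda>j. val j (Pred ?M, \<pi>)) (\<lambda>j. \<Sum>\<^sub>\<infinity>n. sem \<Gamma> M \<rho> (PNat n) * val j (Num n, \<pi>))" for \<pi>
    proof -
      have "dominated b k (\<lambda>j. val j (Pred ?M, \<pi>)) (\<lambda>j. val j (?M, FPred # \<pi>))"
        by (rule dominated_step) simp
      also note M'
      also have "dominated b k (\<lambda>j. \<Sum>\<^sub>\<infinity>n. ?u (PNat n) * val j (Num n, FPred # \<pi>))
          (\<lambda>j. \<Sum>\<^sub>\<infinity>n. ?u (PNat n) * val j (Num (n - 1), \<pi>))"
        by (intro dominated_sum dominated_step) simp
      also have "(\<lambda>j. \<Sum>\<^sub>\<infinity>n. ?u (PNat n) * val j (Num (n - 1), \<pi>))
          = (\<lambda>j. \<Sum>\<^sub>\<infinity>n. sem \<Gamma> M \<rho> (PNat n) * val j (Num n, \<pi>))"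
      proof
        fix j
        have "(\<Sum>\<^sub>\<infinity>n. sem \<Gamma> M \<rho> (PNat n) * val j (Num n, \<pi>))
            = (\<Sum>\<^sub>\<infinity>n. (if n = 0 then ?u (PNat 0) else 0) * val j (Num n, \<pi>)
                + ?u (PNat (Suc n)) * val j (Num n, \<pi>))"
          by (simp add: T_Pred distrib_right)
        also have "\<dots> = ?u (PNat 0) * val j (Num 0, \<pi>) + (\<Sum>\<^sub>\<infinity>n. ?u (PNat (Suc n)) * val j (Num n, \<pi>))"
          by (subst infsum_ennreal_add, subst infsum_ennreal_single[of 0]) auto
        finally show "(\<Sum>\<^sub>\<infinity>n. ?u (PNat n) * val j (Num (n - 1), \<pi>))
            = (\<Sum>\<^sub>\<infinity>n. sem \<Gamma> M \<rho> (PNat n) * val j (Num n, \<pi>))"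
          by (subst infsum_ennreal_Suc) simp
      qed
      finally show ?thesis .
    qed
    then show ?thesis by (simp add: T_Pred)
  next
    case (T_Var x)
    then obtain N where "s x = Some N" "rel b \<tau> k N [] (\<rho> x)" using cl by (auto simp: closing_def)
    then show ?thesis by (simp add: T_Var)
  next
    case (T_Coin r)
    show ?thesis
      unfolding T_Coin csubst.simps sem_Coin_eq
      by (rule rel_combine[where K = Num]) (simp_all only: append_Nil dominated_Coin rel_Num)
  next
    case (T_Let M' x N)
    let ?M = "csubst M' s" and ?N = "csubst N (s(x := None))" and ?u = "sem \<Gamma> M' \<rho>"
    have "rel b TNat k ?M [] ?u" using T_Let cl by (intro IH) simp_all
    note M' = rel_natD[OF this]
    have N: "subst x (Num n) ?N = csubst (subst x (Num n) N) s" for n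
      using subst_csubst[OF inert_s] by (simp only: csubst_subst_Num)
    have "rel b \<tau> k (Let x ?M ?N) [] (\<lambda>a. \<Sum>\<^sub>\<infinity>n. ?u (PNat n) * sem \<Gamma> (subst x (Num n) N) \<rho> a)"
    proof (rule rel_combine[where K = "\<lambda>n. subst x (Num n) ?N"])
      fix \<pi>
      have "dominated b k (\<lambda>j. val j (Let x ?M ?N, \<pi>)) (\<lambda>j. val j (?M, FLet x ?N # \<pi>))"
        by (rule dominated_step) simp
      also note M'
      also have "dominated b k (\<lambda>j. \<Sum>\<^sub>\<infinity>n. ?u (PNat n) * val j (Num n, FLet x ?N # \<pi>))
          (\<lambda>j. \<Sum>\<^sub>\<infinity>n. ?u (PNat n) * val j (subst x (Num n) ?N, \<pi>))"
        by (intro dominated_sum dominated_step) simp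
      finally show "dominated b k (\<lambda>j. val j (Let x ?M ?N, [] @ \<pi>))
          (\<lambda>j. \<Sum>\<^sub>\<infinity>n. ?u (PNat n) * val j (subst x (Num n) ?N, [] @ \<pi>))" by simp
    next
      show "rel b \<tau> k (subst x (Num n) ?N) [] (sem \<Gamma> (subst x (Num n) N) \<rho>)" for n
        unfolding N using T_Let cl by (intro IH typing_subst_Num) (simp_all add: size_subst_Num)
    qed
    then show ?thesis by (simp add: T_Let)
  next
    case (T_If M' N P)
    let ?M = "csubst M' s" and ?N = "csubst N s" and ?P = "csubst P s" and ?u = "sem \<Gamma> M' \<rho>"
    have "rel b TNat k ?M [] ?u" using T_If cl by (intro IH) simp_all
    note M' = rel_natD[OF this]
    have "rel b \<tau> k (If ?M ?N ?P) []
        (\<lambda>a. \<Sum>\<^sub>\<infinity>n. ?u (PNat n) * if_branch (sem \<Gamma> N \<rho>) (sem \<Gamma> P \<rho>) n a)"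
    proof (rule rel_combine[where K = "if_branch ?N ?P"])
      fix \<pi>
      have "dominated b k (\<lambda>j. val j (If ?M ?N ?P, \<pi>)) (\<lambda>j. val j (?M, FIf ?N ?P # \<pi>))"
        by (rule dominated_step) simp
      also note M'
      also have "dominated b k (\<lambda>j. \<Sum>\<^sub>\<infinity>n. ?u (PNat n) * val j (Num n, FIf ?N ?P # \<pi>))
          (\<lambda>j. \<Sum>\<^sub>\<infinity>n. ?u (PNat n) * val j (if_branch ?N ?P n, \<pi>))"
      proof (intro dominated_sum dominated_step)
        show "step (Num n, FIf ?N ?P # \<pi>) = Some (if_branch ?N ?P n, \<pi>)" for n
          by (cases n) (simp_all add: if_branch_def)
      qed
      finally show "dominated b k (\<lambda>j. val j (If ?M ?N ?P, [] @ \<pi>))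
          (\<lambda>j. \<Sum>\<^sub>\<infinity>n. ?u (PNat n) * val j (if_branch ?N ?P n, [] @ \<pi>))" by simp
    next
      have "rel b \<tau> k ?N [] (sem \<Gamma> N \<rho>)" "rel b \<tau> k ?P [] (sem \<Gamma> P \<rho>)"
        using T_If cl by (auto intro!: IH)
      then show "rel b \<tau> k (if_branch ?N ?P n) [] (if_branch (sem \<Gamma> N \<rho>) (sem \<Gamma> P \<rho>) n)" for n
        by (simp add: if_branch_def split: nat.split)
    qed
    then show ?thesis unfolding T_If(1) sem_If_eq by simp
  next
    case (T_App M' \<sigma> N)
    let ?M = "csubst M' s" and ?N = "csubst N s"
    have "rel b (\<sigma> \<rightarrow> \<tau>) k ?M [] (sem \<Gamma> M' \<rho>)" "rel b \<sigma> k ?N [] (sem \<Gamma> N \<rho>)"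
      using T_App cl by (auto intro!: IH simp del: rel.simps)
    then have "rel b \<tau> k ?M [FArg ?N] (fun_app (sem \<Gamma> M' \<rho>) (sem \<Gamma> N \<rho>))"
      using rel_funD sem_clique[OF T_App(3) ok] closing_inert[OF cl T_App(3)] by blast
    then have "rel b \<tau> k (App ?M ?N) [] (fun_app (sem \<Gamma> M' \<rho>) (sem \<Gamma> N \<rho>))"
      by (rule rel_expand[rotated]) (simp add: dominated_step)
    then show ?thesis by (simp add: T_App)
  next
    case (T_Lam x \<sigma> M' \<tau>')
    let ?M = "csubst M' (s(x := None))"
    have "rel b \<tau>' j (Lam x \<sigma> ?M) [FArg N] (fun_app (sem \<Gamma> (Lam x \<sigma> M') \<rho>) u)"
      if j: "j \<le> k" and u: "u \<in> cliques \<sigma>" "inert N" "rel b \<sigma> j N [] u" for j N u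
    proof -
      have "rel b \<tau>' j (csubst M' (s(x \<mapsto> N))) [] (sem (\<Gamma>(x \<mapsto> \<sigma>)) M' (\<rho>(x := u)))"
        using T_Lam u closing_antimono[OF cl j]
        by (intro IH closing_upd) (simp_all del: fun_upd_apply)
      then have "rel b \<tau>' j (subst x N ?M) [] (fun_app (sem \<Gamma> (Lam x \<sigma> M') \<rho>) u)"
        by (simp only: subst_csubst[OF inert_s] fun_app_sem_Lam[OF T_Lam(3) ok u(1)])
      then show ?thesis by (rule rel_expand[rotated]) (simp add: dominated_step)
    qed
    then show ?thesis unfolding T_Lam(1,2) csubst.simps rel.simps by simp
  next
    case (T_Fix M')
    let ?M = "csubst M' s"
    have rel: "rel b (\<tau> \<rightarrow> \<tau>) k ?M [] (sem \<Gamma> M' \<rho>)" using T_Fix cl by (intro IH) simp_all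
    have inert: "inert (Fix ?M)" using closing_inert[OF cl less.prems(1)] by (simp add: T_Fix)
    have f: "sem \<Gamma> M' \<rho> \<in> cliques (\<tau> \<rightarrow> \<tau>)" by (rule sem_clique[OF T_Fix(2) ok])
    have v: "(\<lambda>a. SUP n. (fun_app (sem \<Gamma> M' \<rho>) ^^ n) (\<lambda>_. 0) a) \<in> cliques \<tau>"
      by (intro clique_SUP iterates_clique f incseq_fun_app_iterates)
    have "rel b \<tau> k (Fix ?M) [] (\<lambda>a. SUP n. (fun_app (sem \<Gamma> M' \<rho>) ^^ n) (\<lambda>_. 0) a)"
    proof (cases b)
      case True
      then show ?thesis using rel_upper_fix[OF _ inert v fun_app_fix] rel by simp
    next
      case False
      then show ?thesis using rel_lower_fix[OF _ inert f] rel by simp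
    qed
    then show ?thesis by (simp add: T_Fix)
  qed
qed

lemma closed_sem_clique: "M \<in> closed_terms \<sigma> \<Longrightarrow> closed_sem M \<in> cliques \<sigma>"
  unfolding closed_sem_def closed_terms_def by (auto intro: sem_clique simp: env_ok_def)

text \<open>On the empty stack only the numeral 0 has value 1, so the mixture collapses to the
  coefficient at \<open>PNat 0\<close>. The flag \<open>True\<close> bounds every budgeted value,
  the flag \<open>False\<close> bounds the limit from below.\<close>

lemma ev_lim_closed:
  assumes "M \<in> closed_terms TNat"
  shows "ev_lim (M, []) = closed_sem M (PNat 0)"
proof -
  have rel: "rel b TNat k M [] (closed_sem M)" for b k
    using fundamental[of Map.empty M TNat b k "\<lambda>_ _. 0" Map.empty] assms
    by (simp add: closed_terms_def closed_sem_def closing_def env_ok_def inert_subst_def del: rel.simps)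
  have sum: "(\<Sum>\<^sub>\<infinity>n. closed_sem M (PNat n) * ev_lim (Num n, [])) = closed_sem M (PNat 0)"
    by (subst infsum_ennreal_single[of 0]) (auto simp: ev_lim_Num_Nil)
  show ?thesis
  proof (rule antisym)
    have "ev k (M, []) \<le> closed_sem M (PNat 0)" for k
    proof -
      have "ev k (M, []) \<le> (\<Sum>\<^sub>\<infinity>n. closed_sem M (PNat n) * ev k (Num n, []))"
        using rel_natD[OF rel[of True k], of "[]"] by (simp add: dominated_def val_def)
      also have "\<dots> \<le> (\<Sum>\<^sub>\<infinity>n. closed_sem M (PNat n) * ev_lim (Num n, []))"
        by (intro infsum_ennreal_mono mult_left_mono ev_le_lim) simp
      finally show ?thesis unfolding sum .
    qed
    then show "ev_lim (M, []) \<le> closed_sem M (PNat 0)" unfolding ev_lim_def by (rule SUP_least)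
    show "closed_sem M (PNat 0) \<le> ev_lim (M, [])"
      using rel_natD[OF rel[of False 0], of "[]"] by (simp add: dominated_def val_def sum)
  qed
qed

section \<open>The tamed distance\<close>

text \<open>A product of nonnegative, nondecreasing convex functions is convex. Monotonicity enters
  through \<open>PQ\<close>, which bounds the interpolated value of the remaining factors by its
  value at the end of the segment.\<close>

lemma promote_convex:
  assumes "0 \<le> l" "l \<le> (1::real)"
  shows "promote (\<lambda>a. u a + ennreal l * w a) \<mu>
    \<le> ennreal (1 - l) * promote u \<mu> + ennreal l * promote (\<lambda>a. u a + w a) \<mu>"
proof (induction \<mu>)
  case empty
  have "ennreal (1 - l) + ennreal l = 1" using assms by (subst ennreal_plus[symmetric]) auto
  then show ?case by simp
next
  case (add a \<mu>)
  define L where "L = ennreal l"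
  define L' where "L' = ennreal (1 - l)"
  define P where "P = promote u \<mu>"
  define Q where "Q = promote (\<lambda>a. u a + w a) \<mu>"
  have L: "L' + L = 1" unfolding L_def L'_def using assms by (subst ennreal_plus[symmetric]) auto
  have "P \<le> Q" unfolding P_def Q_def by (rule promote_mono) simp
  then have PQ: "L' * P + L * Q \<le> Q"
    using add_right_mono[OF mult_left_mono[of P Q L'], of "L * Q"] L
    by (simp add: distrib_right[symmetric])
  have "promote (\<lambda>a. u a + L * w a) (add_mset a \<mu>) \<le> (u a + L * w a) * (L' * P + L * Q)"
    using add by (auto simp: L_def L'_def P_def Q_def intro: mult_left_mono)
  also have "\<dots> = u a * (L' * P + L * Q) + L * w a * (L' * P + L * Q)" by (rule distrib_right)
  also have "\<dots> \<le> u a * (L' * P + L * Q) + L * w a * Q"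
    by (intro add_left_mono mult_left_mono PQ) simp
  also have "\<dots> = L' * (u a * P) + L * ((u a + w a) * Q)" by (simp add: algebra_simps)
  finally show ?case by (simp add: L_def L'_def P_def Q_def)
qed

lemma fun_app_convex:
  assumes "0 \<le> l" "l \<le> (1::real)"
  shows "fun_app t (\<lambda>a. u a + ennreal l * w a) b
    \<le> ennreal (1 - l) * fun_app t u b + ennreal l * fun_app t (\<lambda>a. u a + w a) b"
proof -
  have "fun_app t (\<lambda>a. u a + ennreal l * w a) b
      \<le> (\<Sum>\<^sub>\<infinity>\<mu>. t (PFun \<mu> b) * (ennreal (1 - l) * promote u \<mu> + ennreal l * promote (\<lambda>a. u a + w a) \<mu>))"
    unfolding fun_app_eq by (intro infsum_ennreal_mono mult_left_mono promote_convex assms) simp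
  also have "\<dots> = (\<Sum>\<^sub>\<infinity>\<mu>. ennreal (1 - l) * (t (PFun \<mu> b) * promote u \<mu>)
      + ennreal l * (t (PFun \<mu> b) * promote (\<lambda>a. u a + w a) \<mu>))"
    by (intro infsum_cong) (simp add: algebra_simps)
  finally show ?thesis
    by (simp add: fun_app_eq infsum_ennreal_add infsum_ennreal_cmult)
qed

lemma clique_convex:
  assumes "0 \<le> p" "p \<le> 1" "u \<in> cliques \<sigma>" "v \<in> cliques \<sigma>"
  shows "(\<lambda>a. ennreal (of_rat p) * u a + ennreal (1 - of_rat p) * v a) \<in> cliques \<sigma>"
proof -
  have "(\<lambda>a. \<Sum>\<^sub>\<infinity>n. coin_dist p n * if_branch u v n a) \<in> cliques \<sigma>"
    using assms coin_dist_sum[OF assms(1,2)]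
    by (intro clique_infsum) (auto simp: if_branch_def split: nat.split)
  then show ?thesis by (simp add: infsum_coin_dist if_branch_def)
qed

lemma clique_nat_le_1: "u \<in> cliques TNat \<Longrightarrow> u (PNat n) \<le> 1"
  using le_infsum_ennreal[of "\<lambda>n. u (PNat n)" n] by (auto simp: clique_TNat_iff)

definition scale :: "rat \<Rightarrow> point vec \<Rightarrow> point vec" where
  "scale p u = (\<lambda>a. ennreal (of_rat p) * u a)"

lemma scale_clique:
  assumes "0 \<le> p" "p \<le> 1" "u \<in> cliques \<sigma>"
  shows "scale p u \<in> cliques \<sigma>"
  using clique_convex[OF assms clique_zero] by (simp add: scale_def)

text \<open>Along the segment from \<open>p z\<close> in the direction \<open>w\<close>, the clique \<open>p z + (1 - p) w\<close> is reached
  at time \<open>1 - p\<close>, and \<open>t\<close> is convex with values at most \<open>1\<close> there: its increment up to time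
  \<open>p r\<close> is at most \<open>p r / (1 - p)\<close>.\<close>

lemma scaled_increment_le:
  assumes p: "0 \<le> p" "p < 1" and t: "t \<in> cliques (\<sigma> \<rightarrow> TNat)"
    and x: "x \<in> cliques \<sigma>" and w: "w \<in> cliques \<sigma>"
    and xz: "\<And>a. x a = z a + ennreal r * w a" and r: "0 \<le> r"
  shows "fun_app t (scale p x) (PNat n)
    \<le> fun_app t (scale p z) (PNat n) + ennreal (of_rat p / (1 - of_rat p) * r)"
proof -
  define q :: real where "q = of_rat p"
  have q: "0 \<le> q" "q < 1" using p by (simp_all add: q_def)
  \<comment> \<open>Chosen so that \<open>l * (1 - q) = q * r\<close>: the displacement
    \<open>q * r\<close> along w is the fraction l of the displacement \<open>1 - q\<close>.\<close>
  define l where "l = q / (1 - q) * r"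
  have l0: "0 \<le> l" using q r by (simp add: l_def)
  have le1: "fun_app t v (PNat n) \<le> 1" if "v \<in> cliques \<sigma>" for v
    by (rule clique_nat_le_1[OF clique_fun_app[OF t that]])
  have z: "z \<in> cliques \<sigma>" by (rule clique_downward[OF x]) (simp add: xz)
  show ?thesis
  proof (cases "l \<le> 1")
    case True
    define w' where "w' = (\<lambda>a. ennreal (1 - q) * w a)"
    have lq: "l * (1 - q) = q * r" using q by (simp add: l_def field_simps)
    have "ennreal l * ennreal (1 - q) = ennreal q * ennreal r"
      using lq l0 q r by (simp add: ennreal_mult[symmetric])
    then have "scale p x = (\<lambda>a. scale p z a + ennreal l * w' a)"
      by (simp add: fun_eq_iff scale_def w'_def xz q_def distrib_left mult.assoc[symmetric])
    then have "fun_app t (scale p x) (PNat n)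
        \<le> ennreal (1 - l) * fun_app t (scale p z) (PNat n)
          + ennreal l * fun_app t (\<lambda>a. scale p z a + w' a) (PNat n)"
      using fun_app_convex[OF l0 True] by simp
    also have "\<dots> \<le> 1 * fun_app t (scale p z) (PNat n) + ennreal l * 1"
    proof (intro add_mono mult_mono le1)
      show "ennreal (1 - l) \<le> 1" using l0 by simp
      show "(\<lambda>a. scale p z a + w' a) \<in> cliques \<sigma>"
        using clique_convex[OF p(1) less_imp_le[OF p(2)] z w] by (simp add: scale_def w'_def q_def)
    qed simp_all
    finally show ?thesis by (simp add: l_def q_def)
  next
    \<comment> \<open>Past the end of the segment convexity gives no bound, but then the claimed
      increment l exceeds 1, which bounds all values.\<close>
    case False
    have "fun_app t (scale p x) (PNat n) \<le> 1"
      using p x by (intro le1 scale_clique) auto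
    also have "\<dots> \<le> ennreal l" using False by simp
    also have "\<dots> \<le> fun_app t (scale p z) (PNat n) + ennreal l" by simp
    finally show ?thesis by (simp add: l_def q_def)
  qed
qed

text \<open>A real infimum over the empty set carries no information; for a clique the number 1
  belongs to the set.\<close>

lemma pcs_norm_nonneg: "w \<in> cliques \<sigma> \<Longrightarrow> 0 \<le> pcs_norm (ty_sem \<sigma>) w"
  unfolding pcs_norm_def by (rule cInf_greatest) (auto intro!: exI[of _ 1] bexI[of _ w])

lemma scaled_difference_le_norm:
  assumes p: "0 \<le> p" "p < 1" and t: "t \<in> cliques (\<sigma> \<rightarrow> TNat)"
    and x: "x \<in> cliques \<sigma>" and zx: "\<And>a. z a \<le> x a"
  shows "enn2real (fun_app t (scale p x) (PNat n)) - enn2real (fun_app t (scale p z) (PNat n))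
    \<le> of_rat p / (1 - of_rat p) * pcs_norm (ty_sem \<sigma>) (\<lambda>a. x a - z a)"
proof -
  define K :: real where "K = of_rat p / (1 - of_rat p)"
  have K: "0 \<le> K" using p by (simp add: K_def)
  define F where "F v = enn2real (fun_app t (scale p v) (PNat n))" for v
  have z: "z \<in> cliques \<sigma>" by (rule clique_downward[OF x zx])
  have fin: "fun_app t (scale p v) (PNat n) < top" if "v \<in> cliques \<sigma>" for v
    using clique_finite[OF clique_fun_app[OF t scale_clique]] p that by (simp add: less_imp_le)
  have le: "F x - F z \<le> K * r"
    if r: "0 < r" and w: "w \<in> cliques \<sigma>" "(\<lambda>a. x a - z a) = (\<lambda>a. ennreal r * w a)" for r w
  proof -
    have "x a = z a + ennreal r * w a" for a
      using fun_cong[OF w(2), of a] diff_add_cancel_ennreal[OF zx[of a]] by (simp add: add.commute)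
    then have "fun_app t (scale p x) (PNat n) \<le> fun_app t (scale p z) (PNat n) + ennreal (K * r)"
      unfolding K_def using r w by (intro scaled_increment_le[OF p t x w(1)]) auto
    then have "F x \<le> enn2real (fun_app t (scale p z) (PNat n) + ennreal (K * r))"
      unfolding F_def using fin[OF z] by (intro enn2real_mono) auto
    also have "\<dots> = F z + K * r"
      unfolding F_def using fin[OF z] K r by (subst enn2real_plus) auto
    finally show ?thesis by simp
  qed
  let ?R = "{r. r > 0 \<and> (\<exists>w\<in>cliques \<sigma>. (\<lambda>a. x a - z a) = (\<lambda>a. ennreal r * w a))}"
  have w: "(\<lambda>a. x a - z a) \<in> cliques \<sigma>"
    by (rule clique_downward[OF x]) (simp add: diff_le_self_ennreal)
  then have R1: "1 \<in> ?R" by (auto intro!: bexI[of _ "\<lambda>a. x a - z a"])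
  have "F x - F z \<le> K * Inf ?R"
  \<comment> \<open>For p = 0 it is impossible to divide by K in order to reach the infimum; the
    single instance r = 1 already gives the bound.\<close>
  proof (cases "K = 0")
    case True
    then show ?thesis using le[of 1, OF _ w] by simp
  next
    case False
    then have "K > 0" using K by simp
    have "(F x - F z) / K \<le> Inf ?R"
    proof (rule cInf_greatest)
      show "?R \<noteq> {}" using R1 by blast
      fix r assume "r \<in> ?R"
      then obtain w where "0 < r" "w \<in> cliques \<sigma>" "(\<lambda>a. x a - z a) = (\<lambda>a. ennreal r * w a)"
        by blast
      then have "F x - F z \<le> K * r" by (rule le)
      then show "(F x - F z) / K \<le> r" using \<open>K > 0\<close> by (simp add: divide_le_eq mult.commute)
    qed
    then show ?thesis using \<open>K > 0\<close> by (simp add: divide_le_eq mult.commute)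
  qed
  then show ?thesis unfolding F_def K_def pcs_norm_def .
qed

lemma scaled_difference_le_dist:
  assumes p: "0 \<le> p" "p < 1" and t: "t \<in> cliques (\<sigma> \<rightarrow> TNat)"
    and x: "x \<in> cliques \<sigma>" and y: "y \<in> cliques \<sigma>"
  shows "\<bar>enn2real (fun_app t (scale p x) (PNat n)) - enn2real (fun_app t (scale p y) (PNat n))\<bar>
    \<le> of_rat p / (1 - of_rat p) * pcs_dist (ty_sem \<sigma>) x y"
proof -
  define K :: real where "K = of_rat p / (1 - of_rat p)"
  have K: "0 \<le> K" using p by (simp add: K_def)
  define F where "F v = enn2real (fun_app t (scale p v) (PNat n))" for v
  define z where "z = (\<lambda>a. min (x a) (y a))"
  define nx where "nx = pcs_norm (ty_sem \<sigma>) (\<lambda>a. x a - z a)"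
  define ny where "ny = pcs_norm (ty_sem \<sigma>) (\<lambda>a. y a - z a)"
  have mono: "F z \<le> F v" if "v \<in> cliques \<sigma>" "\<And>a. z a \<le> v a" for v
  proof -
    have "fun_app t (scale p v) (PNat n) < \<infinity>"
      using p that by (intro clique_finite[OF clique_fun_app[OF t scale_clique]]) auto
    then show ?thesis
      unfolding F_def scale_def using that(2)
      by (intro enn2real_mono fun_app_mono mult_left_mono) (auto simp: scale_def)
  qed
  have "F x - F z \<le> K * nx" "F y - F z \<le> K * ny"
    unfolding F_def K_def nx_def ny_def
    by (intro scaled_difference_le_norm[OF p t] x y; simp add: z_def)+
  moreover have "F z \<le> F x" "F z \<le> F y" by (intro mono x y; simp add: z_def)+
  moreover have "0 \<le> nx" "0 \<le> ny"
    unfolding nx_def ny_def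
    by (rule pcs_norm_nonneg[OF clique_downward[OF x]] pcs_norm_nonneg[OF clique_downward[OF y]],
        simp add: diff_le_self_ennreal)+
  then have "0 \<le> K * nx" "0 \<le> K * ny" using K by simp_all
  ultimately have "\<bar>F x - F y\<bar> \<le> K * nx + K * ny" by linarith
  then show ?thesis
    by (simp add: F_def K_def nx_def ny_def z_def pcs_dist_def distrib_left)
qed

text \<open>The iteration of the identity starts at 0 and never leaves it.\<close>

lemma sem_Omega:
  assumes "env_ok \<Gamma> \<rho>"
  shows "sem \<Gamma> (Omega \<sigma>) \<rho> = (\<lambda>_. 0)"
proof -
  have "fun_app (sem \<Gamma> (Lam 0 \<sigma> (Var 0)) \<rho>) (\<lambda>_. 0) = (\<lambda>_. 0)"
    using fun_app_sem_Lam[OF T_Var assms clique_zero, of 0 \<sigma> 0 \<sigma>] by simp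
  then have "(fun_app (sem \<Gamma> (Lam 0 \<sigma> (Var 0)) \<rho>) ^^ n) (\<lambda>_. 0) = (\<lambda>_. 0)" for n
    by (induction n) (simp_all del: sem.simps(9))
  then show ?thesis by (simp add: Omega_def del: sem.simps(9))
qed

text \<open>The machine contracts the abstraction in \<open>tamed\<close> first, and adequacy is
  applied to the closed term \<open>?B\<close>. There \<open>coin\<close> puts mass p on 0 and
  \<open>Omega\<close> denotes 0, so the conditional denotes p times the denotation of M.\<close>

lemma prob0_tamed:
  assumes p: "0 \<le> p" "p \<le> 1" and C: "C \<in> closed_terms (\<sigma> \<rightarrow> TNat)" and M: "M \<in> closed_terms \<sigma>"
  shows "prob0 (App (tamed p \<sigma> C) M)
    = enn2real (fun_app (closed_sem C) (scale p (closed_sem M)) (PNat 0))"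
proof -
  let ?B = "App C (If (Coin p) M (Omega \<sigma>))"
  have Omega: "Map.empty \<turnstile> Omega \<sigma> : \<sigma>"
    unfolding Omega_def by (intro typing.intros) simp
  have B: "?B \<in> closed_terms TNat"
    using p C M Omega unfolding closed_terms_def by (auto intro: typing.intros)
  \<comment> \<open>The contraction substitutes for variable 0 inside C too, which is harmless
    because C is closed. In \<open>Omega\<close> the variable 0 is bound, so it also stays as it
    is.\<close>
  have "subst 0 M C = C" using inert_closed[OF C] by (simp add: inert_def)
  then have "ev_lim (App (tamed p \<sigma> C) M, []) = ev_lim (?B, [])"
    by (simp add: ev_lim_step tamed_def Omega_def)
  also have "\<dots> = closed_sem ?B (PNat 0)" by (rule ev_lim_closed[OF B])
  also have "closed_sem ?B = fun_app (closed_sem C) (scale p (closed_sem M))"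
    by (simp add: closed_sem_def sem_Omega env_ok_def scale_def dirac_def)
  finally have ev: "ev_lim (App (tamed p \<sigma> C) M, [])
      = fun_app (closed_sem C) (scale p (closed_sem M)) (PNat 0)" .
  have "fun_app (closed_sem C) (scale p (closed_sem M)) (PNat 0) < \<infinity>"
    by (intro clique_finite[OF clique_fun_app[OF closed_sem_clique[OF C]]]
        scale_clique p closed_sem_clique M)
  moreover have "coins_ok (App (tamed p \<sigma> C) M)"
    using p C M by (simp add: closed_terms_def tamed_def Omega_def coins_ok_typing)
  ultimately show ?thesis using prob0_eq_ev_lim[of "App (tamed p \<sigma> C) M"] by (simp add: ev)
qed

theorem theorem4p1:
  fixes p :: rat and M M' :: tm and \<sigma> :: ty
  assumes "0 \<le> p" and "p < 1"
    and "M \<in> closed_terms \<sigma>" and "M' \<in> closed_terms \<sigma>"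
  shows "d_obs p \<sigma> M M' \<le>
    of_rat p / (1 - of_rat p) * pcs_dist (ty_sem \<sigma>) (closed_sem M) (closed_sem M')"
  unfolding d_obs_def
proof (rule cSUP_least)
  have "Lam 0 \<sigma> (Num 0) \<in> closed_terms (\<sigma> \<rightarrow> TNat)"
    unfolding closed_terms_def by (auto intro: typing.intros)
  then show "closed_terms (\<sigma> \<rightarrow> TNat) \<noteq> {}" by blast
next
  fix C assume C: "C \<in> closed_terms (\<sigma> \<rightarrow> TNat)"
  show "\<bar>prob0 (App (tamed p \<sigma> C) M) - prob0 (App (tamed p \<sigma> C) M')\<bar>
      \<le> of_rat p / (1 - of_rat p) * pcs_dist (ty_sem \<sigma>) (closed_sem M) (closed_sem M')"
    unfolding prob0_tamed[OF assms(1) less_imp_le[OF assms(2)] C assms(3)]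
      prob0_tamed[OF assms(1) less_imp_le[OF assms(2)] C assms(4)]
    by (intro scaled_difference_le_dist closed_sem_clique C assms)
qed

end
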